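(* Let $r\ge 3$ be an integer and let $D=D_1\sqcup\ldots\sqcup D_r$ be the disjoint union of $r$ disks of dimension $r-1$. Then there is a proper general position PL map $f\colon D\to B^r$ such that $fD_1\cdot\ldots\cdot fD_r=0$ but there is no proper general position PL map $f'\colon D\to B^r$ such that $f'=f$ on $\partial D$ and $f'D_1\cap\ldots\cap f'D_r=\emptyset$.
   Context: PL means piecewise linear. $B^d=[0,1]^d$ is the standard PL ball, $S^{d-1}=\partial B^d$, and disks are PL balls. A map $f\colon M\to B^d$ from a manifold with boundary is proper if $f^{-1}(S^{d-1})=\partial M$. Algebraic $r$-intersection number: orient each $D_j$. By general position $fD_1\cap\ldots\cap fD_r$ is a finite set of points $y$, each having exactly one preimage $y_j$ in each $D_j$, and $f$ is affine on a neighborhood $U_j$ of $y_j$. Take a positive normal vector to the oriented hyperplane piece $fU_j$ for each $j$; the $r$-intersection sign of $y$ is the sign $\pm1$ of the basis of $\mathbb{R}^{r}$ formed by these $r$ vectors (in order). $fD_1\cdot\ldots\cdot fD_r\in\mathbb{Z}$ is the sum of the $r$-intersection signs of all points $y\in fD_1\cap\ldots\cap fD_r$. Its vanishing does not depend on the orientations. *)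

theory Defs
  imports "HOL-Analysis.Analysis"
begin

text \<open>
  With \<open>r = CARD('m option) = CARD('m) + 1\<close>, the space \<open>real ^ 'm\<close> is \<open>(r-1)\<close>-dimensional and
  \<open>real ^ 'm option\<close> is \<open>r\<close>-dimensional.  The \<open>r\<close> disks are indexed by \<open>'m option\<close> as well.
  A map \<open>D = D\<^sub>1 \<squnion> \<dots> \<squnion> D\<^sub>r \<rightarrow> B\<^sup>r\<close>, each \<open>D\<^sub>j\<close> being a copy of the standard PL ball of
  dimension \<open>r-1\<close>, is a family \<open>f\<close> whose member \<open>f j\<close> is the restriction to \<open>D\<^sub>j\<close>; the values
  of \<open>f j\<close> outside the ball are irrelevant.
\<close>

abbreviation std_ball :: "(real ^ 'n) set"
  where "std_ball \<equiv> cbox 0 1"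

abbreviation std_sphere :: "(real ^ 'n) set"
  where "std_sphere \<equiv> frontier std_ball"

type_synonym 'm disks_map = "'m option \<Rightarrow> real ^ 'm \<Rightarrow> real ^ 'm option"

definition proper_disks_map :: "'m::finite disks_map \<Rightarrow> bool"
  where "proper_disks_map f \<longleftrightarrow>
    (\<forall>j. f j ` std_ball \<subseteq> std_ball \<and> {x \<in> std_ball. f j x \<in> std_sphere} = std_sphere)"


subsection \<open>Piecewise linear maps and general position\<close>

definition cell_complex :: "'a::euclidean_space set set \<Rightarrow> bool"
  where "cell_complex K \<longleftrightarrow>
    finite K \<and>
    (\<forall>C\<in>K. polytope C) \<and>
    (\<forall>C\<in>K. \<forall>F. F face_of C \<longrightarrow> F \<in> K) \<and>
    (\<forall>C\<in>K. \<forall>C'\<in>K. (C \<inter> C') face_of C \<and> (C \<inter> C') face_of C')"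

definition affine_map_on :: "'a::real_vector set \<Rightarrow> ('a \<Rightarrow> 'b::real_vector) \<Rightarrow> bool"
  where "affine_map_on S f \<longleftrightarrow> (\<exists>L c. linear L \<and> (\<forall>x\<in>S. f x = L x + c))"

text \<open>\<open>f\<close> is PL, being affine on each cell of the cell complexes \<open>K j\<close> which subdivide the disks.\<close>

definition PL_disks_map :: "('m option \<Rightarrow> (real ^ 'm) set set) \<Rightarrow> 'm::finite disks_map \<Rightarrow> bool"
  where "PL_disks_map K f \<longleftrightarrow>
    (\<forall>j. cell_complex (K j) \<and> \<Union>(K j) = std_ball \<and> (\<forall>C\<in>K j. affine_map_on C (f j)))"

text \<open>For finite unions of polytopes this is the usual bound on the dimension
  (\<open>d < 0\<close> means that the set is empty).\<close>

definition dim_at_most :: "'a::euclidean_space set \<Rightarrow> int \<Rightarrow> bool"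
  where "dim_at_most X d \<longleftrightarrow>
    (\<exists>\<A>. finite \<A> \<and> X \<subseteq> \<Union>\<A> \<and> (\<forall>A\<in>\<A>. affine A \<and> aff_dim A \<le> d))"

definition boundary_multiple_points :: "'m::finite disks_map \<Rightarrow> nat \<Rightarrow> (real ^ 'm option) set"
  where "boundary_multiple_points f k =
    {y. \<exists>P. finite P \<and> card P = k \<and> (\<forall>(j, x)\<in>P. x \<in> std_sphere \<and> f j x = y)}"

text \<open>
  PL general position.  First, \<open>f\<close> is nondegenerate.  Second, over the interior of the ball, the
  images of any distinct open cells (of the same disk or of different disks) intersect in a set
  of at most the expected dimension: codimensions in \<open>\<real>\<^sup>r\<close> add up, and the intersection is empty
  when the expected dimension is negative.  Third, the restriction \<open>\<partial>D \<rightarrow> S\<^sup>r\<^sup>-\<^sup>1\<close>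
  is in general position: the \<open>k\<close>-fold points of this codimension one map form a set of dimension
  at most \<open>(r - 1) - k\<close>.  The boundary condition is phrased with multiple points because cells
  mapped to the same facet of the cube lie in a common hyperplane, so that they cannot be asked
  to be in general position in \<open>\<real>\<^sup>r\<close>.
\<close>

definition general_position_wrt :: "('m option \<Rightarrow> (real ^ 'm) set set) \<Rightarrow> 'm::finite disks_map \<Rightarrow> bool"
  where "general_position_wrt K f \<longleftrightarrow>
    (\<forall>j. \<forall>C\<in>K j. inj_on (f j) C) \<and>
    (\<forall>\<S>. finite \<S> \<and> (\<forall>(j, C)\<in>\<S>. C \<in> K j \<and> C \<inter> interior std_ball \<noteq> {}) \<longrightarrow>
       aff_dim (\<Inter>(j, C)\<in>\<S>. f j ` rel_interior C)
         \<le> max (-1) (int CARD('m option) - (\<Sum>(j, C)\<in>\<S>. int CARD('m option) - aff_dim C))) \<and>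
    (\<forall>k\<ge>1. dim_at_most (boundary_multiple_points f k) (int CARD('m option) - 1 - int k))"

definition general_position_PL :: "'m::finite disks_map \<Rightarrow> bool"
  where "general_position_PL f \<longleftrightarrow> (\<exists>K. PL_disks_map K f \<and> general_position_wrt K f)"


subsection \<open>The algebraic intersection number\<close>

definition common_points :: "'m::finite disks_map \<Rightarrow> (real ^ 'm option) set"
  where "common_points f = (\<Inter>j. f j ` std_ball)"

text \<open>
  Each disk carries the standard orientation of \<open>\<real>\<^sup>r\<^sup>-\<^sup>1\<close>.  A normal \<open>n\<close> to the image of the linear
  map \<open>L\<close> is positive if \<open>n\<close> followed by the images of the standard basis vectors is a positive
  basis of \<open>\<real>\<^sup>r\<close>; the index \<open>None\<close> is the column of \<open>n\<close>.
\<close>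

definition positive_normal :: "(real ^ 'm \<Rightarrow> real ^ 'm option) \<Rightarrow> real ^ 'm::finite option \<Rightarrow> bool"
  where "positive_normal L n \<longleftrightarrow>
    (\<forall>v. n \<bullet> L v = 0) \<and>
    det (\<chi> a b. (case b of None \<Rightarrow> n | Some i \<Rightarrow> L (axis i 1)) $ a) > 0"

text \<open>
  For \<open>f\<close> in general position and a common point \<open>y\<close>, the preimage of \<open>y\<close> in each disk is unique,
  \<open>f j\<close> is affine near it, and the derivative is the linear part.  Positive normals are unique
  up to positive factors, so the choice does not affect the sign.
\<close>

definition preimage_point :: "'m::finite disks_map \<Rightarrow> real ^ 'm option \<Rightarrow> 'm option \<Rightarrow> real ^ 'm"
  where "preimage_point f y j = (THE x. x \<in> std_ball \<and> f j x = y)"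

definition normal_at :: "'m::finite disks_map \<Rightarrow> real ^ 'm option \<Rightarrow> 'm option \<Rightarrow> real ^ 'm option"
  where "normal_at f y j =
    (SOME n. positive_normal (frechet_derivative (f j) (at (preimage_point f y j))) n)"

definition intersection_sign :: "'m::finite disks_map \<Rightarrow> real ^ 'm option \<Rightarrow> int"
  where "intersection_sign f y = (if det (\<chi> j. normal_at f y j) > 0 then 1 else - 1)"

definition algebraic_intersection_number :: "'m::finite disks_map \<Rightarrow> int"
  where "algebraic_intersection_number f = (\<Sum>y\<in>common_points f. intersection_sign f y)"

end

theory Submission
  imports Defs "HOL-Homology.Homology"
begin

text \<open>
  All disks of the example are hyperplane pieces \<open>y\<^sub>j = const\<close> except two, which are products of a
  polygonal path in a plane with a cube, up to a shear: one path is a V, the other one crosses itself once.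
  All disks meet in two points with opposite signs, lying on different branches of the
  self-crossing disk.

  Let \<open>f'\<close> be proper with the same boundary values as \<open>f\<close>.  If a path \<open>c\<close> joins two boundary points of the
  ball and meets \<open>f D\<^sub>j\<close> once, or twice with the same sign, then its ends lie in different
  components of the complement of \<open>f' D\<^sub>j\<close>.  Otherwise pushing \<open>f\<close> to \<open>f'\<close> and \<open>c\<close> to a path missing
  \<open>f' D\<^sub>j\<close> would deform \<open>f x - c t\<close>, which has degree one or two, into a map without
  zeros.  The self-crossing disk has complementary regions at levels 0, 1 and 2, the level changing by
  one at each branch.  A function which vanishes on \<open>f' D\<^sub>j\<close> and is positive precisely on the
  component of a base point of level 2 is therefore negative at the boundary points of levels 0 and 1:
  it does not change its sign at the second branch.

  Such functions \<open>\<phi>\<^sub>j\<close>, one for each disk, form a map \<open>\<phi>\<close> from the ball to \<open>\<real>\<^sup>r\<close> whose zeros are the common points of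
  the images \<open>f' D\<^sub>j\<close>.  On the boundary \<open>\<phi>\<close> is homotopic, avoiding 0, to an affine isomorphism with a zero inside the
  ball.  Hence \<open>\<phi>\<close> has a zero.
\<close>

subsection \<open>Maps of nonzero degree have zeros\<close>

text \<open>The algebraic number is zero, so the obstruction has to see just one of the two common
  points. In the slice where \<open>None\<close> is 3/8 and all flat coordinates are 1/2, let v and
  w be the coordinates \<open>Some i1\<close> and \<open>Some i2\<close>. There the V is the pair of
  lines v = 3/7 and v = 4/7, and two branches of the loop are v = 3/8 + w/8 and v = 13/24 + w/8. As
  w runs from 0 to 1, the level of the loop falls from 1 to 0 on v = 3/7 and from 2 to 1 on v = 4/7.
  The arms of the V have opposite signs, so the two losses cancel. Cutting between levels 1 and 2
  keeps only the loss on v = 4/7, and the count becomes one. This cut has to survive the passage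
  from \<open>f\<close> to \<open>f'\<close>: the boundary point of level 2 must remain separated
  from those of levels 1 and 0. Levels 2 and 0 have the same parity, so intersection numbers mod 2
  cannot separate them; a path joining them has intersection number two, which is visible over the
  integers. Three coordinates enter, which is where r >= 3 comes from.\<close>

lemma iso_surjE:
  assumes "h \<in> iso G H" "y \<in> carrier H"
  obtains x where "x \<in> carrier G" "h x = y"
proof -
  have "y \<in> h ` carrier G" using assms by (simp add: iso_iff)
  then show thesis using that by blast
qed

text \<open>The frontier is a sphere, so the group is infinite cyclic and \<open>c\<close> is the
  image of 1. A class of infinite order replaces an integer-valued degree, for which generators
  would have to be chosen on both sides. Homology groups are written multiplicatively, so multiples
  are powers.\<close>

lemma infinite_order_frontier:
  fixes Q :: "'a::euclidean_space set"
  assumes "convex Q" "compact Q" and ne: "interior Q \<noteq> {}" and D: "DIM('a) \<ge> 2"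
  obtains c where "c \<in> carrier (reduced_homology_group (int (DIM('a)) - 1) (top_of_set (frontier Q)))"
    "\<And>k::nat. k > 0 \<Longrightarrow> pow (reduced_homology_group (int (DIM('a)) - 1) (top_of_set (frontier Q))) c k
        \<noteq> one (reduced_homology_group (int (DIM('a)) - 1) (top_of_set (frontier Q)))"
proof -
  let ?n = "DIM('a) - 1"
  let ?H = "reduced_homology_group (int (DIM('a)) - 1) (top_of_set (frontier Q))"
  have n: "int (DIM('a)) - 1 = int ?n" using D by auto
  obtain f :: "(nat \<Rightarrow> real) \<Rightarrow> 'a" and g where
    "homeomorphic_maps (nsphere (DIM('a) - 1)) (top_of_set (sphere 0 1 \<inter> span (Basis::'a set))) f g"
    using homeomorphic_maps_nsphere_euclidean_sphere[OF independent_Basis orthogonal_Basis refl _ norm_Basis]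
    by (metis DIM_positive less_numeral_extra(3))
  then have 1: "nsphere ?n homeomorphic_space top_of_set (sphere (0::'a) 1)"
    unfolding homeomorphic_space_def by auto
  have "rel_frontier Q homeomorphic rel_frontier (cball (0::'a) 1)"
    using assms aff_dim_nonempty_interior[OF ne]
    by (intro homeomorphic_rel_frontiers_convex_bounded_sets)
       (auto simp: compact_imp_bounded aff_dim_cball)
  then have "frontier Q homeomorphic sphere (0::'a) 1"
    using rel_frontier_nonempty_interior[OF ne] rel_frontier_nonempty_interior[of "cball (0::'a) 1"]
    by simp
  then have "top_of_set (frontier Q) homeomorphic_space nsphere ?n"
    using 1 by (meson homeomorphic_space_iff_homeomorphic homeomorphic_space_sym homeomorphic_space_trans)
  then have "?H \<cong> integer_group"
    unfolding n by (meson homeomorphic_space_imp_isomorphic_reduced_homology_groups iso_trans reduced_homology_group_nsphere(1))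
  then have "integer_group \<cong> ?H"
    by (simp add: group.iso_sym)
  then obtain h where h: "h \<in> iso integer_group ?H"
    unfolding is_iso_def by blast
  interpret group_hom integer_group ?H h
    using h by (simp add: group_hom_axioms_def group_hom_def iso_imp_homomorphism)
  show thesis
  proof
    show "h 1 \<in> carrier ?H" by simp
    fix k :: nat assume "k > 0"
    have "pow ?H (h 1) k = h (pow integer_group 1 k)"
      by (rule hom_nat_pow [symmetric]) simp
    also have "pow integer_group (1::int) k = int k"
      by (induct k) (auto simp: nat_pow_def integer_group_def)
    finally show "pow ?H (h 1) k \<noteq> one ?H"
      using h \<open>k > 0\<close> hom_one inj_onD[of h UNIV "int k" 0]
      by (auto simp: iso_def bij_betw_def)
  qed
qed

text \<open>On the frontier, the affine map has a left inverse: undo it, then retract the punctured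
  space. Hence it is injective on homology, and contractibility of \<open>Q\<close> lifts the class
  of the frontier to a relative one. The types \<open>'a\<close> and \<open>'b\<close> differ
  because \<open>Q\<close> will also be a prism over a disk, mapped to the target of the
  disks.\<close>

lemma linear_map_infinite_order:
  fixes Q :: "'a::euclidean_space set" and L :: "'a \<Rightarrow> 'b::euclidean_space"
  assumes Q: "convex Q" "compact Q" and z: "z \<in> interior Q" and D: "DIM('a) \<ge> 2" "DIM('b) = DIM('a)"
    and L: "linear L" "inj L"
  obtains c where "c \<in> carrier (relative_homology_group (DIM('a)) (top_of_set Q) (frontier Q))"
    "\<And>k::nat. k > 0 \<Longrightarrow> pow (relative_homology_group (DIM('a)) euclidean (-{0}))
        (hom_induced (DIM('a)) (top_of_set Q) (frontier Q) euclidean (-{0}) (\<lambda>x. L (x - z)) c) k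
        \<noteq> one (relative_homology_group (DIM('a)) (euclidean::'b topology) (-{0}))"
proof -
  let ?p = "int (DIM('a))"
  let ?X = "top_of_set Q" and ?S = "frontier Q"
  let ?t = "\<lambda>x. L (x - z)"
  let ?H = "reduced_homology_group (?p - 1) (top_of_set ?S)"
  let ?R = "relative_homology_group ?p ?X ?S"
  let ?RB = "relative_homology_group ?p (euclidean::'b topology) (-{0})"
  let ?HB = "homology_group (?p - 1) (subtopology (euclidean::'b topology) (-{0}))"
  have ne: "interior Q \<noteq> {}" using z by auto
  have SQ: "?S \<subseteq> Q" using Q by (simp add: compact_imp_closed frontier_subset_closed)
  have sub: "subtopology ?X ?S = top_of_set ?S"
    using SQ by (simp add: subtopology_subtopology inf.absorb2)
  have Sne: "?S \<noteq> {}" using Q ne compact_frontier_bounded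
    by (metis compact_imp_bounded frontier_eq_empty interior_empty not_bounded_UNIV)
  have ctr: "contractible_space ?X"
    using Q by (simp add: convex_imp_contractible contractible_space_top_of_set)
  obtain d where d: "d \<in> carrier ?H" "\<And>k::nat. k > 0 \<Longrightarrow> pow ?H d k \<noteq> one ?H"
    using infinite_order_frontier[OF Q ne D(1)] by metis
  have iso: "hom_boundary ?p ?X ?S \<in> iso ?R ?H"
    using iso_relative_homology_of_contractible[OF ctr, of ?S ?p] SQ Sne sub by auto
  then obtain c where c: "c \<in> carrier ?R" "hom_boundary ?p ?X ?S c = d"
    using d(1) by (rule iso_surjE)
  obtain L' where L': "linear L'" "\<And>x. L' (L x) = x"
    using linear_injective_left_inverse[OF L] by (auto simp: fun_eq_iff)
  have "dim (range L) = DIM('b)"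
    using dim_image_eq[of L UNIV] L D by simp
  moreover have "subspace (range L)" using L(1) by (simp add: linear_subspace_image)
  ultimately have surj: "range L = UNIV"
    by (metis dim_eq_full span_eq_iff)
  have L'0: "L' w \<noteq> 0" if "w \<noteq> 0" for w
  proof -
    obtain x where "w = L x" using surj by (metis rangeE UNIV_I)
    then show ?thesis using that L'(2) L(1) linear_0 by metis
  qed
  have "rel_frontier Q retract_of (affine hull Q - {z})"
    using Q z by (intro rel_frontier_retract_of_punctured_affine_hull)
     (auto simp: compact_imp_bounded rel_interior_nonempty_interior ne)
  then have "?S retract_of (UNIV - {z})"
    using ne by (simp add: rel_frontier_nonempty_interior affine_hull_nonempty_interior)
  then obtain r where r: "retraction (UNIV - {z}) ?S r" unfolding retract_of_def by blast
  let ?r = "\<lambda>w. r (z + L' w)"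
  have contr: "continuous_map (subtopology euclidean (-{0})) (top_of_set ?S) ?r"
  proof -
    have "continuous_on (-{0}) ?r"
    proof (rule continuous_on_compose2[of "UNIV - {z}" r])
      show "continuous_on (UNIV - {z}) r" using r by (auto simp: retraction_def)
      show "continuous_on (-{0}) (\<lambda>w. z + L' w)"
        using L'(1) by (intro continuous_on_add continuous_on_const linear_continuous_on)
          (simp add: linear_conv_bounded_linear)
      show "(\<lambda>w. z + L' w) ` (-{0}) \<subseteq> UNIV - {z}" using L'0 by auto
    qed
    moreover have "?r w \<in> ?S" if "w \<noteq> 0" for w
      using r L'0[OF that] unfolding retraction_def by (auto simp: Pi_iff)
    ultimately show ?thesis by (auto simp: Pi_iff)
  qed
  have zS: "z \<notin> ?S" using z by (simp add: frontier_def)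
  have contt: "continuous_on A ?t" for A
    by (rule linear_continuous_on_compose[OF _ L(1)]) (intro continuous_intros)
  have tS: "?t \<in> ?S \<rightarrow> -{0}"
    using zS L by (auto simp: Pi_iff linear_injective_0)
  have contt': "continuous_map (top_of_set ?S) (subtopology euclidean (-{0})) ?t"
    using contt tS by (auto simp: Pi_iff)
  have rt: "?r (?t x) = x" if "x \<in> ?S" for x
    using r that L' unfolding retraction_def by auto
  let ?u = "hom_induced ?p ?X ?S euclidean (-{0}) ?t c"
  have nat: "hom_boundary ?p (euclidean::'b topology) (-{0}) ?u
     = hom_induced (?p - 1) (top_of_set ?S) {} (subtopology euclidean (-{0})) {} ?t d"
    using naturality_hom_induced[of ?X euclidean ?t ?S "-{0}" ?p] contt tS c(2)
    by (auto simp: sub fun_eq_iff o_def)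
  have pm1: "?p - 1 \<noteq> 0" using D by auto
  have Heq: "?H = homology_group (?p - 1) (top_of_set ?S)"
    using pm1 by (rule un_reduced_homology_group)
  show thesis
  proof
    show "c \<in> carrier ?R" by fact
    fix k :: nat assume k: "k > 0"
    show "pow ?RB ?u k \<noteq> one ?RB"
    proof
      assume eq: "pow ?RB ?u k = one ?RB"
      interpret b: group_hom ?RB ?HB "hom_boundary ?p (euclidean::'b topology) (-{0})"
        by (simp add: group_hom_axioms_def group_hom_def hom_boundary_hom)
      interpret rr: group_hom ?HB ?H "hom_induced (?p - 1) (subtopology euclidean (-{0})) {} (top_of_set ?S) {} ?r"
        unfolding Heq by (simp add: group_hom_axioms_def group_hom_def hom_induced_hom)
      have u: "?u \<in> carrier ?RB" by (simp add: hom_induced_carrier)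
      let ?v = "hom_boundary ?p (euclidean::'b topology) (-{0}) ?u"
      have v: "?v \<in> carrier ?HB" using u by simp
      have "pow ?HB ?v k = one ?HB"
        using eq b.hom_nat_pow[OF u, of k] b.hom_one by metis
      then have "pow ?H (hom_induced (?p - 1) (subtopology euclidean (-{0})) {} (top_of_set ?S) {} ?r ?v) k = one ?H"
        using rr.hom_nat_pow[OF v, of k] rr.hom_one by metis
      moreover have "hom_induced (?p - 1) (subtopology euclidean (-{0})) {} (top_of_set ?S) {} ?r ?v = d"
      proof -
        have "hom_induced (?p - 1) (subtopology euclidean (-{0})) {} (top_of_set ?S) {} ?r ?v
          = hom_induced (?p - 1) (top_of_set ?S) {} (top_of_set ?S) {} (?r \<circ> ?t) d"
          unfolding nat by (rule hom_induced_compose'[OF contt' _ contr]) auto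
        also have "\<dots> = d"
        proof (rule hom_induced_id_gen)
          show "continuous_map (top_of_set (frontier Q)) (top_of_set (frontier Q)) (?r \<circ> ?t)"
            using contt' contr by (rule continuous_map_compose)
          show "(?r \<circ> ?t) x = x" if "x \<in> topspace (top_of_set (frontier Q))" for x
            using rt that by simp
          show "d \<in> carrier (homology_group (?p - 1) (top_of_set (frontier Q)))"
            using d(1) unfolding Heq .
        qed
        finally show ?thesis .
      qed
      ultimately show False using d(2)[OF k] by simp
    qed
  qed
qed

section \<open>Local homology at isolated zeros\<close>

lemma excision_point:
  fixes S :: "'a::t1_space set"
  assumes B: "openin (top_of_set S) B" and z: "z \<in> B"
  shows "hom_induced p (top_of_set B) (B - {z}) (top_of_set S) (S - {z}) id
    \<in> iso (relative_homology_group p (top_of_set B) (B - {z}))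
          (relative_homology_group p (top_of_set S) (S - {z}))"
proof -
  have BS: "B \<subseteq> S" using B by (rule openin_imp_subset)
  have "closedin (top_of_set S) (S - B)"
    using closedin_diff[OF closedin_topspace B] by simp
  moreover have "openin (top_of_set S) (S - {z})"
    by (metis (no_types, lifting) Diff_eq open_Compl closed_singleton openin_open_Int)
  ultimately have cl: "(top_of_set S) closure_of (S - B) \<subseteq> (top_of_set S) interior_of (S - {z})"
    using z by (simp add: closure_of_closedin interior_of_openin) blast
  have eq: "S - (S - B) = B" "(S - {z}) - (S - B) = B - {z}" "S \<inter> B = B" using BS by auto
  show ?thesis
    using homology_excision_axiom[OF cl Diff_subset, of p]
    by (simp add: eq subtopology_subtopology)
qed

text \<open>The class \<open>a1\<close> is chosen to agree with \<open>a\<close> once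
  \<open>z2\<close> is forgotten. By exactness of the triple Q, Q - {z1}, Q - {z1,z2}, the rest of
  \<open>a\<close> comes from the pair of the last two sets, which excision shrinks to
  \<open>B2\<close>.\<close>

lemma relative_class_two_points:
  fixes Q :: "'a::t1_space set"
  assumes B: "openin (top_of_set Q) B1" "openin (top_of_set Q) B2"
    and z: "z1 \<in> B1" "z2 \<in> B2" and disj: "B1 \<inter> B2 = {}"
    and a: "a \<in> carrier (relative_homology_group p (top_of_set Q) (Q - {z1,z2}))"
  obtains a1 a2 where "a1 \<in> carrier (relative_homology_group p (top_of_set B1) (B1 - {z1}))"
    "a2 \<in> carrier (relative_homology_group p (top_of_set B2) (B2 - {z2}))"
    "a = monoid.mult (relative_homology_group p (top_of_set Q) (Q - {z1,z2}))
        (hom_induced p (top_of_set B2) (B2 - {z2}) (top_of_set Q) (Q - {z1,z2}) id a2)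
        (hom_induced p (top_of_set B1) (B1 - {z1}) (top_of_set Q) (Q - {z1,z2}) id a1)"
proof -
  let ?X = "top_of_set Q" and ?A = "Q - {z1,z2}" and ?A1 = "Q - {z1}"
  let ?H = "relative_homology_group p ?X ?A" and ?H1 = "relative_homology_group p ?X ?A1"
  let ?G1 = "relative_homology_group p (top_of_set B1) (B1 - {z1})"
  let ?G2 = "relative_homology_group p (top_of_set B2) (B2 - {z2})"
  let ?j = "hom_induced p ?X ?A ?X ?A1 id"
  let ?i1 = "hom_induced p (top_of_set B1) (B1 - {z1}) ?X ?A id"
  let ?i2 = "hom_induced p (top_of_set B2) (B2 - {z2}) ?X ?A id"
  have BQ: "B1 \<subseteq> Q" "B2 \<subseteq> Q" using B openin_imp_subset by blast+
  have sub: "subtopology ?X ?A1 = top_of_set ?A1"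
    by (simp add: subtopology_subtopology inf.absorb2 Diff_subset)
  have c1: "continuous_map (top_of_set B1) ?X id" "continuous_map (top_of_set B2) ?X id"
    "continuous_map (top_of_set ?A1) ?X id" "continuous_map (top_of_set B2) (top_of_set ?A1) id"
    using BQ disj z by auto
  have s1: "id \<in> B1 - {z1} \<rightarrow> ?A" "id \<in> B2 - {z2} \<rightarrow> ?A" "id \<in> ?A \<rightarrow> ?A1"
    using BQ disj z by auto
  have "hom_induced p (top_of_set B1) (B1 - {z1}) ?X ?A1 id \<in> iso ?G1 ?H1"
    by (rule excision_point[OF B(1) z(1)])
  then obtain a1 where a1: "a1 \<in> carrier ?G1"
      "hom_induced p (top_of_set B1) (B1 - {z1}) ?X ?A1 id a1 = ?j a"
    by (rule iso_surjE) (rule hom_induced_carrier)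
  interpret j: group_hom ?H ?H1 ?j
    by (simp add: group_hom_axioms_def group_hom_def hom_induced_hom)
  have i1: "?i1 a1 \<in> carrier ?H" by (rule hom_induced_carrier)
  have "?j (?i1 a1) = ?j a"
    using hom_induced_compose'[OF c1(1) s1(1) continuous_map_id s1(3)] a1(2) by simp
  define b where "b = monoid.mult ?H a (m_inv ?H (?i1 a1))"
  have b: "b \<in> carrier ?H" unfolding b_def using a i1 by simp
  have "?j b = one ?H1"
    unfolding b_def using a i1 \<open>?j (?i1 a1) = ?j a\<close> by simp
  then have "b \<in> kernel ?H ?H1 ?j" using b by (simp add: kernel_def)
  moreover have "?A \<subseteq> ?A1" by auto
  note homology_exactness_triple_3[OF this, of p ?X]
  ultimately have "b \<in> hom_induced p (top_of_set ?A1) ?A ?X ?A id ` carrier (relative_homology_group p (top_of_set ?A1) ?A)"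
    unfolding sub by simp
  then obtain b' where b': "b' \<in> carrier (relative_homology_group p (top_of_set ?A1) ?A)"
      "b = hom_induced p (top_of_set ?A1) ?A ?X ?A id b'"
    by (rule imageE) (rule that)
  have "openin (top_of_set ?A1) B2"
    by (rule openin_subset_trans[OF B(2)]) (use BQ disj z in auto)
  from excision_point[OF this z(2), of p]
  have "hom_induced p (top_of_set B2) (B2 - {z2}) (top_of_set ?A1) ?A id
     \<in> iso ?G2 (relative_homology_group p (top_of_set ?A1) ?A)"
    by (simp add: Diff_insert2 [symmetric] insert_commute)
  then obtain a2 where a2: "a2 \<in> carrier ?G2"
      "hom_induced p (top_of_set B2) (B2 - {z2}) (top_of_set ?A1) ?A id a2 = b'"
    using b'(1) by (rule iso_surjE)
  have "?i2 a2 = b"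
    unfolding b'(2) a2(2)[symmetric]
    using hom_induced_compose'[OF c1(4) s1(2) c1(3), of ?A p a2] by simp
  then have "a = monoid.mult ?H (?i2 a2) (?i1 a1)"
    unfolding b_def using a i1 by (simp add: j.G.m_assoc)
  then show thesis using a1(1) a2(1) that by blast
qed

section \<open>Homotopies of maps of pairs: zeros are excluded on the frontier only\<close>

definition bd_homotopic :: "'a::euclidean_space set \<Rightarrow> ('a \<Rightarrow> 'b::euclidean_space) \<Rightarrow> ('a \<Rightarrow> 'b) \<Rightarrow> bool"
  where "bd_homotopic Q = homotopic_with (\<lambda>h. h \<in> frontier Q \<rightarrow> -{0}) (top_of_set Q) euclidean"

lemma bd_homotopic_trans: "bd_homotopic Q F G \<Longrightarrow> bd_homotopic Q G H \<Longrightarrow> bd_homotopic Q F H"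
  unfolding bd_homotopic_def by (rule homotopic_with_trans)

lemma bd_homotopic_segment:
  assumes "continuous_on Q F" "continuous_on Q G"
    and nz: "\<And>x s. x \<in> frontier Q \<Longrightarrow> 0 \<le> s \<Longrightarrow> s \<le> 1 \<Longrightarrow> (1 - s) *\<^sub>R F x + s *\<^sub>R G x \<noteq> 0"
  shows "bd_homotopic Q F G"
  unfolding bd_homotopic_def homotopic_with_def
proof (intro exI conjI ballI allI)
  let ?h = "\<lambda>(s, x). (1 - s) *\<^sub>R F x + s *\<^sub>R G x"
  have "continuous_on ({0..1} \<times> Q) ?h"
    unfolding case_prod_unfold
    by (intro continuous_intros continuous_on_compose2[OF assms(1)] continuous_on_compose2[OF assms(2)]) auto
  then show "continuous_map (prod_topology (top_of_set {0..1}) (top_of_set Q)) euclidean ?h"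
    by simp
  show "(\<lambda>x. ?h (s, x)) \<in> frontier Q \<rightarrow> - {0}" if "s \<in> {0..1}" for s
    using nz that by auto
qed auto

text \<open>The centre moves from \<open>z1\<close> to \<open>z2\<close> while the linear part moves
  from \<open>L1\<close> to \<open>L2\<close>. At each time the only zero is the moving centre,
  which convexity keeps off the frontier.\<close>

lemma bd_homotopic_linear_maps:
  fixes L1 L2 :: "'a::euclidean_space \<Rightarrow> 'b::euclidean_space"
  assumes Q: "convex Q" and z: "z1 \<in> interior Q" "z2 \<in> interior Q"
    and L: "linear L1" "linear L2"
    and nz: "\<And>s v. 0 \<le> s \<Longrightarrow> s \<le> 1 \<Longrightarrow> (1 - s) *\<^sub>R L1 v + s *\<^sub>R L2 v = 0 \<Longrightarrow> v = 0"
  shows "bd_homotopic Q (\<lambda>x. L1 (x - z1)) (\<lambda>x. L2 (x - z2))"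
  unfolding bd_homotopic_def homotopic_with_def
proof (intro exI conjI ballI allI)
  let ?c = "\<lambda>(s, x). x - ((1 - s) *\<^sub>R z1 + s *\<^sub>R z2)"
  let ?h = "\<lambda>y. (1 - fst y) *\<^sub>R L1 (?c y) + fst y *\<^sub>R L2 (?c y)"
  have c: "continuous_on ({0..1} \<times> Q) ?c"
    unfolding case_prod_unfold by (intro continuous_intros)
  have "continuous_on ({0..1} \<times> Q) ?h"
    by (intro continuous_on_add continuous_on_scaleR linear_continuous_on_compose[OF c] L)
       (intro continuous_intros)+
  then show "continuous_map (prod_topology (top_of_set {0..1}) (top_of_set Q)) euclidean ?h"
    by simp
  show "(\<lambda>x. ?h (s, x)) \<in> frontier Q \<rightarrow> - {0}" if "s \<in> {0..1}" for s
  proof -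
    have "(1 - s) *\<^sub>R z1 + s *\<^sub>R z2 \<in> interior Q"
      using that convexD[OF convex_interior[OF Q] z, of "1 - s" s] by auto
    then show ?thesis
      using nz[of s] that by (fastforce simp: frontier_def)
  qed
qed auto

context
  fixes Q :: "'a::euclidean_space set" and p :: int
begin

abbreviation (input) "pair_map f \<equiv> hom_induced p (top_of_set Q) (frontier Q) (euclidean :: 'b::euclidean_space topology) (- {0}) f"

text \<open>\<open>G\<close> factors through the pair of \<open>-{0}\<close> with itself, whose
  relative homology is trivial.\<close>

lemma hom_induced_nonvanishing:
  fixes G :: "'a \<Rightarrow> 'b::euclidean_space"
  assumes "continuous_on Q G" "\<And>x. x \<in> Q \<Longrightarrow> G x \<noteq> 0"
    and c: "c \<in> carrier (relative_homology_group p (top_of_set Q) (frontier Q))" and S: "frontier Q \<subseteq> Q"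
  shows "pair_map G c = one (relative_homology_group p (euclidean :: 'b topology) (- {0}))"
proof -
  let ?Y = "subtopology euclidean (- {0}) :: 'b topology"
  let ?H = "relative_homology_group p ?Y (- {0})"
  have G: "continuous_map (top_of_set Q) ?Y G" "G \<in> frontier Q \<rightarrow> -{0}"
    using assms by auto
  have "pair_map G c = hom_induced p ?Y (-{0}) euclidean (-{0}) id
     (hom_induced p (top_of_set Q) (frontier Q) ?Y (-{0}) G c)"
    using hom_induced_compose'[OF G continuous_map_from_subtopology[OF continuous_map_id], of "-{0}" p c] by simp
  moreover have "trivial_group ?H"
    using trivial_relative_homology_group_topspace[of p ?Y] by simp
  then have "hom_induced p (top_of_set Q) (frontier Q) ?Y (-{0}) G c = one ?H"
    using hom_induced_carrier[of p "top_of_set Q" "frontier Q" ?Y "-{0}" G c] by (simp only: trivial_group_def singleton_iff)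
  moreover have "hom_induced p ?Y (-{0}) euclidean (-{0}) id (one ?H)
     = one (relative_homology_group p (euclidean :: 'b topology) (- {0}))"
    by (intro hom_one[OF hom_induced_hom]) auto
  ultimately show ?thesis by simp
qed

lemma hom_induced_local:
  fixes F :: "'a \<Rightarrow> 'b::euclidean_space"
  assumes F: "continuous_on Q F" "\<And>x. x \<in> A \<Longrightarrow> F x \<noteq> 0" and L: "linear L" "inj L"
    and B: "B \<subseteq> Q" "A \<subseteq> Q" "B - {z} \<subseteq> A" "z \<notin> A"
    and FL: "\<And>x. x \<in> B \<Longrightarrow> F x = L (x - z)"
    and a: "a \<in> carrier (relative_homology_group p (top_of_set B) (B - {z}))"
  shows "hom_induced p (top_of_set Q) A euclidean (- {0}) F
      (hom_induced p (top_of_set B) (B - {z}) (top_of_set Q) A id a)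
    = hom_induced p (top_of_set Q) A euclidean (- {0}) (\<lambda>x. L (x - z))
      (hom_induced p (top_of_set B) (B - {z}) (top_of_set Q) A id a)"
proof -
  have id: "continuous_map (top_of_set B) (top_of_set Q) id" "id \<in> B - {z} \<rightarrow> A"
    using B by auto
  have F': "continuous_map (top_of_set Q) euclidean F" "F \<in> A \<rightarrow> -{0}"
    using F by auto
  have L': "continuous_map (top_of_set Q) euclidean (\<lambda>x. L (x - z))" "(\<lambda>x. L (x - z)) \<in> A \<rightarrow> -{0}"
    using B L linear_injective_0[OF L(1)]
    by (auto intro!: linear_continuous_on_compose[OF _ L(1)] continuous_intros)
  show ?thesis
    unfolding hom_induced_compose'[OF id F'] hom_induced_compose'[OF id L']
    by (rule fun_cong[OF hom_induced_eq]) (use FL in simp)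
qed

lemma hom_induced_one_zero:
  fixes F :: "'a \<Rightarrow> 'b::euclidean_space"
  assumes Q: "frontier Q \<subseteq> Q" and F: "continuous_on Q F" "\<And>x. x \<in> Q - {z} \<Longrightarrow> F x \<noteq> 0"
    and L: "linear L" "inj L"
    and B: "ball z e \<subseteq> Q" "e > 0" and FL: "\<And>x. x \<in> ball z e \<Longrightarrow> F x = L (x - z)"
    and c: "c \<in> carrier (relative_homology_group p (top_of_set Q) (frontier Q))"
  shows "pair_map F c = pair_map (\<lambda>x. L (x - z)) c"
proof -
  let ?B = "ball z e" and ?A = "Q - {z}"
  have z: "z \<in> ?B" using B by simp
  have "z \<in> interior Q" using interior_maximal[OF B(1) open_ball] B(2) by auto
  then have S: "frontier Q \<subseteq> ?A" using Q by (auto simp: frontier_def)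
  have oB: "openin (top_of_set Q) ?B" using B by (simp add: open_subset)
  let ?c = "hom_induced p (top_of_set Q) (frontier Q) (top_of_set Q) ?A id c"
  obtain a where a: "a \<in> carrier (relative_homology_group p (top_of_set ?B) (?B - {z}))"
     "hom_induced p (top_of_set ?B) (?B - {z}) (top_of_set Q) ?A id a = ?c"
    by (rule iso_surjE[OF excision_point[OF oB z]]) (rule hom_induced_carrier)
  have eq: "pair_map G c = hom_induced p (top_of_set Q) ?A euclidean (- {0}) G ?c"
    if "continuous_on Q G" "\<And>x. x \<in> ?A \<Longrightarrow> G x \<noteq> 0" for G :: "'a \<Rightarrow> 'b"
  proof -
    have "id \<in> frontier Q \<rightarrow> ?A" "G \<in> ?A \<rightarrow> -{0}" "continuous_map (top_of_set Q) euclidean G"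
      using S that by auto
    from hom_induced_compose'[OF continuous_map_id this(1,3,2)] show ?thesis by simp
  qed
  have cL: "continuous_on Q (\<lambda>x. L (x - z))"
    by (rule linear_continuous_on_compose[OF _ L(1)]) (intro continuous_intros)
  have nzL: "L (x - z) \<noteq> 0" if "x \<in> ?A" for x
    using that linear_injective_0[OF L(1)] L(2) by auto
  show ?thesis
    unfolding eq[OF F, simplified] eq[OF cL nzL, simplified] a(2)[symmetric]
    by (rule hom_induced_local[OF F(1) _ L B(1) _ _ _ FL a(1)]) (use B F in auto)
qed

text \<open>The class splits into local classes at the zeros, on which \<open>F\<close> may be
  replaced by its affine germs. Each germ vanishes at its own centre only and so kills the other
  local class; its value on its own local class is therefore its value on all of
  \<open>c\<close>.\<close>

lemma hom_induced_two_zeros: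
  fixes F :: "'a \<Rightarrow> 'b::euclidean_space"
  assumes Q: "frontier Q \<subseteq> Q" and F: "continuous_on Q F" "\<And>x. x \<in> Q - {z1,z2} \<Longrightarrow> F x \<noteq> 0"
    and L: "linear L1" "inj L1" "linear L2" "inj L2"
    and B: "ball z1 e1 \<subseteq> Q" "ball z2 e2 \<subseteq> Q" "e1 > 0" "e2 > 0" "ball z1 e1 \<inter> ball z2 e2 = {}"
    and FL: "\<And>x. x \<in> ball z1 e1 \<Longrightarrow> F x = L1 (x - z1)" "\<And>x. x \<in> ball z2 e2 \<Longrightarrow> F x = L2 (x - z2)"
    and c: "c \<in> carrier (relative_homology_group p (top_of_set Q) (frontier Q))"
  shows "pair_map F c = monoid.mult (relative_homology_group p (euclidean :: 'b topology) (- {0}))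
     (pair_map (\<lambda>x. L2 (x - z2)) c) (pair_map (\<lambda>x. L1 (x - z1)) c)"
proof -
  let ?B1 = "ball z1 e1" and ?B2 = "ball z2 e2" and ?A = "Q - {z1,z2}"
  let ?H = "relative_homology_group p (top_of_set Q) ?A"
  let ?HB = "relative_homology_group p (euclidean :: 'b topology) (- {0})"
  let ?i1 = "hom_induced p (top_of_set ?B1) (?B1 - {z1}) (top_of_set Q) ?A id"
  let ?i2 = "hom_induced p (top_of_set ?B2) (?B2 - {z2}) (top_of_set Q) ?A id"
  have z: "z1 \<in> ?B1" "z2 \<in> ?B2" using B by simp_all
  have "z1 \<in> interior Q" "z2 \<in> interior Q"
    using interior_maximal[OF B(1) open_ball] interior_maximal[OF B(2) open_ball] z by auto
  then have S: "frontier Q \<subseteq> ?A" using Q by (auto simp: frontier_def)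
  have oB: "openin (top_of_set Q) ?B1" "openin (top_of_set Q) ?B2"
    using B by (simp_all add: open_subset)
  let ?c = "hom_induced p (top_of_set Q) (frontier Q) (top_of_set Q) ?A id c"
  have c': "?c \<in> carrier ?H" by (rule hom_induced_carrier)
  obtain a1 a2 where a1: "a1 \<in> carrier (relative_homology_group p (top_of_set ?B1) (?B1 - {z1}))"
    and a2: "a2 \<in> carrier (relative_homology_group p (top_of_set ?B2) (?B2 - {z2}))"
    and ca: "?c = monoid.mult ?H (?i2 a2) (?i1 a1)"
    by (rule relative_class_two_points[OF oB z B(5) c'])
  have eq: "pair_map G c = hom_induced p (top_of_set Q) A' euclidean (- {0}) G
        (hom_induced p (top_of_set Q) ?A (top_of_set Q) A' id ?c)"
    if "continuous_on Q G" "\<And>x. x \<in> A' \<Longrightarrow> G x \<noteq> 0" "?A \<subseteq> A'" for A' and G :: "'a \<Rightarrow> 'b"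
  proof -
    have *: "id \<in> frontier Q \<rightarrow> ?A" "id \<in> ?A \<rightarrow> A'" "G \<in> A' \<rightarrow> -{0}" "continuous_map (top_of_set Q) euclidean G"
      "id \<in> frontier Q \<rightarrow> A'"
      using S that by auto
    show ?thesis
      using hom_induced_compose'[OF continuous_map_id *(1) continuous_map_id *(2)]
       hom_induced_compose'[OF continuous_map_id *(5,4,3)] by simp
  qed
  have iA: "?i1 a1 \<in> carrier ?H" "?i2 a2 \<in> carrier ?H" by (simp_all add: hom_induced_carrier)
  have mult: "hom_induced p (top_of_set Q) ?A Y T f ?c
     = monoid.mult (relative_homology_group p Y T) (hom_induced p (top_of_set Q) ?A Y T f (?i2 a2))
        (hom_induced p (top_of_set Q) ?A Y T f (?i1 a1))" for Y T and f :: "'a \<Rightarrow> 'c"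
    unfolding ca by (rule hom_mult[OF hom_induced_hom iA(2,1)])
  have z12: "z1 \<notin> ?B2" "z2 \<notin> ?B1" using z B(5) by blast+
  have BA: "?B1 - {z1} \<subseteq> ?A" "?B2 - {z2} \<subseteq> ?A" using B(1,2) z12 by blast+
  \<comment> \<open>Here \<open>B\<close> lies entirely in \<open>A'\<close>, so the local class
    passes through the trivial group of the pair (A', A').\<close>
  have trivial: "hom_induced p (top_of_set Q) ?A (top_of_set Q) A' id
      (hom_induced p (top_of_set B) (B - {z}) (top_of_set Q) ?A id a)
      = one (relative_homology_group p (top_of_set Q) A')"
    if B: "B \<subseteq> A'" "B - {z} \<subseteq> ?A" "?A \<subseteq> A'" "A' \<subseteq> Q"
      and a: "a \<in> carrier (relative_homology_group p (top_of_set B) (B - {z}))" for A' B z a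
  proof -
    have *: "continuous_map (top_of_set B) (top_of_set Q) id" "id \<in> B - {z} \<rightarrow> ?A" "id \<in> ?A \<rightarrow> A'"
       "continuous_map (top_of_set B) (top_of_set A') id" "continuous_map (top_of_set A') (top_of_set Q) id"
       "id \<in> B - {z} \<rightarrow> A'" "id \<in> A' \<rightarrow> A'"
      using B by auto
    let ?T = "relative_homology_group p (top_of_set A') A'"
    have "trivial_group ?T"
      using trivial_relative_homology_group_topspace[of p "top_of_set A'"] by simp
    then have "hom_induced p (top_of_set B) (B - {z}) (top_of_set A') A' id a = one ?T"
      using hom_induced_carrier[of p "top_of_set B" "B - {z}" "top_of_set A'" A' id a]
      by (simp only: trivial_group_def singleton_iff)
    then have "one (relative_homology_group p (top_of_set Q) A')
      = hom_induced p (top_of_set A') A' (top_of_set Q) A' id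
       (hom_induced p (top_of_set B) (B - {z}) (top_of_set A') A' id a)"
      using hom_one[OF hom_induced_hom[of p "top_of_set A'" A' "top_of_set Q" A' id]] by simp
    then show ?thesis
      using hom_induced_compose'[OF *(1,2) continuous_map_id *(3), of p a]
         hom_induced_compose'[OF *(4,6,5,7), of p a] by simp
  qed
  have part: "pair_map (\<lambda>x. L (x - z)) c
       = hom_induced p (top_of_set Q) ?A euclidean (- {0}) (\<lambda>x. L (x - z)) (i a)"
    if L: "linear L" "inj L" and zz: "z \<in> {z1, z2}"
      and i: "(z = z1 \<and> i = ?i1 \<and> a = a1) \<or> (z = z2 \<and> i = ?i2 \<and> a = a2)"
    for L :: "'a \<Rightarrow> 'b" and i a z
  proof -
    let ?A' = "Q - {z}"
    have cL: "continuous_on Q (\<lambda>x. L (x - z))"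
      by (rule linear_continuous_on_compose[OF _ L(1)]) (intro continuous_intros)
    have nzL: "L (x - z) \<noteq> 0" if "x \<in> ?A'" for x
      using that linear_injective_0[OF L(1)] L(2) by auto
    have AA': "?A \<subseteq> ?A'" using zz by auto
    interpret H': group "relative_homology_group p (top_of_set Q) ?A'" by simp
    let ?k = "hom_induced p (top_of_set Q) ?A (top_of_set Q) ?A' id"
    have car: "?k x \<in> carrier (relative_homology_group p (top_of_set Q) ?A')" for x
      by (rule hom_induced_carrier)
    have "?k ?c = ?k (i a)"
      using i
    proof
      assume *: "z = z1 \<and> i = ?i1 \<and> a = a1"
      have "?k (?i2 a2) = one (relative_homology_group p (top_of_set Q) ?A')"
        by (rule trivial[OF _ BA(2) AA' _ a2]) (use * B z12 in auto)
      then show ?thesis unfolding mult using * car H'.l_one by metis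
    next
      assume *: "z = z2 \<and> i = ?i2 \<and> a = a2"
      have "?k (?i1 a1) = one (relative_homology_group p (top_of_set Q) ?A')"
        by (rule trivial[OF _ BA(1) AA' _ a1]) (use * B z12 in auto)
      then show ?thesis unfolding mult using * car H'.r_one by metis
    qed
    have id: "id \<in> ?A \<rightarrow> ?A'" "(\<lambda>x. L (x - z)) \<in> ?A' \<rightarrow> -{0}"
       "continuous_map (top_of_set Q) euclidean (\<lambda>x. L (x - z))"
      using AA' nzL cL by auto
    have "pair_map (\<lambda>x. L (x - z)) c = hom_induced p (top_of_set Q) ?A' euclidean (- {0}) (\<lambda>x. L (x - z)) (?k ?c)"
      by (rule eq[OF cL _ AA']) (rule nzL)
    then show ?thesis
      unfolding \<open>?k ?c = ?k (i a)\<close>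
      using hom_induced_compose'[OF continuous_map_id id(1,3,2)] by simp
  qed
  have "pair_map F c = hom_induced p (top_of_set Q) ?A euclidean (- {0}) F ?c"
  proof -
    have "hom_induced p (top_of_set Q) ?A (top_of_set Q) ?A id ?c = ?c"
      using hom_induced_id[OF c'] .
    then show ?thesis using eq[of F ?A] F by simp
  qed
  moreover have "hom_induced p (top_of_set Q) ?A euclidean (- {0}) F (?i1 a1)
      = hom_induced p (top_of_set Q) ?A euclidean (- {0}) (\<lambda>x. L1 (x - z1)) (?i1 a1)"
    by (rule hom_induced_local[OF F(1) _ L(1,2) B(1) _ BA(1) _ FL(1) a1]) (use F in auto)
  moreover have "hom_induced p (top_of_set Q) ?A euclidean (- {0}) F (?i2 a2)
      = hom_induced p (top_of_set Q) ?A euclidean (- {0}) (\<lambda>x. L2 (x - z2)) (?i2 a2)"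
    by (rule hom_induced_local[OF F(1) _ L(3,4) B(2) _ BA(2) _ FL(2) a2]) (use F in auto)
  ultimately show ?thesis
    using mult[of euclidean "-{0}" F] part[OF L(1,2), of z1 ?i1 a1] part[OF L(3,4), of z2 ?i2 a2] by simp
qed

end

text \<open>Excision at the zero gives \<open>F\<close> the value of an injective affine map on
  \<open>c\<close>, which has infinite order; a map without zeros would give the trivial value, and
  homotopic maps of pairs agree.\<close>

lemma one_zero_essential:
  fixes F G :: "'a::euclidean_space \<Rightarrow> 'b::euclidean_space"
  assumes Q: "convex Q" "compact Q" and D: "DIM('a) \<ge> 2" "DIM('b) = DIM('a)"
    and F: "continuous_on Q F" "\<And>x. x \<in> Q - {z} \<Longrightarrow> F x \<noteq> 0"
    and L: "linear L" "inj L"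
    and B: "ball z e \<subseteq> Q" "e > 0" and FL: "\<And>x. x \<in> ball z e \<Longrightarrow> F x = L (x - z)"
    and G: "bd_homotopic Q F G" "\<And>x. x \<in> Q \<Longrightarrow> G x \<noteq> 0"
  shows False
proof -
  let ?p = "int DIM('a)"
  let ?HB = "relative_homology_group ?p (euclidean :: 'b topology) (- {0})"
  let ?h = "\<lambda>f. hom_induced ?p (top_of_set Q) (frontier Q) (euclidean :: 'b topology) (- {0}) f"
  have S: "frontier Q \<subseteq> Q" using Q by (simp add: compact_imp_closed frontier_subset_closed)
  have "z \<in> interior Q" using interior_maximal[OF B(1) open_ball] B(2) by auto
  then obtain c where c: "c \<in> carrier (relative_homology_group ?p (top_of_set Q) (frontier Q))"
    and n: "\<And>k::nat. k > 0 \<Longrightarrow> pow ?HB (?h (\<lambda>x. L (x - z)) c) k \<noteq> one ?HB"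
    using linear_map_infinite_order[OF Q _ D L] by blast
  have "continuous_on Q G"
    using homotopic_with_imp_continuous_maps[OF G(1)[unfolded bd_homotopic_def]] by auto
  then have "one ?HB = ?h G c"
    using hom_induced_nonvanishing[OF _ G(2) c S] by simp
  also have "\<dots> = ?h F c"
    using homology_homotopy_axiom[OF G(1)[unfolded bd_homotopic_def]] by metis
  also have "\<dots> = ?h (\<lambda>x. L (x - z)) c"
    by (rule hom_induced_one_zero[OF S F L B FL c])
  finally have eq: "?h (\<lambda>x. L (x - z)) c = one ?HB" ..
  have "monoid ?HB" by (rule group.is_monoid[OF group_relative_homology_group])
  then show False using n[of 1, unfolded eq] monoid.nat_pow_one[of ?HB 1] by auto
qed

text \<open>The segment from \<open>L1\<close> to \<open>L2\<close> makes the two local degrees equal, so the total degree is twice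
  a unit; hence integral homology is needed here.\<close>

lemma two_zeros_essential:
  fixes F G :: "'a::euclidean_space \<Rightarrow> 'b::euclidean_space"
  assumes Q: "convex Q" "compact Q" and D: "DIM('a) \<ge> 2" "DIM('b) = DIM('a)"
    and F: "continuous_on Q F" "\<And>x. x \<in> Q - {z1,z2} \<Longrightarrow> F x \<noteq> 0"
    and L: "linear L1" "linear L2"
    and nz: "\<And>s v. 0 \<le> s \<Longrightarrow> s \<le> 1 \<Longrightarrow> (1 - s) *\<^sub>R L1 v + s *\<^sub>R L2 v = 0 \<Longrightarrow> v = 0"
    and B: "ball z1 e1 \<subseteq> Q" "ball z2 e2 \<subseteq> Q" "e1 > 0" "e2 > 0" "ball z1 e1 \<inter> ball z2 e2 = {}"
    and FL: "\<And>x. x \<in> ball z1 e1 \<Longrightarrow> F x = L1 (x - z1)" "\<And>x. x \<in> ball z2 e2 \<Longrightarrow> F x = L2 (x - z2)"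
    and G: "bd_homotopic Q F G" "\<And>x. x \<in> Q \<Longrightarrow> G x \<noteq> 0"
  shows False
proof -
  let ?p = "int DIM('a)"
  let ?HB = "relative_homology_group ?p (euclidean :: 'b topology) (- {0})"
  let ?h = "\<lambda>f. hom_induced ?p (top_of_set Q) (frontier Q) (euclidean :: 'b topology) (- {0}) f"
  have inj: "inj L1" "inj L2"
    using nz[of 0] nz[of 1] L by (auto simp: linear_injective_0)
  have S: "frontier Q \<subseteq> Q" using Q by (simp add: compact_imp_closed frontier_subset_closed)
  have z: "z1 \<in> interior Q" "z2 \<in> interior Q"
    using interior_maximal[OF B(1) open_ball] interior_maximal[OF B(2) open_ball] B(3,4) by auto
  obtain c where c: "c \<in> carrier (relative_homology_group ?p (top_of_set Q) (frontier Q))"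
    and n: "\<And>k::nat. k > 0 \<Longrightarrow> pow ?HB (?h (\<lambda>x. L1 (x - z1)) c) k \<noteq> one ?HB"
    using linear_map_infinite_order[OF Q z(1) D L(1) inj(1)] by blast
  have "continuous_on Q G"
    using homotopic_with_imp_continuous_maps[OF G(1)[unfolded bd_homotopic_def]] by auto
  then have "one ?HB = ?h G c"
    using hom_induced_nonvanishing[OF _ G(2) c S] by simp
  also have "\<dots> = ?h F c"
    using homology_homotopy_axiom[OF G(1)[unfolded bd_homotopic_def]] by metis
  also have "\<dots> = monoid.mult ?HB (?h (\<lambda>x. L2 (x - z2)) c) (?h (\<lambda>x. L1 (x - z1)) c)"
    by (rule hom_induced_two_zeros[OF S F L(1) inj(1) L(2) inj(2) B FL c])
  also have "?h (\<lambda>x. L2 (x - z2)) c = ?h (\<lambda>x. L1 (x - z1)) c"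
    by (rule fun_cong[OF homology_homotopy_axiom[OF bd_homotopic_linear_maps[OF Q(1) z L nz, unfolded bd_homotopic_def], symmetric]])
  finally have eq: "one ?HB = monoid.mult ?HB (?h (\<lambda>x. L1 (x - z1)) c) (?h (\<lambda>x. L1 (x - z1)) c)" .
  have "pow ?HB u (2::nat) = monoid.mult ?HB u u" if "u \<in> carrier ?HB" for u
    using monoid.l_one[OF group.is_monoid[OF group_relative_homology_group] that]
    by (simp only: numeral_2_eq_2 nat_pow_Suc nat_pow_0)
  from this[OF hom_induced_carrier] have "pow ?HB (?h (\<lambda>x. L1 (x - z1)) c) (2::nat) = one ?HB"
    using eq by (rule trans[OF _ sym])
  then show False using n[OF zero_less_numeral] by blast
qed

subsection \<open>Separation of a convex body\<close>

lemma frontier_Times_interval: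
  fixes K :: "'a::euclidean_space set"
  assumes "closed K" "(x, t) \<in> frontier (K \<times> {0..1::real})"
  shows "x \<in> K \<and> 0 \<le> t \<and> t \<le> 1 \<and> (t = 0 \<or> t = 1 \<or> x \<in> frontier K)"
proof -
  have "closed (K \<times> {0..1::real})" using assms by (intro closed_Times) auto
  then have "(x, t) \<in> K \<times> {0..1}" "(x, t) \<notin> interior K \<times> interior {0..1}"
    using assms(2) by (auto simp: frontier_def interior_Times)
  then show ?thesis using assms(1) by (auto simp: frontier_def interior_atLeastAtMost_real)
qed

text \<open>With a path \<open>c\<close> off the image of \<open>f'\<close>, the map
  \<open>f' x - c t\<close> has no zeros. The straight homotopy to it is harmless on the frontier of
  the prism by convexity: over a boundary point of \<open>K\<close> the disk point stays fixed on
  the frontier of \<open>B\<close> while the path point is interior; at the two ends of the path the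
  roles are exchanged. This is why \<open>c0\<close> must run through the interior.\<close>

lemma same_component_imp_bd_homotopic:
  fixes f f' :: "'a::euclidean_space \<Rightarrow> 'b::euclidean_space"
  assumes K: "compact K" and B: "convex B" "closed B"
    and f: "continuous_on K f" "f ` K \<subseteq> B" "\<And>x. x \<in> K \<Longrightarrow> f x \<in> frontier B \<Longrightarrow> x \<in> frontier K"
    and f': "continuous_on K f'" "f' ` K \<subseteq> B" "\<And>x. x \<in> K \<Longrightarrow> f' x \<in> frontier B \<Longrightarrow> x \<in> frontier K"
    and eq: "\<And>x. x \<in> frontier K \<Longrightarrow> f' x = f x" and fr: "\<And>x. x \<in> frontier K \<Longrightarrow> f x \<in> frontier B"
    and c0: "continuous_on {0..1} c0" "\<And>t. 0 < t \<Longrightarrow> t < 1 \<Longrightarrow> c0 t \<in> interior B"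
      "c0 0 \<in> frontier B" "c0 1 \<in> frontier B"
    and con: "connected_component (B - f' ` K) (c0 0) (c0 (1::real))"
  obtains G where "bd_homotopic (K \<times> {0..1}) (\<lambda>(x, t). f x - c0 t) G"
    "\<And>y. y \<in> K \<times> {0..1} \<Longrightarrow> G y \<noteq> 0"
proof -
  have "closed (f' ` K)" using compact_continuous_image[OF f'(1) K] compact_imp_closed by blast
  then have "openin (top_of_set B) (B - f' ` K)"
    using openin_diff[of "top_of_set B" B "B \<inter> f' ` K"] by (simp add: Diff_Int closedin_closed_Int)
  \<comment> \<open>In a relatively open subset of a convex set, components are path components; the
    homotopy needs an actual path.\<close>
  then have "locally path_connected (B - f' ` K)"
    using locally_open_subset convex_imp_locally_path_connected[OF B(1)] by blast
  then have "path_component (B - f' ` K) (c0 0) (c0 1)"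
    using con by (simp add: path_component_eq_connected_component)
  then obtain c where c: "path c" "path_image c \<subseteq> B - f' ` K" "pathstart c = c0 0" "pathfinish c = c0 1"
    unfolding path_component_def by blast
  have ct: "c t \<in> B - f' ` K" if "0 \<le> t" "t \<le> 1" for t
    using that by (intro subsetD[OF c(2)]) (auto simp: path_image_def)
  have c01: "c 0 = c0 0" "c 1 = c0 1" using c by (auto simp: pathstart_def pathfinish_def)
  let ?G = "\<lambda>(x, t). f' x - c t" and ?F = "\<lambda>(x, t). f x - c0 t"
  have "bd_homotopic (K \<times> {0..1}) ?F ?G"
  proof (rule bd_homotopic_segment)
    show "continuous_on (K \<times> {0..1}) ?F"
      unfolding case_prod_unfold
      by (intro continuous_intros continuous_on_compose2[OF f(1)] continuous_on_compose2[OF c0(1)]) auto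
    show "continuous_on (K \<times> {0..1}) ?G"
      unfolding case_prod_unfold
      by (intro continuous_intros continuous_on_compose2[OF f'(1)] continuous_on_compose2[OF c(1)[unfolded path_def]]) auto
    fix y s assume y: "y \<in> frontier (K \<times> {0..1::real})" and s: "0 \<le> s" "s \<le> (1::real)"
    obtain x t where xt: "y = (x, t)" by force
    have x: "x \<in> K" "0 \<le> t" "t \<le> 1" "t = 0 \<or> t = 1 \<or> x \<in> frontier K"
      using frontier_Times_interval[of K x t] y K by (auto simp: xt compact_imp_closed)
    have "(1 - s) *\<^sub>R f x + s *\<^sub>R f' x \<noteq> (1 - s) *\<^sub>R c0 t + s *\<^sub>R c t"
    proof (cases "x \<in> frontier K")
      case True
      then have fx: "f' x = f x" "f x \<in> frontier B" "(1 - s) *\<^sub>R f x + s *\<^sub>R f' x = f x"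
        using eq fr by (auto simp: algebra_simps)
      show ?thesis
      \<comment> \<open>For these parameters the path point is \<open>c t\<close>, which may lie on
        the frontier of \<open>B\<close>; it is kept apart from the disk because \<open>c\<close>
        avoids the image of \<open>f'\<close>.\<close>
      proof (cases "s = 1 \<or> t = 0 \<or> t = 1")
        case True
        then have "(1 - s) *\<^sub>R c0 t + s *\<^sub>R c t = c t"
          using c01 by (auto simp: algebra_simps)
        then show ?thesis using fx(1,3) ct[OF x(2,3)] imageI[OF x(1), of f'] by auto
      next
        case False
        then have "c t - (1 - s) *\<^sub>R (c t - c0 t) \<in> interior B"
          using x s ct[OF x(2,3)] B c0(2)[of t] by (intro mem_interior_convex_shrink) auto
        moreover have "(1 - s) *\<^sub>R c0 t + s *\<^sub>R c t = c t - (1 - s) *\<^sub>R (c t - c0 t)"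
          by (simp add: algebra_simps)
        ultimately show ?thesis unfolding fx(3) using fx(2) by (auto simp: frontier_def)
      qed
    next
      case False
      then have "f x \<in> interior B" "f' x \<in> interior B"
        using f f' x(1) B closure_subset by (auto simp: frontier_def image_subset_iff subset_iff)
      then have "(1 - s) *\<^sub>R f x + s *\<^sub>R f' x \<in> interior B"
        using s convexD[OF convex_interior[OF B(1)], of "f x" "f' x" "1 - s" s] by auto
      moreover have "(1 - s) *\<^sub>R c0 t + s *\<^sub>R c t \<in> frontier B"
        using False x(4) c01 c0(3,4) by (auto simp flip: scaleR_left_distrib)
      ultimately show ?thesis by (auto simp: frontier_def)
    qed
    then show "(1 - s) *\<^sub>R ?F y + s *\<^sub>R ?G y \<noteq> 0"
      by (auto simp: xt algebra_simps)
  qed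
  moreover have "?G y \<noteq> 0" if "y \<in> K \<times> {0..1}" for y
  proof -
    obtain x t where xt: "y = (x, t)" by force
    then have "x \<in> K" "0 \<le> t" "t \<le> 1" using that by auto
    then have "f' x \<noteq> c t" using ct[of t] by (metis DiffD2 imageI)
    then show ?thesis using xt by simp
  qed
  ultimately show thesis using that by blast
qed

text \<open>All components other than that of \<open>p\<close> share the minus sign, so passing
  through \<open>X\<close> from one of them to another changes nothing. This is what makes one of
  the two branches of the loop invisible. The two definitions fit together because the distance
  vanishes on \<open>X\<close>.\<close>

lemma signed_distance_function:
  fixes B X :: "'a::euclidean_space set"
  assumes B: "convex B" and X: "closed X" "X \<noteq> {}"
  obtains \<phi> :: "'a \<Rightarrow> real" where "continuous_on B \<phi>"
    "\<And>y. y \<in> B \<Longrightarrow> \<phi> y = 0 \<longleftrightarrow> y \<in> X"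
    "\<And>y. y \<in> B \<Longrightarrow> \<phi> y > 0 \<longleftrightarrow> connected_component (B - X) p y"
proof -
  let ?C = "connected_component_set (B - X) p"
  define \<phi> where "\<phi> y = (if y \<in> ?C then infdist y X else - infdist y X)" for y
  have o: "openin (top_of_set B) (B - X)"
    using openin_diff[of "top_of_set B" B "B \<inter> X"] X by (simp add: Diff_Int closedin_closed_Int)
  have "locally connected (B - X)"
    using locally_open_subset[OF _ o] convex_imp_locally_connected[OF B] by blast
  then have open_comp: "openin (top_of_set B) (connected_component_set (B - X) y)" for y
    using o openin_connected_component_locally_connected openin_trans
    by (metis openin_connected_component_locally_connected openin_trans)
  have CB: "?C \<subseteq> B - X" by (rule connected_component_subset)
  have d: "infdist y X > 0" if "y \<notin> X" for y
    using that X by (metis infdist_pos_not_in_closed)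
  have "continuous_on B \<phi>"
  proof -
    have cl1: "closedin (top_of_set B) (B - ?C)"
      using closedin_diff[OF closedin_topspace open_comp[of p]] by simp
    \<comment> \<open>The union of the other components is open as well, so the chosen component
      together with \<open>X\<close> is relatively closed; the two closed pieces can then be
      glued.\<close>
    have "openin (top_of_set B) (\<Union>y \<in> (B - X) - ?C. connected_component_set (B - X) y)"
      using open_comp by (intro openin_Union) auto
    moreover have "(\<Union>y \<in> (B - X) - ?C. connected_component_set (B - X) y) = (B - X) - ?C"
      (is "?L = ?R")
    proof (intro equalityI subsetI)
      fix w assume "w \<in> ?L"
      then obtain y where y: "y \<in> B - X" "y \<notin> ?C" "connected_component (B - X) y w" by blast
      then have "w \<in> B - X" by (meson connected_component_in)
      moreover have "w \<notin> ?C" using y connected_component_sym connected_component_trans by (metis mem_Collect_eq)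
      ultimately show "w \<in> ?R" by blast
    next
      fix w assume w: "w \<in> ?R"
      then have "connected_component (B - X) w w" by (simp add: connected_component_refl)
      then show "w \<in> ?L" using w by blast
    qed
    ultimately have "openin (top_of_set B) ((B - X) - ?C)" by simp
    then have "closedin (top_of_set B) (B - ((B - X) - ?C))"
      using closedin_diff[OF closedin_topspace] by fastforce
    moreover have "B - ((B - X) - ?C) = ?C \<union> (B \<inter> X)" using CB by blast
    ultimately have cl2: "closedin (top_of_set B) (?C \<union> (B \<inter> X))" by simp
    have un: "(?C \<union> (B \<inter> X)) \<union> (B - ?C) = B" using CB by blast
    have "continuous_on ((?C \<union> (B \<inter> X)) \<union> (B - ?C)) (\<lambda>y. if y \<in> ?C then infdist y X else - infdist y X)"
    proof (rule continuous_on_cases_local)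
      show "closedin (top_of_set (?C \<union> B \<inter> X \<union> (B - ?C))) (?C \<union> B \<inter> X)"
        "closedin (top_of_set (?C \<union> B \<inter> X \<union> (B - ?C))) (B - ?C)"
        using cl1 cl2 by (simp_all only: un)
      show "continuous_on (?C \<union> B \<inter> X) (\<lambda>y. infdist y X)" "continuous_on (B - ?C) (\<lambda>y. - infdist y X)"
        by (intro continuous_intros)+
      fix x assume "x \<in> ?C \<union> B \<inter> X \<and> x \<notin> ?C \<or> x \<in> B - ?C \<and> x \<in> ?C"
      then have "x \<in> X" by blast
      then show "infdist x X = - infdist x X" by simp
    qed
    then show ?thesis unfolding \<phi>_def un .
  qed
  moreover have "\<phi> y = 0 \<longleftrightarrow> y \<in> X" if "y \<in> B" for y
    using d[of y] CB by (cases "y \<in> X") (auto simp: \<phi>_def)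
  moreover have "\<phi> y > 0 \<longleftrightarrow> connected_component (B - X) p y" if "y \<in> B" for y
    using d[of y] CB infdist_nonneg[of y X] by (auto simp: \<phi>_def)
  ultimately show thesis using that by blast
qed

subsection \<open>The disks\<close>

text \<open>The direction space of \<open>A\<close> meets the coordinate subspace of
  \<open>I\<close> only in 0, so the two dimensions add up to at most that of the whole space.
  Codimensions are thus bounded by solving equations for the coordinates in \<open>I\<close>,
  without computing ranks.\<close>

lemma aff_dim_le_codim_coordinates:
  fixes A :: "(real ^ 'n) set"
  assumes "affine A" and inj: "\<And>y y'. y \<in> A \<Longrightarrow> y' \<in> A \<Longrightarrow> (\<And>a. a \<notin> I \<Longrightarrow> y $ a = y' $ a) \<Longrightarrow> y = y'"
  shows "aff_dim A \<le> int CARD('n) - int (card I)"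
proof (cases "A = {}")
  case True
  then show ?thesis using card_mono[of UNIV I] by simp
next
  case False
  then obtain y0 where y0: "y0 \<in> A" by blast
  define V where "V = (\<lambda>y. - y0 + y) ` A"
  have V: "subspace V" "aff_dim A = int (dim V)"
    using affine_diffs_subspace[OF assms(1) y0] aff_dim_translation_eq[of "-y0" A]
    by (auto simp: V_def aff_dim_subspace)
  let ?W = "{v :: real ^ 'n. \<forall>a. a \<notin> I \<longrightarrow> v $ a = 0}"
  have W: "subspace ?W" "dim ?W = card I"
    using dim_substandard_cart[of I, where 'a=real] by (auto simp: subspace_def dim_vec_eq)
  have "V \<inter> ?W \<subseteq> {0}"
    using inj[OF _ y0] by (fastforce simp: V_def)
  then have "V \<inter> ?W = {0}" using subspace_0[OF V(1)] subspace_0[OF W(1)] by blast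
  then have "dim V + card I = dim {x + y |x y. x \<in> V \<and> y \<in> ?W}"
    using dim_sums_Int[OF V(1) W(1)] W(2) by simp
  also have "\<dots> \<le> CARD('n)" using dim_subset_UNIV_cart by blast
  finally show ?thesis using V(2) by linarith
qed

text \<open>Checking the given polytopes is enough: the intersection of a face of \<open>P\<close>
  and a face of \<open>P'\<close> is an intersection of faces of \<open>P \<inter> P'\<close>, which
  is itself a face of both.\<close>

lemma cell_complex_faces:
  fixes \<P> :: "'a::euclidean_space set set"
  assumes "finite \<P>" "\<And>P. P \<in> \<P> \<Longrightarrow> polytope P"
    and face: "\<And>P P'. P \<in> \<P> \<Longrightarrow> P' \<in> \<P> \<Longrightarrow> (P \<inter> P') face_of P"
  shows "cell_complex {F. \<exists>P\<in>\<P>. F face_of P}"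
  unfolding cell_complex_def
proof (intro conjI ballI allI impI)
  have "{F. \<exists>P\<in>\<P>. F face_of P} = (\<Union>P\<in>\<P>. {F. F face_of P})" by auto
  then show "finite {F. \<exists>P\<in>\<P>. F face_of P}"
    using assms by (simp add: finite_polytope_faces)
  show "polytope C" if "C \<in> {F. \<exists>P\<in>\<P>. F face_of P}" for C
    using that assms(2) face_of_polytope_polytope by blast
  show "F \<in> {F. \<exists>P\<in>\<P>. F face_of P}" if "C \<in> {F. \<exists>P\<in>\<P>. F face_of P}" "F face_of C" for C F
    using that face_of_trans by blast
  have *: "(C \<inter> C') face_of C" if C: "C face_of P" "C' face_of P'" and P: "P \<in> \<P>" "P' \<in> \<P>" for C C' P P'
  proof -
    let ?W = "P \<inter> P'"
    have W: "?W face_of P" "?W face_of P'" using face[OF P] face[OF P(2,1)] by (auto simp: Int_commute)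
    have "(C \<inter> ?W) face_of P" using C(1) W(1) by (rule face_of_Int)
    then have "(C \<inter> ?W) face_of ?W" using W(1) by (meson Int_lower2 face_of_imp_subset face_of_subset)
    moreover have "(C' \<inter> ?W) face_of P'" using C(2) W(2) by (rule face_of_Int)
    then have "(C' \<inter> ?W) face_of ?W" using W(2) by (meson Int_lower2 face_of_imp_subset face_of_subset)
    ultimately have "((C \<inter> ?W) \<inter> (C' \<inter> ?W)) face_of ?W" by (rule face_of_Int)
    moreover have "(C \<inter> ?W) \<inter> (C' \<inter> ?W) = C \<inter> C'"
      using face_of_imp_subset[OF C(1)] face_of_imp_subset[OF C(2)] by blast
    ultimately have "(C \<inter> C') face_of P" using W(1) face_of_trans by metis
    then show ?thesis using C(1) by (meson Int_lower1 face_of_imp_subset face_of_subset)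
  qed
  show "(C \<inter> C') face_of C" "(C \<inter> C') face_of C'"
    if "C \<in> {F. \<exists>P\<in>\<P>. F face_of P}" "C' \<in> {F. \<exists>P\<in>\<P>. F face_of P}" for C C'
    using that *[of C _ C'] *[of C' _ C] by (auto simp: Int_commute)
qed

lemma mem_std_ball: "x \<in> (std_ball :: (real ^ 'n) set) \<longleftrightarrow> (\<forall>i. 0 \<le> x $ i \<and> x $ i \<le> 1)"
  by (simp add: mem_box_cart)

lemma mem_interior_std_ball: "x \<in> interior (std_ball :: (real ^ 'n) set) \<longleftrightarrow> (\<forall>i. 0 < x $ i \<and> x $ i < 1)"
  by (simp add: interior_cbox mem_box_cart)

lemma frontier_std_ball:
  "x \<in> std_sphere \<longleftrightarrow> x \<in> (std_ball :: (real ^ 'n) set) \<and> (\<exists>i. x $ i = 0 \<or> x $ i = 1)"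
proof -
  have "x \<in> std_sphere \<longleftrightarrow> x \<in> std_ball \<and> x \<notin> interior (std_ball :: (real ^ 'n) set)"
    by (simp add: frontier_def)
  then show ?thesis
    unfolding mem_interior_std_ball by (force simp: mem_std_ball less_le)
qed

section \<open>Construction of the disks\<close>

locale two_axes =
  fixes i1 i2 :: "'m::finite"
  assumes i12: "i1 \<noteq> i2"
begin

text \<open>
  Disk \<open>j\<close> is cut by the hyperplanes \<open>x\<^sub>i\<^sub>1 = break j n\<close> into slabs on which it is affine.
  The disk \<open>Some i1\<close> is the V and \<open>Some i2\<close> is the self-crossing disk; the pair
  \<open>(first_coord, second_coord)\<close> traces their paths in the plane of the coordinates \<open>None\<close> and \<open>Some i1\<close>.
  The self-crossing path drifts by \<open>x\<^sub>i\<^sub>2 / 8\<close> in the coordinate \<open>Some i1\<close>, to make the position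
  general.  Disk \<open>None\<close> is \<open>y $ None = 3/8\<close>, treated as a third, straight path.
\<close>

definition pieces :: "'m option \<Rightarrow> nat"
  where "pieces j = (if j = Some i1 then 2 else if j = Some i2 then 3 else 1)"

definition break :: "'m option \<Rightarrow> nat \<Rightarrow> real"
  where "break j n = (if j = Some i1 then real n / 2 else if j = Some i2 then
     (if n = 0 then 0 else if n = 1 then 1/4 else if n = 2 then 3/4 else 1) else real n)"

text \<open>The V has its vertex at (1/8, 1/2) and ends at (1, 1/4) and (1, 3/4), so the line u =
  3/8 cuts both arms. Without drift, the loop has the vertices (0, 1/8), (3/4, 5/8), (1/4, 5/8), (1,
  1/8) and crosses itself at (1/2, 11/24). Since 3/8 lies between 1/4 and 1/2, the line u = 3/8
  passes upwards through branch 0, branch 2 and the top edge, seeing the levels 0, 1, 2, 1.\<close>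

definition first_coord :: "'m option \<Rightarrow> nat \<Rightarrow> real \<Rightarrow> real"
  where "first_coord j n s = (if j = Some i1 then (if n = 0 then 1 - 7/4 * s else 7/4 * s - 3/4)
     else if j = Some i2 then (if n = 0 then 3 * s else if n = 1 then 1 - s else 3 * s - 2)
     else 3/8)"

definition second_coord :: "'m option \<Rightarrow> nat \<Rightarrow> real \<Rightarrow> real"
  where "second_coord j n s = (if j = Some i1 then 1/4 + s/2
     else if j = Some i2 then (if n = 0 then 1/8 + 2 * s else if n = 1 then 5/8 else 17/8 - 2 * s)
     else s)"

definition flat :: "'m option \<Rightarrow> bool"
  where "flat j \<longleftrightarrow> j \<noteq> None \<and> j \<noteq> Some i1 \<and> j \<noteq> Some i2"

text \<open>A flat disk \<open>Some k\<close> leaves its parameter \<open>x $ k\<close> free, which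
  fills the coordinate \<open>None\<close>. Without the drift of the loop, its lines in the slice
  would be parallel to those of the V; the drift makes them meet transversally.\<close>

definition piece :: "'m option \<Rightarrow> nat \<Rightarrow> real ^ 'm \<Rightarrow> real ^ 'm option"
  where "piece j n x = (\<chi> a. case a of
      None \<Rightarrow> if flat j then x $ the j else first_coord j n (x $ i1)
    | Some l \<Rightarrow> if flat j then (if j = Some l then 1/2 else x $ l)
        else if l = i1 then second_coord j n (x $ i1) + (if j = Some i2 then x $ i2 / 8 else 0)
        else x $ l)"

definition index :: "'m option \<Rightarrow> real \<Rightarrow> nat"
  where "index j s = (if j = Some i1 then (if s \<le> 1/2 then 0 else 1)
     else if j = Some i2 then (if s \<le> 1/4 then 0 else if s \<le> 3/4 then 1 else 2) else 0)"

definition disks :: "'m disks_map"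
  where "disks j x = piece j (index j (x $ i1)) x"

definition slab :: "'m option \<Rightarrow> nat \<Rightarrow> (real ^ 'm) set"
  where "slab j n = cbox (\<chi> i. if i = i1 then break j n else 0) (\<chi> i. if i = i1 then break j (Suc n) else 1)"

text \<open>The image of the slab \<open>n\<close> of disk \<open>j\<close> lies in the hyperplane \<open>sheet_eq j n y = 0\<close>.\<close>

definition sheet_eq :: "'m option \<Rightarrow> nat \<Rightarrow> real ^ 'm option \<Rightarrow> real"
  where "sheet_eq j n y = (if j = None then 8 * y $ None - 3
     else if j = Some i1 then 28 * y $ Some i1 + (if n = 0 then 8 * y $ None - 15 else - 8 * y $ None - 13)
     else if j = Some i2 then 24 * y $ Some i1 - 3 * y $ Some i2 -
       (if n = 0 then 16 * y $ None + 3 else if n = 1 then 15 else 19 - 16 * y $ None)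
     else 2 * y $ j - 1)"

lemma piece_cases:
  obtains "j = None" | "j = Some i1" | "j = Some i2" | "flat j"
  by (auto simp: flat_def)

lemma piece_nth:
  "piece None n x $ None = 3/8"
  "piece None n x $ Some l = x $ l"
  "piece (Some i1) n x $ None = (if n = 0 then 1 - 7/4 * x $ i1 else 7/4 * x $ i1 - 3/4)"
  "piece (Some i1) n x $ Some l = (if l = i1 then 1/4 + x $ i1 / 2 else x $ l)"
  "piece (Some i2) n x $ None = (if n = 0 then 3 * x $ i1 else if n = 1 then 1 - x $ i1 else 3 * x $ i1 - 2)"
  "piece (Some i2) n x $ Some l = (if l = i1 then (if n = 0 then 1/8 + 2 * x $ i1 else if n = 1 then 5/8
     else 17/8 - 2 * x $ i1) + x $ i2 / 8 else x $ l)"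
  "flat j \<Longrightarrow> piece j n x $ None = x $ the j"
  "flat j \<Longrightarrow> piece j n x $ Some l = (if j = Some l then 1/2 else x $ l)"
  using i12 by (auto simp: piece_def flat_def first_coord_def second_coord_def)

lemma mem_slab: "x \<in> slab j n \<longleftrightarrow>
   (break j n \<le> x $ i1 \<and> x $ i1 \<le> break j (Suc n) \<and> (\<forall>i. i \<noteq> i1 \<longrightarrow> 0 \<le> x $ i \<and> x $ i \<le> 1))"
  by (auto simp: slab_def mem_box_cart)

lemma break_simps:
  "break (Some i1) 0 = 0" "break (Some i1) (Suc 0) = 1/2" "break (Some i1) (Suc (Suc 0)) = 1"
  "break (Some i2) 0 = 0" "break (Some i2) (Suc 0) = 1/4" "break (Some i2) (Suc (Suc 0)) = 3/4"
  "break (Some i2) (Suc (Suc (Suc 0))) = 1"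
  "break (Some i1) 1 = 1/2" "break (Some i1) 2 = 1"
  "break (Some i2) 1 = 1/4" "break (Some i2) 2 = 3/4" "break (Some i2) 3 = 1"
  "break None n = real n" "flat j \<Longrightarrow> break j n = real n"
  using i12 by (auto simp: break_def flat_def)

lemma pieces_simps: "pieces (Some i1) = 2" "pieces (Some i2) = 3" "pieces None = 1" "flat j \<Longrightarrow> pieces j = 1"
  using i12 by (auto simp: pieces_def flat_def)

lemma less_piecesE:
  assumes "n < pieces j"
  obtains "j = None" "n = 0" | "flat j" "n = 0" | "j = Some i1" "n = 0" | "j = Some i1" "n = 1"
  | "j = Some i2" "n = 0" | "j = Some i2" "n = 1" | "j = Some i2" "n = 2"
proof (cases j rule: piece_cases)
  case 3
  then have "n = 0 \<or> n = 1 \<or> n = 2" using assms by (auto simp: pieces_simps)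
  then show ?thesis using 3 that by blast
next
  case 2
  then have "n = 0 \<or> n = 1" using assms by (auto simp: pieces_simps)
  then show ?thesis using 2 that by blast
qed (use assms that in \<open>auto simp: pieces_simps\<close>)

lemma break_mono: "n < pieces j \<Longrightarrow> break j n < break j (Suc n)"
  by (erule less_piecesE) (simp_all add: break_simps)

lemma break_bounds: "n \<le> pieces j \<Longrightarrow> 0 \<le> break j n \<and> break j n \<le> 1"
  by (auto simp: pieces_def break_def split: if_splits)

lemma break_pieces: "break j 0 = 0" "break j (pieces j) = 1"
  by (auto simp: pieces_def break_def)

lemma slab_subset:
  assumes "n < pieces j"
  shows "slab j n \<subseteq> std_ball"
proof
  fix x assume x: "x \<in> slab j n"
  have "0 \<le> x $ i \<and> x $ i \<le> 1" for i
    using x assms break_bounds[of n j] break_bounds[of "Suc n" j]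
    by (cases "i = i1") (auto simp: mem_slab)
  then show "x \<in> std_ball" by (simp add: mem_std_ball)
qed

lemma index: "0 \<le> s \<Longrightarrow> s \<le> 1 \<Longrightarrow>
    index j s < pieces j \<and> break j (index j s) \<le> s \<and> s \<le> break j (Suc (index j s))"
  using i12 by (auto simp: index_def pieces_def break_def)

lemma mem_slab_index: "x \<in> std_ball \<Longrightarrow> x \<in> slab j (index j (x $ i1)) \<and> index j (x $ i1) < pieces j"
  using index[of "x $ i1" j] by (auto simp: mem_slab mem_std_ball)

lemma disks_eq_piece:
  assumes "n < pieces j" "x \<in> slab j n"
  shows "disks j x = piece j n x"
proof -
  have "break j n \<le> x $ i1" "x $ i1 \<le> break j (Suc n)" using assms(2) by (simp_all add: mem_slab)
  moreover have "disks j x $ a = piece j n x $ a" if "break j n \<le> x $ i1" "x $ i1 \<le> break j (Suc n)" for a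
    using assms(1)
  proof (rule less_piecesE)
    assume "flat j"
    then show ?thesis by (cases a) (simp_all add: disks_def piece_nth)
  qed (use that i12 in \<open>cases a; auto simp: disks_def index_def piece_nth break_simps numeral_2_eq_2 split: if_splits\<close>)+
  ultimately show ?thesis by (simp add: vec_eq_iff)
qed

lemma sheet_eq_piece:
  assumes "n < pieces j"
  shows "sheet_eq j n (piece j n x) = 0"
  using assms
proof (rule less_piecesE)
  assume "flat j"
  moreover from this obtain k where "j = Some k" by (auto simp: flat_def)
  ultimately show ?thesis using piece_nth(8)[of j n x k] by (simp add: sheet_eq_def flat_def)
qed (use i12 in \<open>simp_all add: sheet_eq_def piece_nth field_simps\<close>)

lemma inj_piece:
  assumes "n < pieces j" "piece j n x = piece j n x'"
  shows "x = x'"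
proof -
  have eq: "piece j n x $ a = piece j n x' $ a" for a using assms(2) by simp
  have "x $ l = x' $ l" for l
    using assms(1)
  proof (rule less_piecesE)
    assume j: "flat j"
    show ?thesis
      using eq[of "Some l"] eq[of None] j by (cases "j = Some l") (auto simp: piece_nth)
  qed (use eq[of "Some l"] eq[of None] eq[of "Some i2"] i12 in \<open>auto simp: piece_nth split: if_splits\<close>)
  then show ?thesis by (simp add: vec_eq_iff)
qed

definition lin :: "'m option \<Rightarrow> nat \<Rightarrow> real ^ 'm \<Rightarrow> real ^ 'm option"
  where "lin j n v = piece j n v - piece j n 0"

lemma lin_nth:
  "lin None n v $ None = 0"
  "lin None n v $ Some l = v $ l"
  "lin (Some i1) n v $ None = (if n = 0 then - 7/4 * v $ i1 else 7/4 * v $ i1)"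
  "lin (Some i1) n v $ Some l = (if l = i1 then v $ i1 / 2 else v $ l)"
  "lin (Some i2) n v $ None = (if n = 0 then 3 * v $ i1 else if n = 1 then - v $ i1 else 3 * v $ i1)"
  "lin (Some i2) n v $ Some l = (if l = i1 then (if n = 0 then 2 * v $ i1 else if n = 1 then 0
     else - 2 * v $ i1) + v $ i2 / 8 else v $ l)"
  "flat j \<Longrightarrow> lin j n v $ None = v $ the j"
  "flat j \<Longrightarrow> lin j n v $ Some l = (if j = Some l then 0 else v $ l)"
  by (simp_all add: lin_def piece_nth)

lemma linear_lin: "linear (lin j n)"
proof (cases j rule: piece_cases)
  case 1
  have "lin j n (v + w) $ a = lin j n v $ a + lin j n w $ a" "lin j n (c *\<^sub>R v) $ a = c * lin j n v $ a" for v w a c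
    unfolding 1 by (cases a; simp add: lin_nth)+
  then show ?thesis by (auto intro!: linearI simp: vec_eq_iff)
next
  case 2
  have "lin j n (v + w) $ a = lin j n v $ a + lin j n w $ a" "lin j n (c *\<^sub>R v) $ a = c * lin j n v $ a" for v w a c
    unfolding 2 by (cases a; simp add: lin_nth algebra_simps)+
  then show ?thesis by (auto intro!: linearI simp: vec_eq_iff)
next
  case 3
  have "lin j n (v + w) $ a = lin j n v $ a + lin j n w $ a" "lin j n (c *\<^sub>R v) $ a = c * lin j n v $ a" for v w a c
    unfolding 3 by (cases a; simp add: lin_nth algebra_simps)+
  then show ?thesis by (auto intro!: linearI simp: vec_eq_iff)
next
  case 4
  have "lin j n (v + w) $ a = lin j n v $ a + lin j n w $ a" "lin j n (c *\<^sub>R v) $ a = c * lin j n v $ a" for v w a c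
    using 4 by (cases a; simp add: lin_nth)+
  then show ?thesis by (auto intro!: linearI simp: vec_eq_iff)
qed

lemma piece_eq_lin: "piece j n x = lin j n x + piece j n 0"
  by (simp add: lin_def)

section \<open>The subdivision, piecewise linearity and properness\<close>

definition cells :: "'m option \<Rightarrow> (real ^ 'm) set set"
  where "cells j = {F. \<exists>P \<in> slab j ` {..<pieces j}. F face_of P}"

lemma std_ball_eq_slabs: "std_ball = (\<Union>n<pieces j. slab j n)"
  using mem_slab_index slab_subset by (fastforce simp: set_eq_iff)

lemma break_less: "n < n' \<Longrightarrow> n' \<le> pieces j \<Longrightarrow> break j n < break j n'"
proof (induct n' rule: less_induct)
  case (less n')
  then obtain k where k: "n' = Suc k" by (cases n') auto
  have "break j k < break j n'" using break_mono[of k j] less.prems k by simp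
  then show ?case using less.hyps[of k] less.prems k by (cases "n = k") auto
qed

lemma slab_Int_face:
  assumes "n < pieces j" "n' < pieces j"
  shows "(slab j n \<inter> slab j n') face_of slab j n"
proof -
  have conv: "convex (slab j n)" by (simp add: slab_def)
  consider "n = n'" | "n < n'" | "n' < n" by linarith
  then show ?thesis
  proof cases
    case 1
    then show ?thesis using face_of_refl[OF conv] by simp
  next
    case 2
    let ?h = "{x :: real ^ 'm. axis i1 1 \<bullet> x = break j (Suc n)}"
    have "break j (Suc n) \<le> break j n'"
      using 2 assms break_less[of "Suc n" n' j] by (cases "Suc n = n'") auto
    have face: "(slab j n \<inter> ?h) face_of slab j n"
      by (rule face_of_Int_supporting_hyperplane_le[OF conv]) (simp add: mem_slab inner_axis')
    show ?thesis
    proof (cases "Suc n = n'")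
      case True
      then have "slab j n \<inter> slab j n' = slab j n \<inter> ?h"
        using break_mono[OF assms(2)] by (auto simp: mem_slab inner_axis')
      then show ?thesis using face by simp
    next
      case False
      then have "break j (Suc n) < break j n'"
        using 2 assms by (intro break_less) auto
      then have "slab j n \<inter> slab j n' = {}" by (auto simp: mem_slab)
      then show ?thesis by simp
    qed
  next
    case 3
    let ?h = "{x :: real ^ 'm. axis i1 1 \<bullet> x = break j n}"
    have face: "(slab j n \<inter> ?h) face_of slab j n"
      by (rule face_of_Int_supporting_hyperplane_ge[OF conv]) (simp add: mem_slab inner_axis')
    show ?thesis
    proof (cases "Suc n' = n")
      case True
      then have "slab j n \<inter> slab j n' = slab j n \<inter> ?h"
        using break_mono[OF assms(1)] break_mono[OF assms(2)] by (auto simp: mem_slab inner_axis')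
      then show ?thesis using face by simp
    next
      case False
      then have "break j (Suc n') < break j n"
        using 3 assms by (intro break_less) auto
      then have "slab j n \<inter> slab j n' = {}" by (auto simp: mem_slab)
      then show ?thesis by simp
    qed
  qed
qed

lemma PL_disks: "PL_disks_map cells disks"
  unfolding PL_disks_map_def
proof (intro allI conjI ballI)
  fix j
  show "cell_complex (cells j)"
    unfolding cells_def
    by (rule cell_complex_faces) (auto intro: slab_Int_face, auto simp: slab_def polytope_interval)
  show "\<Union>(cells j) = std_ball"
  proof -
    have "\<Union>(cells j) = (\<Union>n<pieces j. slab j n)"
    proof
      show "\<Union>(cells j) \<subseteq> (\<Union>n<pieces j. slab j n)"
        unfolding cells_def using face_of_imp_subset by fastforce
      have "slab j n \<in> cells j" if "n < pieces j" for n
        unfolding cells_def using that face_of_refl[of "slab j n"] by (auto simp: slab_def)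
      then show "(\<Union>n<pieces j. slab j n) \<subseteq> \<Union>(cells j)" by blast
    qed
    then show ?thesis using std_ball_eq_slabs by simp
  qed
  fix C assume "C \<in> cells j"
  then obtain n where n: "n < pieces j" "C \<subseteq> slab j n"
    unfolding cells_def using face_of_imp_subset by blast
  have "disks j x = lin j n x + piece j n 0" if "x \<in> C" for x
    using disks_eq_piece[OF n(1), of x] piece_eq_lin[of j n x] n(2) that by auto
  then show "affine_map_on C (disks j)"
    unfolding affine_map_on_def
    by - (rule exI[of _ "lin j n"], rule exI[of _ "piece j n 0"], use linear_lin in auto)
qed

text \<open>Properness reduces to the plane of \<open>None\<close> and \<open>Some i1\<close>, where
  a path may touch the boundary of the square only at its ends; the remaining coordinates are
  parameters of the disk.\<close>

lemma piece_coord_bounds: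
  assumes n: "n < pieces j" "\<not> flat j" and x: "x \<in> slab j n"
  shows "0 \<le> piece j n x $ None" "piece j n x $ None \<le> 1"
    "0 < piece j n x $ Some i1 \<or> x $ i1 = 0" "piece j n x $ Some i1 < 1 \<or> x $ i1 = 1"
    "0 \<le> piece j n x $ Some i1" "piece j n x $ Some i1 \<le> 1"
    "piece j n x $ None = 0 \<or> piece j n x $ None = 1 \<Longrightarrow> x $ i1 = 0 \<or> x $ i1 = 1"
    "x $ i1 = 0 \<or> x $ i1 = 1 \<Longrightarrow> piece j n x $ None = 0 \<or> piece j n x $ None = 1
      \<or> piece j n x $ Some i1 = 0 \<or> piece j n x $ Some i1 = 1"
proof -
  have b: "break j n \<le> x $ i1" "x $ i1 \<le> break j (Suc n)" "0 \<le> x $ i2" "x $ i2 \<le> 1"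
    using x i12 by (auto simp: mem_slab)
  show "0 \<le> piece j n x $ None" "piece j n x $ None \<le> 1"
    "0 < piece j n x $ Some i1 \<or> x $ i1 = 0" "piece j n x $ Some i1 < 1 \<or> x $ i1 = 1"
    "0 \<le> piece j n x $ Some i1" "piece j n x $ Some i1 \<le> 1"
    "piece j n x $ None = 0 \<or> piece j n x $ None = 1 \<Longrightarrow> x $ i1 = 0 \<or> x $ i1 = 1"
    "x $ i1 = 0 \<or> x $ i1 = 1 \<Longrightarrow> piece j n x $ None = 0 \<or> piece j n x $ None = 1
      \<or> piece j n x $ Some i1 = 0 \<or> piece j n x $ Some i1 = 1"
    by (rule less_piecesE[OF n(1)]; use b n in \<open>simp add: piece_nth break_simps\<close>; linarith?; argo?)+
qed

lemma piece_other_coord: "\<not> flat j \<Longrightarrow> l \<noteq> i1 \<Longrightarrow> piece j n x $ Some l = x $ l"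
  by (cases j rule: piece_cases) (auto simp: piece_nth)

lemma proper_disks: "proper_disks_map disks"
  unfolding proper_disks_map_def
proof (intro allI conjI)
  fix j
  have r: "disks j x $ a \<in> {0..1}" "disks j x $ a \<in> {0,1} \<Longrightarrow> x \<in> std_sphere"
    if x: "x \<in> std_ball" for x a
  proof -
    obtain n where n: "n < pieces j" "x \<in> slab j n" using mem_slab_index[OF x] by blast
    have x01: "0 \<le> x $ i" "x $ i \<le> 1" for i using x by (auto simp: mem_std_ball)
    have b: "break j n \<le> x $ i1" "x $ i1 \<le> break j (Suc n)" using n(2) by (auto simp: mem_slab)
    have "piece j n x $ a \<in> {0..1} \<and> (piece j n x $ a \<in> {0,1} \<longrightarrow> (\<exists>i. x $ i = 0 \<or> x $ i = 1))"
    proof (cases "flat j")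
      case True
      then show ?thesis using x01 by (cases a) (auto simp: piece_nth)
    next
      case False
      consider "a = None" | "a = Some i1" | l where "a = Some l" "l \<noteq> i1" by (cases a) auto
      then show ?thesis
        using piece_coord_bounds[OF n(1) False n(2)] x01 piece_other_coord[OF False, of _ n x]
        by cases auto
    qed
    then show "disks j x $ a \<in> {0..1}" "disks j x $ a \<in> {0,1} \<Longrightarrow> x \<in> std_sphere"
      using x by (auto simp: disks_eq_piece[OF n] frontier_std_ball)
  qed
  show sub: "disks j ` std_ball \<subseteq> std_ball" using r(1) by (auto simp: mem_std_ball)
  show "{x \<in> std_ball. disks j x \<in> std_sphere} = std_sphere"
  proof (intro equalityI subsetI)
    fix x assume "x \<in> {x \<in> std_ball. disks j x \<in> std_sphere}"
    then have "x \<in> std_ball" "\<exists>a. disks j x $ a = 0 \<or> disks j x $ a = 1"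
      by (auto simp: frontier_std_ball[of "disks j x"])
    then show "x \<in> std_sphere" using r(2) by blast
  next
    fix x :: "real ^ 'm" assume "x \<in> std_sphere"
    then obtain i where x: "x \<in> std_ball" and i: "x $ i = 0 \<or> x $ i = 1"
      by (auto simp: frontier_std_ball)
    obtain n where n: "n < pieces j" "x \<in> slab j n" using mem_slab_index[OF x] by blast
    have b: "break j n \<le> x $ i1" "x $ i1 \<le> break j (Suc n)" using n(2) by (auto simp: mem_slab)
    have "\<exists>a. piece j n x $ a = 0 \<or> piece j n x $ a = 1"
    proof (cases "flat j")
      case True
      then show ?thesis
        using i piece_nth(7)[of j n x] piece_nth(8)[of j n x i] by (cases "j = Some i") (auto intro: exI[of _ None] exI[of _ "Some i"])
    next
      case False
      then show ?thesis
        using piece_coord_bounds(8)[OF n(1) False n(2)] i piece_other_coord[OF False, of i n x]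
        by (cases "i = i1") auto
    qed
    then have "\<exists>a. disks j x $ a = 0 \<or> disks j x $ a = 1" by (simp add: disks_eq_piece[OF n])
    moreover have "disks j x \<in> std_ball" using sub x by blast
    ultimately have "disks j x \<in> std_sphere" by (simp only: frontier_std_ball)
    then show "x \<in> {x \<in> std_ball. disks j x \<in> std_sphere}" using x by simp
  qed
qed

end

subsection \<open>General position\<close>

text \<open>These are the traces of the sheets of the three disks that are not flat on a facet w = 0
  or w = 1. The constants of the paths are such that no three of the six lines are concurrent on
  either facet; all twenty triples are refuted.\<close>

lemma at_most_two_lines:
  fixes u v w :: real
  assumes w: "w = 0 \<or> w = 1"
    and e: "m0 \<longrightarrow> 8 * u = 3" "m1 \<longrightarrow> 28 * v + 8 * u = 15" "m2 \<longrightarrow> 28 * v - 8 * u = 13"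
      "m3 \<longrightarrow> 24 * v - 3 * w - 16 * u = 3" "m4 \<longrightarrow> 24 * v - 3 * w = 15" "m5 \<longrightarrow> 24 * v - 3 * w + 16 * u = 19"
  shows "of_bool m0 + of_bool m1 + of_bool m2 + of_bool m3 + of_bool m4 + of_bool m5 \<le> (2::nat)"
proof -
  have t012: "\<not> (m0 \<and> m1 \<and> m2)" using w e(1,2,3) by argo
  have t013: "\<not> (m0 \<and> m1 \<and> m3)" using w e(1,2,4) by argo
  have t014: "\<not> (m0 \<and> m1 \<and> m4)" using w e(1,2,5) by argo
  have t015: "\<not> (m0 \<and> m1 \<and> m5)" using w e(1,2,6) by argo
  have t023: "\<not> (m0 \<and> m2 \<and> m3)" using w e(1,3,4) by argo
  have t024: "\<not> (m0 \<and> m2 \<and> m4)" using w e(1,3,5) by argo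
  have t025: "\<not> (m0 \<and> m2 \<and> m5)" using w e(1,3,6) by argo
  have t034: "\<not> (m0 \<and> m3 \<and> m4)" using w e(1,4,5) by argo
  have t035: "\<not> (m0 \<and> m3 \<and> m5)" using w e(1,4,6) by argo
  have t045: "\<not> (m0 \<and> m4 \<and> m5)" using w e(1,5,6) by argo
  have t123: "\<not> (m1 \<and> m2 \<and> m3)" using w e(2,3,4) by argo
  have t124: "\<not> (m1 \<and> m2 \<and> m4)" using w e(2,3,5) by argo
  have t125: "\<not> (m1 \<and> m2 \<and> m5)" using w e(2,3,6) by argo
  have t134: "\<not> (m1 \<and> m3 \<and> m4)" using w e(2,4,5) by argo
  have t135: "\<not> (m1 \<and> m3 \<and> m5)" using w e(2,4,6) by argo
  have t145: "\<not> (m1 \<and> m4 \<and> m5)" using w e(2,5,6) by argo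
  have t234: "\<not> (m2 \<and> m3 \<and> m4)" using w e(3,4,5) by argo
  have t235: "\<not> (m2 \<and> m3 \<and> m5)" using w e(3,4,6) by argo
  have t245: "\<not> (m2 \<and> m4 \<and> m5)" using w e(3,5,6) by argo
  have t345: "\<not> (m3 \<and> m4 \<and> m5)" using w e(4,5,6) by argo
  show ?thesis
    using t012 t013 t014 t015 t023 t024 t025 t034 t035 t045 t123 t124 t125 t134 t135 t145 t234 t235 t245 t345
    by (cases m0; simp?; cases m1; simp?; cases m2; simp?; cases m3; simp?; cases m4; simp?; cases m5; simp?)
qed

context two_axes
begin

section \<open>The hyperplanes of the slabs and their intersections\<close>

definition sheet_indices :: "('m option \<times> nat) set"
  where "sheet_indices = Sigma UNIV (\<lambda>j. {..<pieces j})"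

lemma finite_sheet_indices: "finite sheet_indices"
  by (simp add: sheet_indices_def)

definition sheets :: "('m option \<times> nat) set \<Rightarrow> (real ^ 'm option) set"
  where "sheets D = {y. \<forall>(j, n) \<in> D. sheet_eq j n y = 0}"

lemma sheet_eq_affine:
  assumes "u + v = 1"
  shows "sheet_eq j n (u *\<^sub>R x + v *\<^sub>R y) = u * sheet_eq j n x + v * sheet_eq j n y"
proof -
  have v: "v = 1 - u" using assms by simp
  show ?thesis unfolding v sheet_eq_def by (simp add: field_simps)
qed

lemma affine_sheets: "affine (sheets D)"
  unfolding affine_def sheets_def by (auto simp: sheet_eq_affine case_prod_unfold)

lemma sheetsD: "y \<in> sheets D \<Longrightarrow> (j, n) \<in> D \<Longrightarrow> sheet_eq j n y = 0"
  by (auto simp: sheets_def)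

lemma sheet_eqs:
  "sheet_eq None n y = 0 \<longleftrightarrow> 8 * y $ None = 3"
  "sheet_eq (Some i1) 0 y = 0 \<longleftrightarrow> 28 * y $ Some i1 + 8 * y $ None = 15"
  "sheet_eq (Some i1) (Suc 0) y = 0 \<longleftrightarrow> 28 * y $ Some i1 - 8 * y $ None = 13"
  "sheet_eq (Some i2) 0 y = 0 \<longleftrightarrow> 24 * y $ Some i1 - 3 * y $ Some i2 - 16 * y $ None = 3"
  "sheet_eq (Some i2) (Suc 0) y = 0 \<longleftrightarrow> 24 * y $ Some i1 - 3 * y $ Some i2 = 15"
  "sheet_eq (Some i2) 2 y = 0 \<longleftrightarrow> 24 * y $ Some i1 - 3 * y $ Some i2 + 16 * y $ None = 19"
  "flat j \<Longrightarrow> sheet_eq j n y = 0 \<longleftrightarrow> 2 * y $ j = 1"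
  using i12 by (auto simp: sheet_eq_def flat_def)

text \<open>A second sheet of the same disk through a point determines the coordinate \<open>None\<close>; every other
  sheet determines the coordinate which is the name of its disk.\<close>

definition pivot :: "('m option \<times> nat) set \<Rightarrow> 'm option \<times> nat \<Rightarrow> 'm option"
  where "pivot D p = (if p = (Some i1, 1) \<and> (Some i1, 0) \<in> D \<or> p = (Some i2, 1) \<and> (Some i2, 0) \<in> D
     \<or> p = (Some i2, 2) \<and> ((Some i2, 0) \<in> D \<or> (Some i2, 1) \<in> D) then None else fst p)"

text \<open>Eliminating v and w from two sheets of one disk leaves a value of \<open>None\<close>:
  1/8 at the vertex of the V, 3/4 and 1/4 at the corners of the loop, 1/2 at its self-crossing.
  These differ from one another and from the 3/8 of the disk \<open>None\<close>, so a point can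
  realize only one of them.\<close>

lemma sheet_pair_values:
  assumes y: "y \<in> sheets D"
  shows "(None, 0) \<in> D \<Longrightarrow> y $ None = 3/8"
    "(Some i1, 0) \<in> D \<Longrightarrow> (Some i1, 1) \<in> D \<Longrightarrow> y $ None = 1/8"
    "(Some i2, 0) \<in> D \<Longrightarrow> (Some i2, 1) \<in> D \<Longrightarrow> y $ None = 3/4"
    "(Some i2, 0) \<in> D \<Longrightarrow> (Some i2, 2) \<in> D \<Longrightarrow> y $ None = 1/2"
    "(Some i2, 1) \<in> D \<Longrightarrow> (Some i2, 2) \<in> D \<Longrightarrow> y $ None = 1/4"
proof -
  have *: "(j, n) \<in> D \<Longrightarrow> sheet_eq j n y = 0" for j n using y by (rule sheetsD)
  show "(None, 0) \<in> D \<Longrightarrow> y $ None = 3/8" by (drule *) (simp add: sheet_eqs)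
  show "(Some i1, 0) \<in> D \<Longrightarrow> (Some i1, 1) \<in> D \<Longrightarrow> y $ None = 1/8" by (drule *)+ (simp add: sheet_eqs)
  show "(Some i2, 0) \<in> D \<Longrightarrow> (Some i2, 1) \<in> D \<Longrightarrow> y $ None = 3/4" by (drule *)+ (simp add: sheet_eqs)
  show "(Some i2, 0) \<in> D \<Longrightarrow> (Some i2, 2) \<in> D \<Longrightarrow> y $ None = 1/2" by (drule *)+ (simp add: sheet_eqs)
  show "(Some i2, 1) \<in> D \<Longrightarrow> (Some i2, 2) \<in> D \<Longrightarrow> y $ None = 1/4" by (drule *)+ (simp add: sheet_eqs)
qed

lemma None_pivot:
  assumes D: "D \<subseteq> sheet_indices" and p: "p \<in> D" "pivot D p = None"
  shows "p = (None, 0) \<or> p = (Some i1, 1) \<and> (Some i1, 0) \<in> D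
    \<or> p = (Some i2, 1) \<and> (Some i2, 0) \<in> D
    \<or> p = (Some i2, 2) \<and> ((Some i2, 0) \<in> D \<or> (Some i2, 1) \<in> D)"
proof (cases "p = (Some i1, 1) \<and> (Some i1, 0) \<in> D \<or> p = (Some i2, 1) \<and> (Some i2, 0) \<in> D
     \<or> p = (Some i2, 2) \<and> ((Some i2, 0) \<in> D \<or> (Some i2, 1) \<in> D)")
  case False
  then have "fst p = None" using p(2) unfolding pivot_def by (simp only: if_False)
  then have "p = (None, 0)" using p(1) D by (cases p) (auto simp: sheet_indices_def pieces_simps)
  then show ?thesis by blast
qed blast

lemma None_pivot_value:
  assumes D: "D \<subseteq> sheet_indices" and p: "p \<in> D" "pivot D p = None" and y: "y \<in> sheets D"
  shows "p = (None, 0) \<and> y $ None = 3/8 \<or> p = (Some i1, 1) \<and> y $ None = 1/8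
    \<or> p = (Some i2, 1) \<and> y $ None = 3/4
    \<or> p = (Some i2, 2) \<and> (Some i2, 0) \<in> D \<and> y $ None = 1/2
    \<or> p = (Some i2, 2) \<and> (Some i2, 1) \<in> D \<and> y $ None = 1/4"
  using None_pivot[OF D p] sheet_pair_values[OF y] p(1) by (elim disjE conjE; simp)

lemma None_pivot_unique:
  assumes D: "D \<subseteq> sheet_indices" and p: "p \<in> D" "pivot D p = None" "q \<in> D" "pivot D q = None"
    and y: "y \<in> sheets D"
  shows "p = q"
  using None_pivot_value[OF D p(1,2) y] None_pivot_value[OF D p(3,4) y] by auto

text \<open>The common point \<open>y\<close> is essential: two sheets with pivot
  \<open>None\<close> would demand two different values of \<open>y $ None\<close>. Three sheets of
  the loop through one point are excluded in the same way.\<close>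

lemma inj_on_pivot:
  assumes D: "D \<subseteq> sheet_indices" and y: "y \<in> sheets D"
  shows "inj_on (pivot D) D"
proof (rule inj_onI)
  fix p q assume p: "p \<in> D" and q: "q \<in> D" and eq: "pivot D p = pivot D q"
  show "p = q"
  proof (cases "pivot D p = None")
    case True
    then show ?thesis using None_pivot_unique[OF D p _ q _ y] eq by auto
  next
    case False
    then have *: "pivot D p = fst p" "pivot D q = fst q" "fst p = fst q"
      using eq by (auto simp: pivot_def split: if_splits)
    obtain j n n' where jn: "p = (j, n)" "q = (j, n')" using *(3) by (metis prod.collapse)
    have n: "n < pieces j" "n' < pieces j" using p q D jn by (auto simp: sheet_indices_def)
    have "n = n'"
    proof (cases j rule: piece_cases)
      case 2
      then have "n = 0 \<or> n = 1" "n' = 0 \<or> n' = 1" using n by (auto simp: pieces_simps)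
      then show ?thesis using p q * False jn 2 unfolding pivot_def by (elim disjE; simp)
    next
      case 3
      then have "n = 0 \<or> n = 1 \<or> n = 2" "n' = 0 \<or> n' = 1 \<or> n' = 2" using n by (auto simp: pieces_simps)
      then show ?thesis using p q * False jn 3 unfolding pivot_def by (elim disjE; simp)
    qed (use n in \<open>simp_all add: pieces_simps\<close>)
    then show ?thesis using jn by simp
  qed
qed

text \<open>The system is triangular: \<open>None\<close> comes first, then \<open>Some i1\<close>
  from the V, then \<open>Some i2\<close> from the loop, where the drift gives it a nonzero
  coefficient; flat coordinates stand alone.\<close>

lemma sheets_determined:
  assumes D: "D \<subseteq> sheet_indices" and y: "y \<in> sheets D" "y' \<in> sheets D"
    and eq: "\<And>a. a \<notin> pivot D ` D \<Longrightarrow> y $ a = y' $ a"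
  shows "y = y'"
proof -
  have u: "y $ None = y' $ None"
  proof (cases "None \<in> pivot D ` D")
    case True
    then obtain p where p: "p \<in> D" "pivot D p = None" by force
    show ?thesis
      using None_pivot[OF D p] p(1) sheet_pair_values[OF y(1)] sheet_pair_values[OF y(2)]
      by (elim disjE conjE; simp)
  qed (use eq in blast)
  have sheet: "\<exists>n. (a, n) \<in> D" if "a \<in> pivot D ` D" "a \<noteq> None" for a
    using that by (auto simp: pivot_def split: if_splits)
  have v: "y $ Some i1 = y' $ Some i1"
  proof (cases "Some i1 \<in> pivot D ` D")
    case True
    then obtain n where n: "(Some i1, n) \<in> D" using sheet by blast
    then have "n = 0 \<or> n = 1" using D by (auto simp: sheet_indices_def pieces_simps)
    then show ?thesis
      using sheetsD[OF y(1) n] sheetsD[OF y(2) n] u by (auto simp: sheet_eqs)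
  qed (use eq in blast)
  have w: "y $ Some i2 = y' $ Some i2"
  proof (cases "Some i2 \<in> pivot D ` D")
    case True
    then obtain n where n: "(Some i2, n) \<in> D" using sheet by blast
    then have "n = 0 \<or> n = 1 \<or> n = 2" using D by (auto simp: sheet_indices_def pieces_simps)
    then show ?thesis
      using sheetsD[OF y(1) n] sheetsD[OF y(2) n] u v by (auto simp: sheet_eqs)
  qed (use eq in blast)
  have "y $ a = y' $ a" for a
  proof (cases "flat a")
    case True
    then have "a \<noteq> None" by (auto simp: flat_def)
    show ?thesis
    proof (cases "a \<in> pivot D ` D")
      case in_pivot: True
      then obtain n where "(a, n) \<in> D" using sheet \<open>a \<noteq> None\<close> by blast
      from sheetsD[OF y(1) this] sheetsD[OF y(2) this] True show ?thesis by (simp add: sheet_eqs)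
    qed (use eq in blast)
  qed (use u v w in \<open>auto simp: flat_def\<close>)
  then show ?thesis by (simp add: vec_eq_iff)
qed

lemma aff_dim_sheets:
  assumes D: "D \<subseteq> sheet_indices" and y: "y \<in> sheets D"
  shows "aff_dim (sheets D) \<le> int CARD('m option) - int (card D)"
proof -
  have "card (pivot D ` D) = card D" using inj_on_pivot[OF D y] by (rule card_image)
  then show ?thesis
    using aff_dim_le_codim_coordinates[OF affine_sheets, of D "pivot D ` D"] sheets_determined[OF D] by metis
qed

text \<open>The sheets of the disks that are not flat. Once \<open>Some i2\<close> is fixed, their
  equations describe lines in the plane of \<open>None\<close> and \<open>Some i1\<close>.\<close>

definition plane_lines :: "('m option \<times> nat) set"
  where "plane_lines = {(None, 0), (Some i1, 0), (Some i1, Suc 0), (Some i2, 0), (Some i2, Suc 0), (Some i2, 2)}"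

lemma card_plane_lines_le:
  assumes y: "y \<in> sheets D" and w: "y $ Some i2 = 0 \<or> y $ Some i2 = 1"
  shows "card (D \<inter> plane_lines) \<le> 2"
proof -
  define m where "m k \<longleftrightarrow> [(None, 0), (Some i1, 0), (Some i1, Suc 0), (Some i2, 0), (Some i2, Suc 0), (Some i2, 2)] ! k \<in> D"
    for k
  have e: "m 0 \<Longrightarrow> 8 * y $ None = 3"
    "m 1 \<Longrightarrow> 28 * y $ Some i1 + 8 * y $ None = 15"
    "m 2 \<Longrightarrow> 28 * y $ Some i1 - 8 * y $ None = 13"
    "m 3 \<Longrightarrow> 24 * y $ Some i1 - 3 * y $ Some i2 - 16 * y $ None = 3"
    "m 4 \<Longrightarrow> 24 * y $ Some i1 - 3 * y $ Some i2 = 15"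
    "m 5 \<Longrightarrow> 24 * y $ Some i1 - 3 * y $ Some i2 + 16 * y $ None = 19"
    using sheetsD[OF y, of None 0] sheetsD[OF y, of "Some i1" 0] sheetsD[OF y, of "Some i1" "Suc 0"]
      sheetsD[OF y, of "Some i2" 0] sheetsD[OF y, of "Some i2" "Suc 0"] sheetsD[OF y, of "Some i2" 2]
    unfolding m_def by (simp_all add: sheet_eqs)
  let ?l = "[(None, 0), (Some i1, 0), (Some i1, Suc 0), (Some i2, 0), (Some i2, Suc 0), (Some i2, 2)]"
  have "D \<inter> plane_lines = set (filter (\<lambda>p. p \<in> D) ?l)" by (auto simp: plane_lines_def)
  then have "card (D \<inter> plane_lines) \<le> length (filter (\<lambda>p. p \<in> D) ?l)" using card_length by metis
  also have "\<dots> = of_bool (m 0) + of_bool (m 1) + of_bool (m 2) + of_bool (m 3) + of_bool (m 4) + of_bool (m 5)"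
    unfolding m_def by simp
  also have "\<dots> \<le> (2::nat)"
    by (rule at_most_two_lines[OF w]) (use e in blast)+
  finally show ?thesis .
qed

text \<open>The six lines have different slopes, so any two of them meet in a single point.\<close>

lemma plane_lines_determined:
  assumes p: "p \<in> plane_lines" "q \<in> plane_lines" "p \<noteq> q"
    and y: "sheet_eq (fst p) (snd p) y = 0" "sheet_eq (fst q) (snd q) y = 0"
      "sheet_eq (fst p) (snd p) y' = 0" "sheet_eq (fst q) (snd q) y' = 0" "y $ Some i2 = y' $ Some i2"
  shows "y $ None = y' $ None \<and> y $ Some i1 = y' $ Some i1"
  using p y i12 unfolding plane_lines_def by (elim insertE emptyE; simp add: sheet_eqs; linarith?)

text \<open>The facet equation raises the codimension by one if its coordinate is not a pivot. Only
  \<open>Some i2\<close> can be both, being the pivot of the loop. On those facets the sheets that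
  are not flat become lines in a plane: at most two pass through a point, and two determine
  it.\<close>

lemma aff_dim_sheets_facet:
  assumes D: "D \<subseteq> sheet_indices" and y0: "y0 \<in> sheets D" "y0 \<in> std_ball" and i: "y0 $ i = 0 \<or> y0 $ i = 1"
  shows "aff_dim (sheets D \<inter> {y. y $ i = y0 $ i}) \<le> int CARD('m option) - 1 - int (card D)"
proof -
  let ?A = "sheets D \<inter> {y. y $ i = y0 $ i}"
  have "{y :: real ^ 'm option. y $ i = y0 $ i} = {y. axis i 1 \<bullet> y = y0 $ i}" by (simp add: inner_axis')
  then have aff: "affine ?A" using affine_sheets affine_hyperplane by (metis affine_Int)
  have fin: "finite D" using D finite_sheet_indices finite_subset by blast
  have main: ?thesis if card: "card I = Suc (card D)"
    and det: "\<And>y y'. y \<in> ?A \<Longrightarrow> y' \<in> ?A \<Longrightarrow> (\<And>a. a \<notin> I \<Longrightarrow> y $ a = y' $ a) \<Longrightarrow> y = y'" for I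
    using aff_dim_le_codim_coordinates[OF aff, of I] det card by fastforce
  show ?thesis
  proof (cases "i = Some i2")
    case False
    \<comment> \<open>A pivot coordinate of \<open>y0\<close> would be neither 0 nor 1:
      \<open>None\<close> takes one of the five values above, a flat coordinate is 1/2, and a sheet
      of the V reaches v = 0 or v = 1 only with \<open>None\<close> outside the unit
      interval.\<close>
    have "i \<notin> pivot D ` D"
    proof
      assume "i \<in> pivot D ` D"
      then obtain p where p: "p \<in> D" "pivot D p = i" by blast
      show False
      proof (cases "i = None")
        case True
        then show False using None_pivot_value[OF D p(1) _ y0(1)] p(2) i by auto
      next
        case iN: False
        then obtain n where pn: "p = (i, n)" using p(2) by (cases p) (auto simp: pivot_def split: if_splits)
        have eq: "sheet_eq i n y0 = 0" using sheetsD[OF y0(1)] p(1) pn by blast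
        have u: "0 \<le> y0 $ None" "y0 $ None \<le> 1" using y0(2) by (simp_all add: mem_std_ball)
        show False
        proof (cases "i = Some i1")
          case True
          then have "n = 0 \<or> n = 1" using D p(1) pn by (auto simp: sheet_indices_def pieces_simps)
          then show False using eq True i u by (auto simp: sheet_eqs)
        next
          case i1: False
          then have "flat i" using iN False by (simp add: flat_def)
          then show False using eq i by (auto simp: sheet_eqs)
        qed
      qed
    qed
    then have "card (insert i (pivot D ` D)) = Suc (card D)"
      using fin card_image[OF inj_on_pivot[OF D y0(1)]] by simp
    then show ?thesis
    proof (rule main)
      fix y y' assume y: "y \<in> ?A" "y' \<in> ?A" and eq: "\<And>a. a \<notin> insert i (pivot D ` D) \<Longrightarrow> y $ a = y' $ a"
      have "y $ a = y' $ a" if "a \<notin> pivot D ` D" for a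
        using eq[of a] that y by (cases "a = i") auto
      then show "y = y'" using y by (intro sheets_determined[OF D]) auto
    qed
  next
    case True
    let ?D0 = "D \<inter> plane_lines" and ?Dr = "D - plane_lines"
    have Dr: "flat j \<and> n = 0" if "(j, n) \<in> ?Dr" for j n
    proof -
      have "n < pieces j" using that D by (auto simp: sheet_indices_def)
      then show ?thesis by (rule less_piecesE) (use that in \<open>auto simp: plane_lines_def\<close>)
    qed
    have card_D: "card D = card ?D0 + card ?Dr"
      using fin by (rule card_Int_Diff)
    have cardr: "card (fst ` ?Dr) = card ?Dr"
    proof (rule card_image, rule inj_onI)
      fix p q assume "p \<in> ?Dr" "q \<in> ?Dr" "fst p = fst q"
      then show "p = q" using Dr[of "fst p" "snd p"] Dr[of "fst q" "snd q"] by (cases p; cases q) auto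
    qed
    have sheet: "sheet_eq (fst p) (snd p) y = 0" if "p \<in> D" "y \<in> sheets D" for p y
      using sheetsD[OF that(2), of "fst p" "snd p"] that(1) by simp
    have le2: "card ?D0 \<le> 2"
      by (rule card_plane_lines_le[OF y0(1)]) (use i True in auto)
    have flat_det: "y $ a = y' $ a" if "y \<in> ?A" "y' \<in> ?A" "\<And>a. a \<notin> insert (Some i2) (I0 \<union> fst ` ?Dr) \<Longrightarrow> y $ a = y' $ a"
       "I0 \<subseteq> {None, Some i1}" "flat a" for y y' a I0
    proof (cases "a \<in> fst ` ?Dr")
      case in_Dr: True
      then obtain n where "(a, n) \<in> D" by auto
      then show ?thesis
        using sheetsD[of y D a n] sheetsD[of y' D a n] that(1,2,5) by (auto simp: sheet_eqs)
    next
      case False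
      then show ?thesis using that by (auto simp: flat_def)
    qed
    obtain I0 where I0: "I0 \<subseteq> {None, Some i1}" "card I0 = card ?D0"
      and det: "\<And>y y'. y \<in> sheets D \<Longrightarrow> y' \<in> sheets D \<Longrightarrow> y $ Some i2 = y' $ Some i2 \<Longrightarrow>
        (\<And>a. a \<in> {None, Some i1} - I0 \<Longrightarrow> y $ a = y' $ a) \<Longrightarrow> y $ None = y' $ None \<and> y $ Some i1 = y' $ Some i1"
    proof -
      consider "card ?D0 = 0" | "card ?D0 = 1" | "card ?D0 = 2" using le2 by linarith
      then show ?thesis
      proof cases
        case 1
        show ?thesis by (rule that[of "{}"]) (use 1 in auto)
      next
        case 2
        then obtain p where p: "?D0 = {p}" by (auto simp: card_1_singleton_iff)
        show ?thesis
        proof (rule that[of "if p = (None, 0) then {None} else {Some i1}"])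
          fix y y' assume y: "y \<in> sheets D" "y' \<in> sheets D" "y $ Some i2 = y' $ Some i2"
            and eq: "\<And>a. a \<in> {None, Some i1} - (if p = (None, 0) then {None} else {Some i1}) \<Longrightarrow> y $ a = y' $ a"
          have pD: "p \<in> D" "p \<in> plane_lines" using p by auto
          show "y $ None = y' $ None \<and> y $ Some i1 = y' $ Some i1"
            using pD(2) sheet[OF pD(1) y(1)] sheet[OF pD(1) y(2)] y(3) eq[of None] eq[of "Some i1"]
            unfolding plane_lines_def by (elim insertE emptyE; simp add: sheet_eqs)
        qed (use 2 in auto)
      next
        case 3
        then obtain p q where pq: "?D0 = {p, q}" "p \<noteq> q" by (auto simp: card_2_iff)
        then have D: "p \<in> D" "q \<in> D" "p \<in> plane_lines" "q \<in> plane_lines" by auto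
        show ?thesis
          by (rule that[of "{None, Some i1}"])
             (use 3 plane_lines_determined[OF D(3,4) pq(2)] sheet[OF D(1)] sheet[OF D(2)] in auto)
      qed
    qed
    have nf: "j \<notin> fst ` ?Dr" if "\<not> flat j" for j
      using Dr that by auto
    have nf3: "None \<notin> fst ` ?Dr" "Some i1 \<notin> fst ` ?Dr" "Some i2 \<notin> fst ` ?Dr"
      by (rule nf; simp add: flat_def)+
    have "finite I0" using I0(1) finite_subset by blast
    moreover have "I0 \<inter> F = {}" if "None \<notin> F" "Some i1 \<notin> F" for F
      using that I0(1) by auto
    note this[OF nf3(1,2)]
    moreover have "Some i2 \<notin> I0 \<union> fst ` ?Dr"
      using I0(1) nf3(3) i12 by auto
    ultimately have "card (insert (Some i2) (I0 \<union> fst ` ?Dr)) = Suc (card D)"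
      using fin card_D cardr I0(2) by (simp add: card_Un_disjoint)
    then show ?thesis
    proof (rule main)
      fix y y' assume y: "y \<in> ?A" "y' \<in> ?A" and eq: "\<And>a. a \<notin> insert (Some i2) (I0 \<union> fst ` ?Dr) \<Longrightarrow> y $ a = y' $ a"
      have w: "y $ Some i2 = y' $ Some i2" using y True by auto
      have uv: "y $ None = y' $ None \<and> y $ Some i1 = y' $ Some i1"
        using y w eq i12 nf3 by (intro det) auto
      have "y $ a = y' $ a" for a
        using uv w flat_det[OF y eq I0(1), of a] by (cases a rule: piece_cases) auto
      then show "y = y'" by (simp add: vec_eq_iff)
    qed
  qed
qed

section \<open>Counting the sheets through cells\<close>

definition slabs_of :: "'m option \<Rightarrow> (real ^ 'm) set \<Rightarrow> nat set"
  where "slabs_of j C = {n. n < pieces j \<and> C \<subseteq> slab j n}"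

text \<open>A cell meeting the interior is either a slab, of codimension 1 in the target, or a wall
  between neighbouring slabs, of codimension 2 and contained in both.\<close>

lemma cell_codim_le:
  assumes C: "C \<in> cells j" "C \<inter> interior std_ball \<noteq> {}"
  shows "int CARD('m option) - aff_dim C \<le> int (card (slabs_of j C))"
proof -
  obtain n where n: "n < pieces j" and F: "C face_of slab j n" using C(1) by (auto simp: cells_def)
  have CS: "C \<subseteq> slab j n" using F by (rule face_of_imp_subset)
  have fin: "finite (slabs_of j C)" by (simp add: slabs_of_def)
  have nS: "n \<in> slabs_of j C" using n CS by (simp add: slabs_of_def)
  have int_slab: "x \<in> interior (slab j n)" if "break j n < x $ i1" "x $ i1 < break j (Suc n)" "\<And>i. 0 < x $ i \<and> x $ i < 1" for x
    using that by (auto simp: slab_def interior_cbox mem_box_cart)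
  have card1: "1 \<le> card (slabs_of j C)" using nS fin by (metis One_nat_def Suc_leI card_gt_0_iff empty_iff)
  have full: ?thesis if "x \<in> C" "x \<in> interior (slab j n)" for x
  proof -
    have "slab j n \<subseteq> C"
      using subset_of_face_of[OF F order_refl] that interior_subset_rel_interior by blast
    then have "C = slab j n" using CS by blast
    then have "aff_dim C = int CARD('m)" using that aff_dim_nonempty_interior[of C] by auto
    then show ?thesis using card1 by simp
  qed
  obtain x where xC: "x \<in> C" "x \<in> interior std_ball" using C(2) by blast
  then have x: "x \<in> C" "\<And>i. 0 < x $ i \<and> x $ i < 1" using mem_interior_std_ball by blast+
  have xb: "break j n \<le> x $ i1" "x $ i1 \<le> break j (Suc n)" using x CS by (auto simp: mem_slab)
  show ?thesis
  proof (cases "\<exists>x'\<in>C. x' $ i1 \<noteq> x $ i1")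
    case True
    then obtain x' where x': "x' \<in> C" "x' $ i1 \<noteq> x $ i1" by blast
    \<comment> \<open>The midpoint is strictly between the breaks, as \<open>x\<close> and
      \<open>x'\<close> differ in \<open>i1\<close>, and it is interior in the other directions
      because \<open>x\<close> is.\<close>
    let ?w = "(1/2) *\<^sub>R x + (1/2) *\<^sub>R x'"
    have "convex C" using F face_of_imp_convex by blast
    then have wC: "?w \<in> C" using x(1) x'(1) by (intro convexD) auto
    have x'b: "break j n \<le> x' $ i1" "x' $ i1 \<le> break j (Suc n)" "\<And>i. 0 \<le> x' $ i \<and> x' $ i \<le> 1"
      using x'(1) CS slab_subset[OF n] by (auto simp: mem_slab mem_std_ball)
    have "0 < ?w $ i \<and> ?w $ i < 1" for i using x(2)[of i] x'b(3)[of i] by simp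
    moreover have "break j n < ?w $ i1" "?w $ i1 < break j (Suc n)"
      using xb x'b x'(2) by (auto simp: field_simps)
    ultimately have "?w \<in> interior (slab j n)" by (intro int_slab)
    then show ?thesis using full wC by blast
  next
    case False
    then have Ceq: "\<And>x'. x' \<in> C \<Longrightarrow> x' $ i1 = x $ i1" by blast
    show ?thesis
    proof (cases "break j n < x $ i1 \<and> x $ i1 < break j (Suc n)")
      case True
      then show ?thesis using full[OF x(1)] int_slab x(2) by blast
    next
      case bd: False
      define H where "H = {w :: real ^ 'm. axis i1 1 \<bullet> w = x $ i1}"
      let ?U = "H \<inter> interior std_ball"
      have Ux: "x \<in> ?U" using xC(2) by (simp add: H_def inner_axis')
      have "affine H" unfolding H_def by (rule affine_hyperplane)
      moreover have "?U \<noteq> {}" using Ux by blast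
      ultimately have hull: "affine hull ?U = H"
        by (metis affine_hull_affine_Int_open hull_same open_interior)
      have "openin (top_of_set (affine hull ?U)) ?U"
        unfolding hull by (intro openin_open_Int open_interior)
      then have "rel_interior ?U = ?U" by (rule rel_interior_openin)
      have "?U \<subseteq> slab j n"
        using xb by (auto simp: H_def mem_slab inner_axis' mem_box_cart less_imp_le)
      then have "?U \<subseteq> C"
        using subset_of_face_of[OF F, of ?U] x(1) Ux \<open>rel_interior ?U = ?U\<close> by blast
      then have "aff_dim ?U \<le> aff_dim C" by (rule aff_dim_subset)
      moreover have "aff_dim ?U = int CARD('m) - 1"
        using aff_dim_hyperplane[of "axis i1 (1::real)" "x $ i1"] hull aff_dim_affine_hull[of ?U] by (simp add: H_def)
      ultimately have dim: "int CARD('m) - 1 \<le> aff_dim C" by simp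
      obtain n' where n': "n' < pieces j" "n' \<noteq> n" "C \<subseteq> slab j n'"
      proof (cases "x $ i1 = break j n")
        case True
        then have "n \<noteq> 0" using x(2)[of i1] break_pieces(1)[of j] by (metis less_irrefl)
        then obtain n' where "n = Suc n'" by (cases n) auto
        moreover have "C \<subseteq> slab j n'"
          using calculation CS Ceq True break_mono[of n' j] n by (fastforce simp: mem_slab)
        ultimately show ?thesis using that[of n'] n by auto
      next
        case xn: False
        then have xS: "x $ i1 = break j (Suc n)" using bd xb by auto
        then have "Suc n \<noteq> pieces j" using x(2)[of i1] break_pieces(2)[of j] by (metis less_irrefl)
        then have "Suc n < pieces j" using n by simp
        moreover have "C \<subseteq> slab j (Suc n)"
          using calculation CS Ceq xS break_mono[of "Suc n" j] by (fastforce simp: mem_slab)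
        ultimately show ?thesis using that[of "Suc n"] by auto
      qed
      have "{n, n'} \<subseteq> slabs_of j C" using nS n' by (simp add: slabs_of_def)
      then have "card {n, n'} \<le> card (slabs_of j C)" using fin by (rule card_mono[rotated])
      then have "2 \<le> card (slabs_of j C)" using n'(2) by simp
      then show ?thesis using dim by simp
    qed
  qed
qed

lemma disks_inj_slab:
  "n < pieces j \<Longrightarrow> x \<in> slab j n \<Longrightarrow> x' \<in> slab j n \<Longrightarrow> disks j x = disks j x' \<Longrightarrow> x = x'"
  by (metis disks_eq_piece inj_piece)

text \<open>The map is injective on a slab, and distinct faces have disjoint relative interiors.
  Cells of one disk whose images share a point therefore lie in no common slab, so no sheet is
  counted twice.\<close>

lemma cells_image_disjoint:
  assumes C: "C \<in> cells j" "C' \<in> cells j" "C \<noteq> C'" and n: "n \<in> slabs_of j C" "n \<in> slabs_of j C'"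
  shows "disks j ` rel_interior C \<inter> disks j ` rel_interior C' = {}"
proof -
  have n': "n < pieces j" "C \<subseteq> slab j n" "C' \<subseteq> slab j n" using n by (auto simp: slabs_of_def)
  have face: "B face_of slab j n" if "B \<in> cells j" "B \<subseteq> slab j n" for B
  proof -
    have "slab j n \<in> cells j"
      unfolding cells_def using n'(1) face_of_refl[of "slab j n"] by (auto simp: slab_def)
    then have "(B \<inter> slab j n) face_of slab j n"
      using PL_disks that(1) unfolding PL_disks_map_def cell_complex_def by blast
    then show ?thesis using that(2) by (simp add: inf.absorb1)
  qed
  have "rel_interior C \<inter> rel_interior C' = {}"
    using face_of_eq[OF face[OF C(1) n'(2)] face[OF C(2) n'(3)]] C(3) by blast
  moreover have "disks j x = disks j x' \<Longrightarrow> x = x'" if "x \<in> C" "x' \<in> C'" for x x'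
    using disks_inj_slab[OF n'(1), of x x'] that n' by blast
  ultimately show ?thesis using rel_interior_subset by fastforce
qed

text \<open>Both dimension bounds count distinct sheets through a point: a cell contributes all
  slabs containing it, a boundary preimage the slab selected by \<open>index\<close>.\<close>

lemma general_position_disks: "general_position_wrt cells disks"
  unfolding general_position_wrt_def
proof (intro conjI allI ballI impI)
  fix j C assume "C \<in> cells j"
  then obtain n where n: "n < pieces j" "C \<subseteq> slab j n"
    unfolding cells_def using face_of_imp_subset by blast
  show "inj_on (disks j) C"
  proof (rule inj_onI)
    fix x x' assume "x \<in> C" "x' \<in> C" "disks j x = disks j x'"
    then show "x = x'" using disks_inj_slab[OF n(1), of x x'] n(2) by blast
  qed
next
  fix \<S> :: "('m option \<times> (real ^ 'm) set) set"
  assume S: "finite \<S> \<and> (\<forall>(j, C)\<in>\<S>. C \<in> cells j \<and> C \<inter> interior std_ball \<noteq> {})"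
  let ?T = "\<Inter>(j, C)\<in>\<S>. disks j ` rel_interior C"
  show "aff_dim ?T \<le> max (-1) (int CARD('m option) - (\<Sum>(j, C)\<in>\<S>. int CARD('m option) - aff_dim C))"
  proof (cases "?T = {}")
    case False
    then obtain y where y: "y \<in> ?T" by blast
    let ?f = "\<lambda>(j, C). {j} \<times> slabs_of j C"
    let ?D = "\<Union>p\<in>\<S>. ?f p"
    have D: "?D \<subseteq> sheet_indices" by (auto simp: slabs_of_def sheet_indices_def)
    have T: "?T \<subseteq> sheets ?D"
    proof
      fix z assume z: "z \<in> ?T"
      have "sheet_eq j n z = 0" if jC: "(j, C) \<in> \<S>" and n: "n \<in> slabs_of j C" for j C n
      proof -
        have n': "n < pieces j" "C \<subseteq> slab j n" using n by (auto simp: slabs_of_def)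
        obtain x where "x \<in> rel_interior C" "z = disks j x" using z jC by blast
        then have "z = piece j n x" using disks_eq_piece[OF n'(1), of x] n'(2) rel_interior_subset by blast
        then show ?thesis using sheet_eq_piece[OF n'(1)] by simp
      qed
      then show "z \<in> sheets ?D" unfolding sheets_def by blast
    qed
    have disj: "?f p \<inter> ?f q = {}" if pq: "p \<in> \<S>" "q \<in> \<S>" "p \<noteq> q" for p q
    proof (rule ccontr)
      assume ne: "?f p \<inter> ?f q \<noteq> {}"
      obtain j C where p: "p = (j, C)" by force
      obtain j' C' where q: "q = (j', C')" by force
      obtain n where n: "n \<in> slabs_of j C" "n \<in> slabs_of j C'" "j' = j" using ne p q by auto
      have "y \<in> disks j ` rel_interior C \<inter> disks j ` rel_interior C'" using y pq p q n(3) by blast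
      moreover have "C \<in> cells j" "C' \<in> cells j" using S pq p q n(3) by auto
      ultimately show False using cells_image_disjoint[of C j C' n] pq(3) p q n by auto
    qed
    have "(\<Sum>(j, C)\<in>\<S>. int CARD('m option) - aff_dim C) \<le> (\<Sum>(j, C)\<in>\<S>. int (card (slabs_of j C)))"
    proof (rule sum_mono)
      fix p assume pS: "p \<in> \<S>"
      obtain j C where p: "p = (j, C)" by force
      have "C \<in> cells j \<and> C \<inter> interior std_ball \<noteq> {}"
        using bspec[OF conjunct2[OF S] pS] unfolding p prod.case .
      then show "(case p of (j, C) \<Rightarrow> int CARD('m option) - aff_dim C) \<le> (case p of (j, C) \<Rightarrow> int (card (slabs_of j C)))"
        unfolding p prod.case by (intro cell_codim_le) blast+
    qed
    also have "\<dots> = (\<Sum>p\<in>\<S>. int (card (?f p)))"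
      by (rule sum.cong) (auto simp: card_cartesian_product)
    also have "\<dots> = int (card ?D)"
    proof -
      have "card ?D = (\<Sum>p\<in>\<S>. card (?f p))"
      proof (rule card_UN_disjoint)
        show "finite \<S>" using S by blast
        show "\<forall>p\<in>\<S>. finite (?f p)" by (auto simp: slabs_of_def)
        show "\<forall>p\<in>\<S>. \<forall>q\<in>\<S>. p \<noteq> q \<longrightarrow> ?f p \<inter> ?f q = {}" using disj by blast
      qed
      then show ?thesis by simp
    qed
    finally have le: "(\<Sum>(j, C)\<in>\<S>. int CARD('m option) - aff_dim C) \<le> int (card ?D)" .
    have "aff_dim ?T \<le> aff_dim (sheets ?D)" using T by (rule aff_dim_subset)
    also have "\<dots> \<le> int CARD('m option) - int (card ?D)"
      using aff_dim_sheets[OF D] T y by blast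
    finally show ?thesis using le by linarith
  qed simp
next
  fix k :: nat assume k: "1 \<le> k"
  let ?d = "int CARD('m option) - 1 - int k"
  let ?\<A> = "{A. \<exists>D\<in>Pow sheet_indices. \<exists>i\<in>UNIV. \<exists>e\<in>{0,1::real}. A = sheets D \<inter> {y. y $ i = e} \<and> aff_dim A \<le> ?d}"
  show "dim_at_most (boundary_multiple_points disks k) ?d"
    unfolding dim_at_most_def
  proof (intro exI[of _ ?\<A>] conjI ballI)
    have "?\<A> \<subseteq> (\<lambda>(D, i, e). sheets D \<inter> {y. y $ i = e}) ` (Pow sheet_indices \<times> UNIV \<times> {0,1})" by auto
    moreover have "finite (Pow sheet_indices \<times> (UNIV :: 'm option set) \<times> {0,1::real})"
      using finite_sheet_indices by auto
    ultimately show "finite ?\<A>" using finite_surj by blast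
    show "affine A" "aff_dim A \<le> ?d" if AA: "A \<in> ?\<A>" for A
    proof -
      obtain D and i :: "'m option" and e :: real where A: "A = sheets D \<inter> {y. y $ i = e}" "aff_dim A \<le> ?d" using AA by blast
      have "{y :: real ^ 'm option. y $ i = e} = {y. axis i 1 \<bullet> y = e}" by (simp add: inner_axis')
      then show "affine A" using A(1) affine_sheets affine_hyperplane by (metis affine_Int)
      show "aff_dim A \<le> ?d" by (rule A(2))
    qed
    show "boundary_multiple_points disks k \<subseteq> \<Union>?\<A>"
    proof
      fix y assume "y \<in> boundary_multiple_points disks k"
      then obtain P where P': "finite P \<and> card P = k \<and> (\<forall>(j, x)\<in>P. x \<in> std_sphere \<and> disks j x = y)"
        unfolding boundary_multiple_points_def mem_Collect_eq by (rule exE)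
      have P: "finite P" "card P = k" "x \<in> std_sphere \<and> disks j x = y" if "(j, x) \<in> P" for j x
        using P' bspec[OF conjunct2[OF conjunct2[OF P']] that] unfolding prod.case by (simp_all only:)
      have Pk: "finite P" "card P = k" using P' by (simp_all only:)
      let ?g = "\<lambda>(j, x). (j, index j (x $ i1))"
      let ?D = "?g ` P"
      have xb: "x \<in> std_ball" if "(j, x) \<in> P" for j x
        using P(3)[OF that] frontier_std_ball by blast
      have inj: "inj_on ?g P"
      proof (rule inj_onI)
        fix p q assume pq: "p \<in> P" "q \<in> P" "?g p = ?g q"
        obtain j x where p: "p = (j, x)" by force
        obtain j' x' where q: "q = (j', x')" by force
        have eq: "j' = j" "index j (x' $ i1) = index j (x $ i1)" using pq(3) p q by auto
        let ?n = "index j (x $ i1)"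
        have sl: "x \<in> slab j ?n" "x' \<in> slab j ?n" "?n < pieces j"
          using mem_slab_index[of x j] mem_slab_index[of x' j] xb[of j x] xb[of j' x'] pq(1,2) p q eq by auto
        have "piece j ?n x = piece j ?n x'"
          using disks_eq_piece[OF sl(3,1)] disks_eq_piece[OF sl(3,2)] P(3)[of j x] P(3)[of j' x'] pq(1,2) p q eq by auto
        then show "p = q" using inj_piece[OF sl(3)] p q eq by blast
      qed
      have D: "?D \<subseteq> sheet_indices"
        using mem_slab_index xb by (auto simp: sheet_indices_def)
      have "sheet_eq j (index j (x $ i1)) y = 0" if "(j, x) \<in> P" for j x
        using mem_slab_index[OF xb[OF that], of j] sheet_eq_piece[of "index j (x $ i1)" j x]
           disks_eq_piece[of "index j (x $ i1)" j x] P(3)[OF that] by auto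
      then have y: "y \<in> sheets ?D" unfolding sheets_def by auto
      have "P \<noteq> {}" using Pk(2) k by auto
      then obtain j x where jx: "(j, x) \<in> P" by auto
      then have "y \<in> std_sphere"
        using proper_disks P(3)[OF jx] unfolding proper_disks_map_def by blast
      then obtain i where yi: "y \<in> std_ball" "y $ i = 0 \<or> y $ i = 1" by (auto simp: frontier_std_ball)
      have "card ?D = k" using card_image[OF inj] Pk(2) by simp
      then have "aff_dim (sheets ?D \<inter> {z. z $ i = y $ i}) \<le> ?d"
        using aff_dim_sheets_facet[OF D y yi] by simp
      then have "sheets ?D \<inter> {z. z $ i = y $ i} \<in> ?\<A>" using D yi(2) by blast
      then show "y \<in> \<Union>?\<A>" using y by blast
    qed
  qed
qed

lemma general_position_PL_disks: "general_position_PL disks"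
  using PL_disks general_position_disks unfolding general_position_PL_def by blast

end

subsection \<open>The algebraic intersection number\<close>

text \<open>A permutation with a nonzero term never raises \<open>r\<close> and lowers it wherever
  it moves an index; since it preserves the sum of \<open>r\<close>, it is the identity. The rank
  function stands in for an ordering of the index type.\<close>

lemma det_triangular_rank:
  fixes A :: "real ^ 'n ^ 'n" and r :: "'n \<Rightarrow> nat"
  assumes tri: "\<And>i j. A $ i $ j \<noteq> 0 \<Longrightarrow> i = j \<or> r j < r i"
  shows "det A = (\<Prod>i\<in>UNIV. A $ i $ i)"
proof -
  let ?t = "\<lambda>p. of_int (sign p) * (\<Prod>i\<in>UNIV. A $ i $ p i)"
  have "?t p = 0" if p: "p permutes UNIV" "p \<noteq> id" for p
  proof (rule ccontr)
    assume "?t p \<noteq> 0"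
    then have "A $ i $ p i \<noteq> 0" for i by auto
    then have le: "p i = i \<or> r (p i) < r i" for i using tri by metis
    obtain k where k: "p k \<noteq> k" using p(2) by (auto simp: fun_eq_iff)
    have "(\<Sum>i\<in>UNIV. r (p i)) < (\<Sum>i\<in>UNIV. r i)"
      by (rule sum_strict_mono_ex1) (use le k in \<open>auto intro: less_imp_le simp: order_le_less\<close>, metis)
    moreover have "(\<Sum>i\<in>UNIV. r (p i)) = (\<Sum>i\<in>UNIV. r i)"
      using sum.permute[OF p(1), of r] by (simp add: o_def)
    ultimately show False by simp
  qed
  then have "det A = (\<Sum>p\<in>{id}. ?t p)"
    unfolding det_def by (intro sum.mono_neutral_right) (auto simp: permutes_id finite_permutations)
  then show ?thesis by (simp add: sign_id)
qed

definition normal_matrix :: "real ^ 'm option \<Rightarrow> (real ^ 'm \<Rightarrow> real ^ 'm option) \<Rightarrow> real ^ 'm::finite option ^ 'm option"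
  where "normal_matrix w L = (\<chi> a b. (case b of None \<Rightarrow> w | Some i \<Rightarrow> L (axis i 1)) $ a)"

lemma linear_sum_axis:
  fixes L :: "real ^ 'm \<Rightarrow> 'b::real_vector"
  assumes "linear L"
  shows "L z = (\<Sum>i\<in>UNIV. z $ i *\<^sub>R L (axis i 1))"
proof -
  have "z = (\<Sum>i\<in>UNIV. z $ i *\<^sub>R axis i 1)"
    by (simp add: vec_eq_iff axis_def if_distrib cong: if_cong)
  then have "L z = L (\<Sum>i\<in>UNIV. z $ i *\<^sub>R axis i 1)" by simp
  then show ?thesis using assms by (simp add: linear_sum linear_scale)
qed

lemma UNIV_option: "(UNIV :: 'm::finite option set) = insert None (range Some)"
  by (rule UNIV_option_conv)

lemma sum_option: "(\<Sum>a\<in>(UNIV :: 'm::finite option set). g a) = g None + (\<Sum>i\<in>UNIV. g (Some i))"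
  by (simp add: UNIV_option sum.reindex)

text \<open>Adding a combination of the other columns to the column \<open>None\<close> leaves the
  determinant unchanged. The sign test for a normal thus reduces to the vector
  \<open>axis None 1\<close>.\<close>

lemma det_normal_matrix:
  assumes L: "linear L"
  shows "det (normal_matrix (c *\<^sub>R w + L z) L) = c * det (normal_matrix w L)"
proof -
  let ?T = "\<chi> a b. if b = None then (case a of None \<Rightarrow> c | Some i \<Rightarrow> z $ i) else if a = b then 1 else 0"
  have "normal_matrix (c *\<^sub>R w + L z) L = normal_matrix w L ** ?T"
  proof -
    have "(c *\<^sub>R w + L z) $ a = c * w $ a + (\<Sum>i\<in>UNIV. L (axis i 1) $ a * z $ i)" for a
      using arg_cong[OF linear_sum_axis[OF L, of z], of "\<lambda>v. v $ a"] by (simp add: mult.commute)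
    moreover have "(\<Sum>i\<in>UNIV. L (axis i 1) $ a * (if i = k then 1 else 0)) = L (axis k 1) $ a" for a k
      by (simp add: if_distrib cong: if_cong)
    ultimately show ?thesis
      by (auto simp: normal_matrix_def matrix_matrix_mult_def vec_eq_iff sum_option mult.commute split: option.splits)
  qed
  moreover have "det ?T = c"
  proof -
    have "det ?T = (\<Prod>a\<in>UNIV. ?T $ a $ a)"
      by (rule det_triangular_rank[of _ "\<lambda>a. if a = None then 0 else 1"]) (auto split: if_splits)
    also have "\<dots> = c" by (simp add: UNIV_option prod.reindex)
    finally show ?thesis .
  qed
  ultimately show ?thesis by (simp add: det_mul mult.commute)
qed

lemma positive_normal_alt:
  "positive_normal L n \<longleftrightarrow> (\<forall>v. n \<bullet> L v = 0) \<and> det (normal_matrix n L) > 0"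
  by (simp add: positive_normal_def normal_matrix_def)

text \<open>A nonzero normal and the range of \<open>L\<close> together span the space, so the
  determinant is nonzero and one of the two directions is positive. This is what gives the
  \<open>SOME\<close> in \<open>normal_at\<close> its meaning.\<close>

lemma ex_positive_normal:
  fixes L :: "real ^ 'm \<Rightarrow> real ^ 'm::finite option"
  assumes L: "linear L" "inj L"
  shows "\<exists>n. positive_normal L n"
proof -
  have "dim (range L) = CARD('m)"
    using dim_image_eq[of L UNIV] L by simp
  then have "dim (range L) < DIM(real ^ 'm option)" by simp
  then obtain n where n: "n \<noteq> 0" "\<And>y. y \<in> span (range L) \<Longrightarrow> orthogonal n y"
    using orthogonal_to_subspace_exists by blast
  then have orth: "n \<bullet> L v = 0" for v using span_base[of "L v" "range L"] by (auto simp: orthogonal_def)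
  have "det (normal_matrix n L) \<noteq> 0"
  proof -
    have "normal_matrix n L *v x = 0 \<Longrightarrow> x = 0" for x
    proof -
      assume eq: "normal_matrix n L *v x = 0"
      let ?z = "\<chi> i. x $ Some i"
      have "normal_matrix n L *v x = x $ None *\<^sub>R n + L ?z"
        using linear_sum_axis[OF L(1), of ?z]
        by (simp add: vec_eq_iff matrix_vector_mult_def normal_matrix_def sum_option mult.commute)
      then have e: "x $ None *\<^sub>R n + L ?z = 0" using eq by simp
      then have "n \<bullet> (x $ None *\<^sub>R n + L ?z) = 0" by simp
      then have "x $ None = 0" using n(1) by (simp add: inner_add_right orth)
      then have "L ?z = 0" using e by simp
      then have "?z = 0" using L linear_injective_0 by blast
      have "x $ a = 0" for a
        using \<open>x $ None = 0\<close> arg_cong[OF \<open>?z = 0\<close>, of "\<lambda>v. v $ the a"] by (cases a) auto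
      then show "x = 0" by (simp add: vec_eq_iff)
    qed
    then show ?thesis by (metis invertible_det_nz invertible_left_inverse matrix_left_invertible_ker)
  qed
  moreover have "det (normal_matrix (- n) L) = - det (normal_matrix n L)"
    using det_normal_matrix[OF L(1), of "-1" n 0] L(1) by (simp add: linear_0)
  ultimately have "positive_normal L n \<or> positive_normal L (- n)"
    unfolding positive_normal_alt using orth by (auto simp: linorder_neq_iff)
  then show ?thesis by blast
qed

lemma prod_remove_two:
  fixes g :: "'a::finite \<Rightarrow> real"
  assumes "a \<noteq> b"
  shows "(\<Prod>j\<in>UNIV. g j) = g a * g b * (\<Prod>j\<in>UNIV - {a, b}. g j)"
proof -
  have "UNIV = insert a (insert b (UNIV - {a, b}))" by auto
  then have "prod g UNIV = prod g (insert a (insert b (UNIV - {a, b})))" by simp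
  then show ?thesis using assms by (simp add: mult.assoc)
qed

context two_axes
begin

section \<open>Normals and common points of the disks\<close>

lemma inj_lin: "n < pieces j \<Longrightarrow> inj (lin j n)"
  using inj_piece by (auto simp: inj_def lin_def)

lemma frechet_derivative_disks:
  assumes n: "n < pieces j" and x: "x \<in> interior (slab j n)"
  shows "frechet_derivative (disks j) (at x) = lin j n"
proof -
  have "(lin j n has_derivative lin j n) (at x)"
    using linear_lin linear_conv_bounded_linear bounded_linear_imp_has_derivative by blast
  then have "((\<lambda>x. lin j n x + piece j n 0) has_derivative lin j n) (at x)"
    by (rule has_derivative_add_const)
  then have "(piece j n has_derivative lin j n) (at x)"
    by (simp add: piece_eq_lin[symmetric])
  moreover have "piece j n z = disks j z" if "z \<in> interior (slab j n)" for z
    using disks_eq_piece[OF n, of z] interior_subset[of "slab j n"] that by auto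
  ultimately have "(disks j has_derivative lin j n) (at x)"
    using has_derivative_transform_within_open[OF _ open_interior x] by blast
  then show ?thesis by (metis frechet_derivative_at)
qed

text \<open>The plane on which the disk \<open>None\<close> and all flat disks meet; the V cuts it in \<open>v = 3/7\<close> and
  \<open>v = 4/7\<close>.\<close>

definition crossing :: "real \<Rightarrow> real \<Rightarrow> real ^ 'm option"
  where "crossing v w = (\<chi> a. case a of None \<Rightarrow> 3/8 | Some l \<Rightarrow> if l = i1 then v else if l = i2 then w else 1/2)"

lemma crossing_nth: "crossing v w $ None = 3/8" "crossing v w $ Some i1 = v" "crossing v w $ Some i2 = w"
  "l \<noteq> i1 \<Longrightarrow> l \<noteq> i2 \<Longrightarrow> crossing v w $ Some l = 1/2"
  "flat j \<Longrightarrow> crossing v w $ j = 1/2"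
  using i12 by (auto simp: crossing_def flat_def split: option.splits)

lemma eq_crossing_iff: "y = crossing v w \<longleftrightarrow> y $ None = 3/8 \<and> y $ Some i1 = v \<and> y $ Some i2 = w \<and>
    (\<forall>j. flat j \<longrightarrow> y $ j = 1/2)"
proof
  assume r: "y $ None = 3/8 \<and> y $ Some i1 = v \<and> y $ Some i2 = w \<and> (\<forall>j. flat j \<longrightarrow> y $ j = 1/2)"
  have "y $ a = crossing v w $ a" for a
    using r by (cases a rule: piece_cases) (auto simp: crossing_nth)
  then show "y = crossing v w" by (simp add: vec_eq_iff)
qed (auto simp: crossing_nth)

lemma disks_image_sheet:
  assumes "x \<in> std_ball"
  obtains n where "n < pieces j" "x \<in> slab j n" "disks j x = piece j n x" "sheet_eq j n (disks j x) = 0"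
  using mem_slab_index[OF assms, of j] disks_eq_piece sheet_eq_piece by metis

text \<open>A preimage of \<open>y\<close> under a piece of disk \<open>j\<close>, with the path
  parameter supplied as \<open>s\<close>.\<close>

definition lift :: "'m option \<Rightarrow> real \<Rightarrow> real ^ 'm option \<Rightarrow> real ^ 'm"
  where "lift j s y = (\<chi> l. if flat j then (if j = Some l then y $ None else y $ Some l)
     else if l = i1 then s else y $ Some l)"

lemma lift_crossing:
  assumes v: "0 < v" "v < 1" and w: "0 < w" "w < 1" and n: "n < pieces j"
    and s: "\<not> flat j \<Longrightarrow> first_coord j n s = 3/8"
      "\<not> flat j \<Longrightarrow> second_coord j n s + (if j = Some i2 then w/8 else 0) = v"
      "\<not> flat j \<Longrightarrow> break j n < s \<and> s < break j (Suc n)"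
  shows "piece j n (lift j s (crossing v w)) = crossing v w"
    "lift j s (crossing v w) \<in> interior (slab j n)"
proof -
  have "piece j n (lift j s (crossing v w)) $ a = crossing v w $ a" for a
  proof (cases "flat j")
    case True
    then obtain k where k: "j = Some k" by (cases j) (auto simp: flat_def)
    show ?thesis
      using True k crossing_nth(5)[OF True, of v w] crossing_nth(1)[of v w]
      by (cases a) (auto simp: piece_def lift_def)
  next
    case False
    then show ?thesis
      using s i12 by (cases a) (auto simp: piece_def lift_def crossing_nth)
  qed
  then show "piece j n (lift j s (crossing v w)) = crossing v w" by (simp add: vec_eq_iff)
  have c: "0 < crossing v w $ a \<and> crossing v w $ a < 1" for a
    using v w by (cases a rule: piece_cases) (auto simp: crossing_nth)
  have b0: "flat j \<Longrightarrow> break j n = 0 \<and> break j (Suc n) = 1"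
    using n by (auto simp: break_simps pieces_simps)
  show "lift j s (crossing v w) \<in> interior (slab j n)"
    using c s(3) b0 by (auto simp: slab_def interior_cbox mem_box_cart lift_def)
qed

text \<open>By \<open>uniq\<close>, the hyperplane of no other slab contains \<open>y\<close>, so
  the preimage is unique and the derivative there is \<open>lin j n\<close>. The chosen normal then
  depends only on \<open>j\<close> and \<open>n\<close>.\<close>

lemma normal_at_crossing:
  assumes y: "piece j n x = y" "x \<in> interior (slab j n)" "n < pieces j"
    and uniq: "\<And>n'. n' < pieces j \<Longrightarrow> sheet_eq j n' y = 0 \<Longrightarrow> n' = n"
  shows "y \<in> disks j ` std_ball" "positive_normal (lin j n) (normal_at disks y j)"
    "normal_at disks y j = (SOME N. positive_normal (lin j n) N)"
proof -
  have xs: "x \<in> slab j n" using y(2) interior_subset by blast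
  then have xb: "x \<in> std_ball" using slab_subset[OF y(3)] by blast
  have fx: "disks j x = y" using disks_eq_piece[OF y(3) xs] y(1) by simp
  then show "y \<in> disks j ` std_ball" using xb by blast
  have "preimage_point disks y j = x"
    unfolding preimage_point_def
  proof (rule the_equality)
    fix x' assume x': "x' \<in> std_ball \<and> disks j x' = y"
    then obtain n' where n': "n' < pieces j" "disks j x' = piece j n' x'" "sheet_eq j n' (disks j x') = 0"
      using disks_image_sheet by blast
    then have "n' = n" using uniq x' by auto
    then show "x' = x" using inj_piece[OF y(3)] n'(2) x' y(1) by metis
  qed (use xb fx in blast)
  then show N: "normal_at disks y j = (SOME N. positive_normal (lin j n) N)"
    unfolding normal_at_def using frechet_derivative_disks[OF y(3,2)] by simp
  show "positive_normal (lin j n) (normal_at disks y j)"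
    unfolding N by (rule someI_ex[OF ex_positive_normal[OF linear_lin inj_lin[OF y(3)]]])
qed

lemma lin_axis:
  "l \<noteq> i1 \<Longrightarrow> lin None n (axis l 1) = axis (Some l) 1"
  "lin None n (axis i1 1) = axis (Some i1) 1"
  "l \<noteq> i1 \<Longrightarrow> lin (Some i1) n (axis l 1) = axis (Some l) 1"
  "lin (Some i1) n (axis i1 1) = (if n = 0 then - 7/4 else 7/4) *\<^sub>R axis None 1 + (1/2) *\<^sub>R axis (Some i1) 1"
  "l \<noteq> i1 \<Longrightarrow> l \<noteq> i2 \<Longrightarrow> lin (Some i2) n (axis l 1) = axis (Some l) 1"
  "lin (Some i2) n (axis i2 1) = axis (Some i2) 1 + (1/8) *\<^sub>R axis (Some i1) 1"
  "lin (Some i2) 0 (axis i1 1) = 3 *\<^sub>R axis None 1 + 2 *\<^sub>R axis (Some i1) 1"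
  "lin (Some i2) 2 (axis i1 1) = 3 *\<^sub>R axis None 1 - 2 *\<^sub>R axis (Some i1) 1"
  "flat (Some k) \<Longrightarrow> lin (Some k) n (axis k 1) = axis None 1"
  "flat (Some k) \<Longrightarrow> l \<noteq> k \<Longrightarrow> lin (Some k) n (axis l 1) = axis (Some l) 1"
  unfolding vec_eq_iff split_option_all
  using i12 by (auto simp: lin_nth axis_def)

lemma det_normal_matrix_axis_None:
  assumes "linear L" and tri: "\<And>l k. L (axis l 1) $ Some k \<noteq> 0 \<Longrightarrow> l = k \<or> l = i2 \<and> k = i1"
  shows "det (normal_matrix (axis None 1) L) = (\<Prod>l\<in>UNIV. L (axis l 1) $ Some l)"
proof -
  have ax: "axis None (1::real) $ (a :: 'm option) = (if a = None then 1 else 0)" for a by (simp add: axis_def)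
  have "det (normal_matrix (axis None 1) L) = (\<Prod>a\<in>UNIV. normal_matrix (axis None 1) L $ a $ a)"
  proof (rule det_triangular_rank[of _ "\<lambda>a. if a = None then 2 else if a = Some i1 then 1 else 0"])
    fix a b assume nz: "normal_matrix (axis None 1) L $ a $ b \<noteq> 0"
    show "a = b \<or> (if b = None then 2 else if b = Some i1 then 1 else 0) < (if a = None then 2 else if a = Some i1 then 1 else (0::nat))"
    proof (cases b)
      case None
      then show ?thesis using nz by (simp add: normal_matrix_def ax split: if_splits)
    next
      case (Some l)
      then show ?thesis using nz tri[of l "the a"] i12 by (cases a) (auto simp: normal_matrix_def)
    qed
  qed
  then show ?thesis by (simp add: UNIV_option prod.reindex normal_matrix_def)
qed

text \<open>The positive normal is a positive multiple of (1, 7/2) on one arm and of (1, -7/2) on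
  the other, in the coordinates \<open>None\<close> and \<open>Some i1\<close>. This change of sign
  is what makes the two intersection signs opposite.\<close>

lemma positive_normal_vee:
  assumes N: "positive_normal (lin (Some i1) n) N"
  shows "l \<noteq> i1 \<Longrightarrow> N $ Some l = 0" "n = 0 \<Longrightarrow> N $ Some i1 > 0" "n \<noteq> 0 \<Longrightarrow> N $ Some i1 < 0"
proof -
  let ?L = "lin (Some i1) n" and ?c = "if n = 0 then 7/2 else - 7/2 :: real"
  have orth: "N \<bullet> ?L (axis l 1) = 0" for l using N by (simp add: positive_normal_alt)
  show 0: "N $ Some l = 0" if "l \<noteq> i1" for l
    using orth[of l] that by (simp add: lin_axis inner_axis)
  have 1: "N $ Some i1 = ?c * N $ None"
    using orth[of i1] by (auto simp: lin_axis inner_add_right inner_axis split: if_splits)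
  \<comment> \<open>Pairing with \<open>N\<close>, which is orthogonal to the range, shows that the
    coefficient of \<open>axis None 1\<close> is the squared length of \<open>N\<close> divided by
    \<open>N $ None\<close>; hence the factor 1 + 49/4.\<close>
  have "N = (N $ None * (1 + 49/4)) *\<^sub>R axis None 1 + ?L ((?c * N $ None * 2) *\<^sub>R axis i1 1)"
    unfolding vec_eq_iff split_option_all
    using 0 1 by (auto simp: lin_nth axis_def)
  then have "det (normal_matrix N ?L) = (N $ None * (1 + 49/4)) * det (normal_matrix (axis None 1) ?L)"
    using det_normal_matrix[OF linear_lin] by metis
  moreover have "det (normal_matrix (axis None 1) ?L) > 0"
    by (subst det_normal_matrix_axis_None[OF linear_lin]) (auto simp: lin_nth axis_def split: if_splits intro!: prod_pos)
  moreover have "det (normal_matrix N ?L) > 0" using N by (simp add: positive_normal_alt)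
  ultimately have "N $ None > 0"
    by (metis mult.commute mult_pos_pos zero_less_mult_pos zero_less_mult_pos2 add_pos_pos zero_less_divide_iff zero_less_numeral zero_less_one)
  then show "n = 0 \<Longrightarrow> N $ Some i1 > 0" "n \<noteq> 0 \<Longrightarrow> N $ Some i1 < 0" using 1 by auto
qed

text \<open>Between the rising and the falling branch both the slope and the sign of the
  \<open>None\<close> entry flip, so the entry \<open>Some i2\<close>, which is due to the drift,
  stays positive. The loop contributes equally at both common points.\<close>

lemma positive_normal_loop:
  assumes N: "positive_normal (lin (Some i2) n) N" and n: "n = 0 \<or> n = 2"
  shows "l \<noteq> i1 \<Longrightarrow> l \<noteq> i2 \<Longrightarrow> N $ Some l = 0" "N $ Some i2 > 0"
proof -
  let ?L = "lin (Some i2) n" and ?c = "if n = 0 then 1 else - 1 :: real"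
  have orth: "N \<bullet> ?L (axis l 1) = 0" for l using N by (simp add: positive_normal_alt)
  show 0: "N $ Some l = 0" if "l \<noteq> i1" "l \<noteq> i2" for l
    using orth[of l] that by (simp add: lin_axis inner_axis)
  have 1: "N $ Some i1 = - (3/2) * ?c * N $ None"
    using orth[of i1] n by (auto simp: lin_axis inner_add_right inner_diff_right inner_axis)
  have 2: "N $ Some i2 = - N $ Some i1 / 8"
    using orth[of i2] by (auto simp: lin_axis inner_add_right inner_axis)
  have "N = (N $ None * (1 + 9/4 * (1 + 1/64))) *\<^sub>R axis None 1
     + ?L (N $ Some i2 *\<^sub>R axis i2 1 + (?c / 2 * (N $ Some i1 - N $ Some i2 / 8)) *\<^sub>R axis i1 1)"
    (is "_ = ?R")
  proof -
    consider "n = 0" | "n = 2" using n by blast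
    then have "N $ None = ?R $ None \<and> (\<forall>x. N $ Some x = ?R $ Some x)"
    proof cases
      assume "n = 0"
      moreover from this have "N $ Some i1 = - (3/2) * N $ None" "N $ Some i2 = 3/16 * N $ None" using 1 2 by simp_all
      ultimately show ?thesis using 0 i12 by (auto simp: lin_nth axis_def algebra_simps)
    next
      assume "n = 2"
      moreover from this have "N $ Some i1 = 3/2 * N $ None" "N $ Some i2 = - 3/16 * N $ None" using 1 2 by simp_all
      ultimately show ?thesis using 0 i12 by (auto simp: lin_nth axis_def algebra_simps)
    qed
    then show ?thesis unfolding vec_eq_iff split_option_all .
  qed
  then have "det (normal_matrix N ?L) = (N $ None * (1 + 9/4 * (1 + 1/64))) * det (normal_matrix (axis None 1) ?L)"
    using det_normal_matrix[OF linear_lin] by metis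
  moreover have "det (normal_matrix (axis None 1) ?L) = 2 * ?c"
  proof -
    have "det (normal_matrix (axis None 1) ?L) = (\<Prod>l\<in>UNIV. ?L (axis l 1) $ Some l)"
      by (rule det_normal_matrix_axis_None[OF linear_lin]) (use i12 in \<open>auto simp: lin_nth axis_def split: if_splits\<close>)
    also have "\<dots> = (\<Prod>l\<in>UNIV. if l = i1 then 2 * ?c else 1)"
      by (rule prod.cong) (use i12 n in \<open>auto simp: lin_nth axis_def\<close>)
    finally show ?thesis by simp
  qed
  moreover have "det (normal_matrix N ?L) > 0" using N by (simp add: positive_normal_alt)
  ultimately have "?c * N $ None > 0" by (simp split: if_splits)
  then show "N $ Some i2 > 0" unfolding 2 1 by (auto split: if_splits)
qed

lemma positive_normal_nonzero: "linear L \<Longrightarrow> positive_normal L N \<Longrightarrow> N \<noteq> 0"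
  using det_normal_matrix[of L 0 0 0] by (auto simp: positive_normal_alt linear_0)

text \<open>The slabs through \<open>crossing (4/7) (5/21)\<close>; at the other common point every
  index is 0.\<close>

definition crossing_piece :: "'m option \<Rightarrow> nat"
  where "crossing_piece j = (if j = Some i1 then 1 else if j = Some i2 then 2 else 0)"

lemma normal_at_crossings:
  assumes "y = crossing (4/7) (5/21) \<and> k = crossing_piece \<or> y = crossing (3/7) (3/7) \<and> k = (\<lambda>j. 0)"
  shows "y \<in> disks j ` std_ball" "positive_normal (lin j (k j)) (normal_at disks y j)"
    "normal_at disks y j = (SOME N. positive_normal (lin j (k j)) N)"
proof -
  have k: "k j < pieces j" using assms i12 by (auto simp: crossing_piece_def pieces_def)
  obtain v w where y: "y = crossing v w" and vw: "0 < v" "v < 1" "0 < w" "w < 1"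
    and vw': "v = 4/7 \<and> w = 5/21 \<and> k = crossing_piece \<or> v = 3/7 \<and> w = 3/7 \<and> k = (\<lambda>j. 0)"
    using assms by (elim disjE conjE) (fastforce+)
  \<comment> \<open>Solutions of \<open>first_coord j n s = 3/8\<close> on the slabs concerned: 9/14
    and 5/14 on the V, 19/24 and 1/8 on the loop. On the disk \<open>None\<close> the parameter is v
    itself.\<close>
  let ?s = "if v = 4/7 then (if j = Some i1 then 9/14 else if j = Some i2 then 19/24 else 4/7)
     else (if j = Some i1 then 5/14 else if j = Some i2 then 1/8 else 3/7 :: real)"
  have "\<not> flat j \<Longrightarrow> first_coord j (k j) ?s = 3/8"
    "\<not> flat j \<Longrightarrow> second_coord j (k j) ?s + (if j = Some i2 then w/8 else 0) = v"
    "\<not> flat j \<Longrightarrow> break j (k j) < ?s \<and> ?s < break j (Suc (k j))"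
    using vw' i12 by (auto simp: first_coord_def second_coord_def break_def flat_def crossing_piece_def)
  from lift_crossing[OF vw k this]
  have l: "piece j (k j) (lift j ?s y) = y" "lift j ?s y \<in> interior (slab j (k j))" unfolding y by auto
  have u: "n' = k j" if "n' < pieces j" "sheet_eq j n' y = 0" for n'
    by (rule less_piecesE[OF that(1)])
       (use that(2) vw' k i12 in \<open>auto simp: sheet_eqs y crossing_nth crossing_piece_def pieces_simps\<close>)
  show "y \<in> disks j ` std_ball" "positive_normal (lin j (k j)) (normal_at disks y j)"
    "normal_at disks y j = (SOME N. positive_normal (lin j (k j)) N)"
    using normal_at_crossing[OF l k u] by auto
qed

text \<open>In the slice, the lines v = 3/7 and v = 4/7 of the V meet the lines v = 3/8 + w/8, v =
  5/8 + w/8 and v = 13/24 + w/8 of the loop in six points, of which only two have w in the unit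
  interval.\<close>

lemma common_points_disks: "common_points disks = {crossing (4/7) (5/21), crossing (3/7) (3/7)}"
proof (intro equalityI subsetI)
  fix y assume y: "y \<in> common_points disks"
  have im: "y \<in> disks j ` std_ball" for j using y by (simp add: common_points_def)
  have ex: "\<exists>n<pieces j. sheet_eq j n y = 0" for j
  proof -
    obtain x where x: "x \<in> std_ball" "y = disks j x" using im[of j] by (rule imageE)
    show ?thesis by (rule disks_image_sheet[OF x(1), of j]) (use x(2) in blast)
  qed
  have "disks None ` std_ball \<subseteq> std_ball" using proper_disks by (simp add: proper_disks_map_def)
  then have "y \<in> std_ball" using im[of None] by (rule subsetD)
  then have w: "0 \<le> y $ Some i2" "y $ Some i2 \<le> 1" by (simp_all add: mem_std_ball)
  have u: "y $ None = 3/8" using ex[of None] by (auto simp: sheet_eqs)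
  have f: "y $ j = 1/2" if "flat j" for j using ex[of j] that by (auto simp: sheet_eqs)
  obtain n where n: "n < 2" "sheet_eq (Some i1) n y = 0" using ex[of "Some i1"] by (auto simp: pieces_simps)
  obtain k where k: "k < 3" "sheet_eq (Some i2) k y = 0" using ex[of "Some i2"] by (auto simp: pieces_simps)
  have "n = 0 \<or> n = Suc 0" "k = 0 \<or> k = Suc 0 \<or> k = 2" using n(1) k(1) by auto
  then have "y $ Some i1 = 4/7 \<and> y $ Some i2 = 5/21 \<or> y $ Some i1 = 3/7 \<and> y $ Some i2 = 3/7"
    using n(2) k(2) u w by (elim disjE; simp add: sheet_eqs; argo)
  then show "y \<in> {crossing (4/7) (5/21), crossing (3/7) (3/7)}"
    using u f by (auto simp: eq_crossing_iff)
next
  fix y assume "y \<in> {crossing (4/7) (5/21), crossing (3/7) (3/7)}"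
  then show "y \<in> common_points disks"
    unfolding common_points_def using normal_at_crossings(1)[of y crossing_piece] normal_at_crossings(1)[of y "\<lambda>j. 0"] by blast
qed

text \<open>The order \<open>None\<close>, \<open>Some i1\<close>, \<open>Some i2\<close>, then the
  flat indices makes the matrix triangular: the normal of the V has entries at the first two, that
  of the loop at the first three, and every other normal only at its own index.\<close>

lemma det_normals:
  assumes k: "k (Some i1) = 0 \<or> k (Some i1) = (1::nat)" "k (Some i2) = 0 \<or> k (Some i2) = (2::nat)"
    and N: "\<And>j. positive_normal (lin j (k j)) (N j)"
  shows "det (\<chi> j. N j) = N (Some i1) $ Some i1 * N (Some i2) $ Some i2 * (\<Prod>j\<in>UNIV - {Some i1, Some i2}. N j $ j)"
    "(\<Prod>j\<in>UNIV - {Some i1, Some i2}. N j $ j) \<noteq> 0"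
proof -
  have orth: "N j \<bullet> lin j (k j) (axis l 1) = 0" for j l using N[of j] by (simp add: positive_normal_alt)
  have zN: "N None $ Some l = 0" for l
    using orth[of None l] by (cases "l = i1") (simp_all add: lin_axis inner_axis)
  have zf: "N j $ a = 0" if ja: "flat j" "a \<noteq> j" for j a
  proof -
    obtain m where m: "j = Some m" using ja(1) by (cases j) (auto simp: flat_def)
    show ?thesis
      using orth[of j m] orth[of j "the a"] ja unfolding m
      by (cases a) (simp_all add: lin_axis inner_axis)
  qed
  have "det (\<chi> j. N j) = (\<Prod>j\<in>UNIV. (\<chi> j. N j) $ j $ j)"
  proof (rule det_triangular_rank[of _ "\<lambda>a. if a = None then 0 else if a = Some i1 then 1 else if a = Some i2 then 2 else 3"])
    fix j a assume nz: "(\<chi> j. N j) $ j $ a \<noteq> 0"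
    show "j = a \<or> (if a = None then 0 else if a = Some i1 then 1 else if a = Some i2 then 2 else 3)
       < (if j = None then 0 else if j = Some i1 then 1 else if j = Some i2 then 2 else (3::nat))"
    proof (cases j rule: piece_cases)
      case 1
      then show ?thesis using nz zN by (cases a) auto
    next
      case 2
      then show ?thesis using nz positive_normal_vee(1)[OF N[of "Some i1"]] by (cases a) auto
    next
      case 3
      then show ?thesis using nz positive_normal_loop(1)[OF N[of "Some i2"] k(2)] i12 by (cases a) auto
    next
      case 4
      then show ?thesis using nz zf[of j a] by (cases "a = j") auto
    qed
  qed
  then show "det (\<chi> j. N j) = N (Some i1) $ Some i1 * N (Some i2) $ Some i2 * (\<Prod>j\<in>UNIV - {Some i1, Some i2}. N j $ j)"
    using prod_remove_two[of "Some i1" "Some i2" "\<lambda>j. N j $ j"] i12 by simp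
  have "N j $ j \<noteq> 0" if j: "j \<noteq> Some i1" "j \<noteq> Some i2" for j
  proof
    assume z: "N j $ j = 0"
    have "N j $ a = 0" for a
      using z zN zf[of j a] j by (cases "j = None"; cases a) (auto simp: flat_def)
    then have "N j = 0" by (simp add: vec_eq_iff)
    then show False using positive_normal_nonzero[OF linear_lin N[of j]] by blast
  qed
  then show "(\<Prod>j\<in>UNIV - {Some i1, Some i2}. N j $ j) \<noteq> 0" by simp
qed

lemma algebraic_intersection_number_disks: "algebraic_intersection_number disks = 0"
proof -
  let ?a = "crossing (4/7) (5/21)" and ?b = "crossing (3/7) (3/7)"
  let ?P = "\<lambda>N. \<Prod>j\<in>UNIV - {Some i1, Some i2}. N j $ j :: real"
  have ab: "?a \<noteq> ?b"
  proof
    assume "?a = ?b"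
    from arg_cong[OF this, of "\<lambda>y. y $ Some i1"] show False by (simp add: crossing_nth)
  qed
  have a: "positive_normal (lin j (crossing_piece j)) (normal_at disks ?a j)"
     "normal_at disks ?a j = (SOME N. positive_normal (lin j (crossing_piece j)) N)" for j
    using normal_at_crossings(2,3)[of ?a crossing_piece] by auto
  have b: "positive_normal (lin j 0) (normal_at disks ?b j)"
     "normal_at disks ?b j = (SOME N. positive_normal (lin j 0) N)" for j
    using normal_at_crossings(2,3)[of ?b "\<lambda>j. 0"] by auto
  \<comment> \<open>The disks other than the V and the loop have the same linear part at both
    points, so \<open>SOME\<close> picks the same normals and the sign of this product does not have
    to be found.\<close>
  have "?P (normal_at disks ?a) = ?P (normal_at disks ?b)"
    by (rule prod.cong) (auto simp: a(2) b(2) crossing_piece_def)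
  moreover note da = det_normals[of crossing_piece "normal_at disks ?a", OF _ _ a(1)]
  moreover note db = det_normals[of "\<lambda>j. 0" "normal_at disks ?b", OF _ _ b(1)]
  moreover have "normal_at disks ?a (Some i1) $ Some i1 < 0" "normal_at disks ?b (Some i1) $ Some i1 > 0"
    using positive_normal_vee(3)[OF a(1)[of "Some i1"]] positive_normal_vee(2)[OF b(1)[of "Some i1"]]
    by (simp_all add: crossing_piece_def)
  moreover have "normal_at disks ?a (Some i2) $ Some i2 > 0" "normal_at disks ?b (Some i2) $ Some i2 > 0"
    using positive_normal_loop(2)[OF a(1)[of "Some i2"]] positive_normal_loop(2)[OF b(1)[of "Some i2"]] i12
    by (simp_all add: crossing_piece_def)
  moreover have sgn: "0 < x1 * x2 * q \<longleftrightarrow> \<not> 0 < z1 * z2 * q" if "x1 < 0" "x2 > 0" "z1 > 0" "z2 > 0" "q \<noteq> 0"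
    for x1 x2 z1 z2 q :: real
    using that by (auto simp: zero_less_mult_iff mult_less_0_iff)
  ultimately have "det (\<chi> j. normal_at disks ?a j) > 0 \<longleftrightarrow> \<not> det (\<chi> j. normal_at disks ?b j) > 0"
    using i12 sgn[of "normal_at disks ?a (Some i1) $ Some i1" "normal_at disks ?a (Some i2) $ Some i2"
      "normal_at disks ?b (Some i1) $ Some i1" "normal_at disks ?b (Some i2) $ Some i2" "?P (normal_at disks ?b)"]
    by (simp add: crossing_piece_def)
  then have "intersection_sign disks ?a + intersection_sign disks ?b = 0"
    by (auto simp: intersection_sign_def)
  then show ?thesis
    unfolding algebraic_intersection_number_def common_points_disks using ab by simp
qed

end

subsection \<open>Other disks with the same boundary\<close>

lemma two_le_DIM_Times: "2 \<le> CARD('m option) \<Longrightarrow> 2 \<le> DIM((real ^ 'm::finite) \<times> real)"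
  by simp

lemma compact_convex_prism:
  "convex ((std_ball :: (real ^ 'm) set) \<times> {0..1::real})" "compact ((std_ball :: (real ^ 'm) set) \<times> {0..1::real})"
  by (simp_all add: convex_Times compact_Times)

text \<open>The name refers to what will be refuted; the locale itself does not assume the images to
  be without a common point.\<close>

locale avoiding_disks = two_axes i1 i2 for i1 i2 :: "'m::finite" +
  fixes f' :: "'m disks_map"
  assumes cont: "\<And>j. continuous_on std_ball (f' j)"
    and proper': "proper_disks_map f'"
    and same_boundary: "\<And>j x. x \<in> std_sphere \<Longrightarrow> f' j x = disks j x"
begin

definition image' :: "'m option \<Rightarrow> (real ^ 'm option) set"
  where "image' j = f' j ` std_ball"

lemma continuous_disks: "continuous_on std_ball (disks j)"
proof -
  have "continuous_on (\<Union>n\<in>{..<pieces j}. slab j n) (disks j)"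
  proof (rule continuous_on_closed_Union)
    fix n assume n: "n \<in> {..<pieces j}"
    have "continuous_on (slab j n) (\<lambda>x. lin j n x + piece j n 0)"
      by (intro continuous_on_add continuous_on_const linear_continuous_on linear_lin[unfolded linear_conv_bounded_linear])
    then show "continuous_on (slab j n) (disks j)"
    proof (rule continuous_on_eq)
      fix x assume "x \<in> slab j n"
      then show "lin j n x + piece j n 0 = disks j x"
        using n disks_eq_piece[of n j x] piece_eq_lin[of j n x] by simp
    qed
  qed (auto simp: slab_def)
  then show ?thesis by (simp add: std_ball_eq_slabs[of j])
qed

lemma closed_image': "closed (image' j)"
  unfolding image'_def using compact_continuous_image[OF cont compact_cbox] by (rule compact_imp_closed)

lemma image'_ne: "image' j \<noteq> {}"
  using mem_std_ball[of "0 :: real ^ 'm"] unfolding image'_def by auto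

lemma proper'D: "f' j ` std_ball \<subseteq> std_ball" "{x \<in> std_ball. f' j x \<in> std_sphere} = std_sphere"
  by (rule conjunct1[OF spec[OF proper'[unfolded proper_disks_map_def]]]
      conjunct2[OF spec[OF proper'[unfolded proper_disks_map_def]]])+

lemma proper_disksD: "disks j ` std_ball \<subseteq> std_ball" "{x \<in> std_ball. disks j x \<in> std_sphere} = std_sphere"
  by (rule conjunct1[OF spec[OF proper_disks[unfolded proper_disks_map_def]]]
      conjunct2[OF spec[OF proper_disks[unfolded proper_disks_map_def]]])+

text \<open>By properness, a point of the image on the sphere comes from the boundary of the disk,
  where \<open>f'\<close> is prescribed. This is how the sheets of \<open>disks\<close> give
  information about \<open>f'\<close>.\<close>

lemma image'_boundary:
  assumes "y \<in> image' j" "y \<in> std_sphere"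
  obtains n where "n < pieces j" "sheet_eq j n y = 0"
proof -
  obtain x where x: "x \<in> std_ball" "y = f' j x" using assms(1) unfolding image'_def by (rule imageE)
  then have "x \<in> {x \<in> std_ball. f' j x \<in> std_sphere}" using assms(2) by blast
  then have "x \<in> std_sphere" unfolding proper'D .
  then have "y = disks j x" using same_boundary x(2) by simp
  then show thesis using disks_image_sheet[OF x(1), of j] that by metis
qed

section \<open>The difference of a disk and a path\<close>

lemma prism_homotopy:
  assumes c: "continuous_on {0..1} c" "\<And>t. 0 < t \<Longrightarrow> t < 1 \<Longrightarrow> c t \<in> interior std_ball"
    "c 0 \<in> std_sphere" "c 1 \<in> std_sphere"
    and con: "connected_component (std_ball - image' j) (c 0) (c (1::real))"
  obtains G where "bd_homotopic (std_ball \<times> {0..1}) (\<lambda>(x, t). disks j x - c t) G"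
    "\<forall>y \<in> std_ball \<times> {0..1}. G y \<noteq> 0"
proof (rule same_component_imp_bd_homotopic[of std_ball std_ball "disks j" "f' j" c])
  note p = proper_disksD[of j] proper'D[of j]
  show "disks j ` std_ball \<subseteq> std_ball" "f' j ` std_ball \<subseteq> std_ball" using p by blast+
  show "x \<in> std_sphere" if "x \<in> std_ball" "disks j x \<in> std_sphere" for x using p(2) that by blast
  show "x \<in> std_sphere" if "x \<in> std_ball" "f' j x \<in> std_sphere" for x using p(4) that by blast
  show "disks j x \<in> std_sphere" if "x \<in> std_sphere" for x using p(2) that by blast
  show "connected_component (std_ball - f' j ` std_ball) (c 0) (c 1)" using con unfolding image'_def .
  show "thesis" if "bd_homotopic (std_ball \<times> {0..1}) (\<lambda>(x, t). disks j x - c t) G"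
    "\<And>y. y \<in> std_ball \<times> {0..1} \<Longrightarrow> G y \<noteq> 0" for G
    using that \<open>\<And>G. bd_homotopic (std_ball \<times> {0..1}) (\<lambda>(x, t). disks j x - c t) G \<Longrightarrow> \<forall>y\<in>std_ball \<times> {0..1}. G y \<noteq> 0 \<Longrightarrow> thesis\<close> by blast
  show "closed (std_ball :: (real ^ 'm option) set)" "convex (std_ball :: (real ^ 'm option) set)"
    "compact (std_ball :: (real ^ 'm) set)"
    by (rule closed_cbox convex_box compact_cbox)+
  show "c t \<in> interior std_ball" if "0 < t" "t < 1" for t using that by (rule c(2))
qed (use c(1,3,4) cont continuous_disks same_boundary in simp_all)

text \<open>The linear part of \<open>(x, t) \<mapsto> disks j x - c t\<close> for a path \<open>c\<close> with velocity \<open>d\<close>.\<close>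

definition lin_prism :: "'m option \<Rightarrow> nat \<Rightarrow> real ^ 'm option \<Rightarrow> (real ^ 'm) \<times> real \<Rightarrow> real ^ 'm option"
  where "lin_prism j n d = (\<lambda>p. lin j n (fst p) - snd p *\<^sub>R d)"

lemma linear_lin_prism: "linear (lin_prism j n d)"
proof -
  have "lin j n (v + w) = lin j n v + lin j n w" "lin j n (c *\<^sub>R v) = c *\<^sub>R lin j n v" for v w c
    using linear_lin linear_add linear_scale by blast+
  then show ?thesis unfolding lin_prism_def by (auto intro!: linearI simp: algebra_simps)
qed

text \<open>Disk and path are both affine near the crossing. The bound \<open>r \<le> e\<close> is
  recorded so that balls around crossings at different times can be kept disjoint.\<close>

lemma local_form:
  assumes n: "n < pieces j" and x: "x \<in> interior (slab j n)" and t: "0 < t" "t < 1"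
    and c: "e > 0" "\<And>t'. \<bar>t' - t\<bar> < e \<Longrightarrow> c t' = c t + (t' - t) *\<^sub>R d" and eq: "piece j n x = c t"
  obtains r where "r > 0" "ball (x, t) r \<subseteq> std_ball \<times> {0..1}" "r \<le> e"
    "\<forall>p \<in> ball (x, t) r. (\<lambda>(x, t). disks j x - c t) p = lin_prism j n d (p - (x, t))"
proof -
  obtain r0 where r0: "r0 > 0" "ball x r0 \<subseteq> slab j n"
    using x interior_subset[of "slab j n"] open_interior[of "slab j n"] by (meson open_contains_ball order_trans)
  define r where "r = min (min r0 e) (min t (1 - t))"
  have r: "r > 0" "r \<le> r0" "r \<le> e" "r \<le> t" "r \<le> 1 - t" using r0 c t by (auto simp: r_def)
  have d: "dist x x' < r" "dist t t' < r" if "(x', t') \<in> ball (x, t) r" for x' t'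
    using that dist_fst_le[of "(x, t)" "(x', t')"] dist_snd_le[of "(x, t)" "(x', t')"] by auto
  have sl: "x' \<in> slab j n" if "(x', t') \<in> ball (x, t) r" for x' t'
    using d[OF that] r(2) r0(2) by auto
  show thesis
  proof
    show "r > 0" "r \<le> e" using r by simp_all
    show "ball (x, t) r \<subseteq> std_ball \<times> {0..1}"
    proof
      fix p assume p: "p \<in> ball (x, t) r"
      obtain x' t' where xt: "p = (x', t')" by force
      have "x' \<in> std_ball" using sl p xt slab_subset[OF n] by blast
      moreover have "0 \<le> t'" "t' \<le> 1" using d(2)[of x' t'] p xt r(4,5) by (auto simp: dist_real_def)
      ultimately show "p \<in> std_ball \<times> {0..1}" using xt by simp
    qed
    show "\<forall>p \<in> ball (x, t) r. (\<lambda>(x, t). disks j x - c t) p = lin_prism j n d (p - (x, t))"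
    proof
    fix p assume p: "p \<in> ball (x, t) r"
    obtain x' t' where xt: "p = (x', t')" by force
    have "disks j x' = piece j n x'" using disks_eq_piece[OF n sl] p xt by blast
    moreover have "c t' = c t + (t' - t) *\<^sub>R d"
      using d(2)[of x' t'] p xt r(3) by (intro c(2)) (auto simp: dist_real_def)
    moreover have "lin j n (x' - x) = piece j n x' - piece j n x"
      using linear_diff[OF linear_lin[of j n], of x' x] by (simp add: lin_def)
    ultimately show "(\<lambda>(x, t). disks j x - c t) p = lin_prism j n d (p - (x, t))"
      using eq by (simp add: xt lin_prism_def)
    qed
  qed
qed

lemma prism_homotopy':
  assumes "continuous_on {0..1} c" "\<forall>t. 0 < t \<longrightarrow> t < 1 \<longrightarrow> c t \<in> interior std_ball"
    "c 0 \<in> std_sphere" "c 1 \<in> std_sphere"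
    and "connected_component (std_ball - image' j) (c 0) (c (1::real))"
  shows "\<exists>G. bd_homotopic (std_ball \<times> {0..1}) (\<lambda>(x, t). disks j x - c t) G
    \<and> (\<forall>y \<in> std_ball \<times> {0..1}. G y \<noteq> 0)"
proof (rule prism_homotopy[of c j])
  show "c t \<in> interior std_ball" if "0 < t" "t < 1" for t using assms(2) that by blast
qed (insert assms, (assumption | blast)+)

lemma local_form':
  assumes "n < pieces j" "x \<in> interior (slab j n)" "0 < t" "t < 1"
    and "e > 0" "\<forall>t'. \<bar>t' - t\<bar> < e \<longrightarrow> c t' = c t + (t' - t) *\<^sub>R d" and "piece j n x = c t"
  shows "\<exists>r. r > 0 \<and> ball (x, t) r \<subseteq> std_ball \<times> {0..1} \<and> r \<le> e
    \<and> (\<forall>p \<in> ball (x, t) r. (\<lambda>(x, t). disks j x - c t) p = lin_prism j n d (p - (x, t)))"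
proof (rule local_form[of n j x t e c d])
  show "c t' = c t + (t' - t) *\<^sub>R d" if "\<bar>t' - t\<bar> < e" for t' using assms(6) that by blast
qed (insert assms, (assumption | blast)+)

lemma zero_on_sheet:
  assumes "x \<in> std_ball" "disks j x = y"
  obtains n where "n < pieces j" "sheet_eq j n y = 0" "piece j n x = y"
  by (rule disks_image_sheet[OF assms(1), of j]) (rule that, use assms(2) in auto)

text \<open>Zeros of \<open>disks j x - c t\<close> are crossings: \<open>uniq\<close> and
  injectivity of the piece leave one of them, and by \<open>trans\<close> the velocity is not
  parallel to the sheet, which makes the zero nondegenerate. It cannot be deformed away.\<close>

lemma separated_one_crossing:
  assumes c: "continuous_on {0..1} c" "\<forall>t. 0 < t \<longrightarrow> t < 1 \<longrightarrow> c t \<in> interior std_ball"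
    "c 0 \<in> std_sphere" "c (1::real) \<in> std_sphere"
    and n: "n < pieces j" and x: "x \<in> interior (slab j n)" and t: "0 < t" "t < 1"
    and loc: "e > 0" "\<forall>t'. \<bar>t' - t\<bar> < e \<longrightarrow> c t' = c t + (t' - t) *\<^sub>R d" and eq: "piece j n x = c t"
    and trans: "sheet_eq j n (c t + d) \<noteq> 0"
    and uniq: "\<And>t' n'. 0 \<le> t' \<Longrightarrow> t' \<le> 1 \<Longrightarrow> n' < pieces j \<Longrightarrow> sheet_eq j n' (c t') = 0 \<Longrightarrow> n' = n \<and> t' = t"
    and card: "2 \<le> CARD('m option)"
  shows "\<not> connected_component (std_ball - image' j) (c 0) (c 1)"
proof
  assume con: "connected_component (std_ball - image' j) (c 0) (c 1)"
  obtain G where G: "bd_homotopic (std_ball \<times> {0..1}) (\<lambda>(x, t). disks j x - c t) G"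
    "\<forall>y \<in> std_ball \<times> {0..1}. G y \<noteq> 0"
    using prism_homotopy'[OF c con] by (elim exE conjE) (rule that)
  obtain r where r: "r > 0" "ball (x, t) r \<subseteq> std_ball \<times> {0..1}" "r \<le> e"
    "\<forall>p \<in> ball (x, t) r. (\<lambda>(x, t). disks j x - c t) p = lin_prism j n d (p - (x, t))"
    using local_form'[OF n x t loc eq] by (elim exE conjE) (rule that)
  let ?F = "\<lambda>(x, t). disks j x - c t"
  have F: "continuous_on (std_ball \<times> {0..1}) ?F"
    using homotopic_with_imp_continuous_maps[OF G(1)[unfolded bd_homotopic_def]] by auto
  have nz: "?F p \<noteq> 0" if "p \<in> std_ball \<times> {0..1} - {(x, t)}" for p
  proof
    assume z: "?F p = 0"
    obtain x' t' where p: "p = (x', t')" by force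
    have xt: "x' \<in> std_ball" "0 \<le> t'" "t' \<le> 1" "(x', t') \<noteq> (x, t)" using that p by auto
    have "disks j x' = c t'" using z p by simp
    then obtain n' where n': "n' < pieces j" "sheet_eq j n' (c t') = 0" "piece j n' x' = c t'"
      by (rule zero_on_sheet[OF xt(1)]) (rule that)
    then have "n' = n" "t' = t" using uniq xt by blast+
    then show False using inj_piece[OF n, of x' x] n'(3) eq xt(4) by simp
  qed
  have inj: "inj (lin_prism j n d)"
    unfolding linear_injective_0[OF linear_lin_prism]
  proof (intro allI impI)
    fix p assume "lin_prism j n d p = 0"
    then have e: "lin j n (fst p) = snd p *\<^sub>R d" by (simp add: lin_prism_def)
    have "piece j n (x + fst p) = c t + snd p *\<^sub>R d"
      using linear_add[OF linear_lin[of j n], of x "fst p"] e eq by (simp add: piece_eq_lin[of j n "x + fst p"] piece_eq_lin[of j n x])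
    then have "sheet_eq j n (c t + snd p *\<^sub>R d) = 0" using sheet_eq_piece[OF n] by metis
    moreover have "c t + snd p *\<^sub>R d = (1 - snd p) *\<^sub>R c t + snd p *\<^sub>R (c t + d)" by (simp add: algebra_simps)
    moreover have "sheet_eq j n (c t) = 0" using sheet_eq_piece[OF n, of x] eq by simp
    ultimately have "snd p = 0" using trans sheet_eq_affine[of "1 - snd p" "snd p" j n "c t" "c t + d"] by simp
    moreover from this have "fst p = 0"
      using e inj_lin[OF n] linear_injective_0[OF linear_lin] by simp
    ultimately show "p = 0" by (simp add: prod_eq_iff)
  qed
  show False
    by (rule one_zero_essential[OF compact_convex_prism two_le_DIM_Times[OF card] _ F nz linear_lin_prism inj r(2,1)
        bspec[OF r(4)] G(1) bspec[OF G(2)]]) auto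
qed

text \<open>The segment descends from level 2 to level 0, crossing branches 2 and 0 in the same
  direction. The two local linear maps are joined by a segment of injective maps, so their degrees
  add instead of cancelling.\<close>

lemma separated_loop_two_crossings:
  assumes card: "2 \<le> CARD('m option)"
  shows "\<not> connected_component (std_ball - image' (Some i2)) (crossing (4/7) 0) (crossing (3/7) 1)"
proof
  let ?j = "Some i2"
  define c where "c t = crossing (4/7 - t/7) t" for t
  define d where "d = c 1 - c 0"
  assume "connected_component (std_ball - image' ?j) (crossing (4/7) 0) (crossing (3/7) 1)"
  then have con: "connected_component (std_ball - image' ?j) (c 0) (c 1)" by (simp add: c_def)
  have c_lin: "c t' = c t + (t' - t) *\<^sub>R d" for t t'
    unfolding d_def c_def vec_eq_iff split_option_all by (auto simp: crossing_def algebra_simps)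
  have "continuous_on {0..1} (\<lambda>t. c 0 + (t - 0) *\<^sub>R d)" by (intro continuous_intros)
  then have "continuous_on {0..1} c" by (rule continuous_on_eq) (rule c_lin[symmetric])
  moreover have "c t \<in> interior std_ball" if "0 < t" "t < 1" for t
    using that by (auto simp: c_def crossing_def mem_box_cart split: option.splits)
  moreover have "c 0 \<in> std_sphere" "c 1 \<in> std_sphere"
    by (auto simp: frontier_std_ball mem_std_ball c_def crossing_def split: option.splits intro!: exI[of _ "Some i2"] simp: i12[symmetric])
  ultimately have c: "continuous_on {0..1} c" "\<forall>t. 0 < t \<longrightarrow> t < 1 \<longrightarrow> c t \<in> interior std_ball"
    "c 0 \<in> std_sphere" "c 1 \<in> std_sphere" by blast+
  obtain G where G: "bd_homotopic (std_ball \<times> {0..1}) (\<lambda>(x, t). disks ?j x - c t) G"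
    "\<forall>y \<in> std_ball \<times> {0..1}. G y \<noteq> 0"
    using prism_homotopy'[OF c con] by (elim exE conjE) (rule that)
  have cl: "\<forall>t'. \<bar>t' - t\<bar> < 1/4 \<longrightarrow> c t' = c t + (t' - t) *\<^sub>R d" for t
    by (intro allI impI) (rule c_lin)
  let ?F = "\<lambda>(x, t). disks ?j x - c t"
  \<comment> \<open>With v = 4/7 - t/7 and w = t, the equation v = 3/8 + w/8 gives t = 11/15 and v =
    13/24 + w/8 gives t = 1/9. The path parameters 1/8 and 19/24 are those with first coordinate
    3/8.\<close>
  let ?x1 = "lift ?j (1/8) (c (11/15))" and ?x2 = "lift ?j (19/24) (c (1/9))"
  have n: "0 < pieces ?j" "2 < pieces ?j" by (simp_all add: pieces_simps)
  have x1: "piece ?j 0 ?x1 = c (11/15)" "?x1 \<in> interior (slab ?j 0)"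
    unfolding c_def by (rule lift_crossing; use i12 in \<open>simp add: n first_coord_def second_coord_def break_simps\<close>)+
  have x2: "piece ?j 2 ?x2 = c (1/9)" "?x2 \<in> interior (slab ?j 2)"
    unfolding c_def by (rule lift_crossing; use i12 in \<open>simp add: n first_coord_def second_coord_def break_simps\<close>)+
  have num: "0 < (11/15 :: real)" "11/15 < (1 :: real)" "0 < (1/9 :: real)" "1/9 < (1 :: real)" "0 < (1/4 :: real)"
    by simp_all
  obtain r1 where r1: "r1 > 0" "ball (?x1, 11/15::real) r1 \<subseteq> std_ball \<times> {0..1}" "r1 \<le> 1/4"
    "\<forall>p \<in> ball (?x1, 11/15::real) r1. ?F p = lin_prism ?j 0 d (p - (?x1, 11/15::real))"
    using local_form'[where c = c, OF n(1) x1(2) num(1,2,5) cl x1(1)]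
    by (elim exE conjE) (rule that)
  obtain r2 where r2: "r2 > 0" "ball (?x2, 1/9::real) r2 \<subseteq> std_ball \<times> {0..1}" "r2 \<le> 1/4"
    "\<forall>p \<in> ball (?x2, 1/9::real) r2. ?F p = lin_prism ?j 2 d (p - (?x2, 1/9::real))"
    using local_form'[where c = c, OF n(2) x2(2) num(3,4,5) cl x2(1)]
    by (elim exE conjE) (rule that)
  have disj: "ball (?x1, 11/15::real) r1 \<inter> ball (?x2, 1/9::real) r2 = {}"
  proof (rule ccontr)
    assume "ball (?x1, 11/15::real) r1 \<inter> ball (?x2, 1/9::real) r2 \<noteq> {}"
    then obtain p where "dist (?x1, 11/15::real) p < r1" "dist (?x2, 1/9::real) p < r2" by auto
    then have "dist (11/15) (snd p) < 1/4" "dist (1/9) (snd p) < 1/4"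
      using dist_snd_le[of "(?x1, 11/15::real)" p] dist_snd_le[of "(?x2, 1/9::real)" p] r1(3) r2(3) by auto
    then show False by (auto simp: dist_real_def abs_if split: if_splits)
  qed
  have F: "continuous_on (std_ball \<times> {0..1}) ?F"
    using homotopic_with_imp_continuous_maps[OF G(1)[unfolded bd_homotopic_def]] by auto
  have nz: "?F p \<noteq> 0" if pp: "p \<in> std_ball \<times> {0..1} - {(?x1, 11/15::real), (?x2, 1/9::real)}" for p
  proof
    assume z: "?F p = 0"
    obtain x' t' where p: "p = (x', t')" by force
    have xt: "x' \<in> std_ball" "0 \<le> t'" "t' \<le> 1" "(x', t') \<noteq> (?x1, 11/15::real)" "(x', t') \<noteq> (?x2, 1/9::real)" using pp p by auto
    have "disks ?j x' = c t'" using z p by simp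
    then obtain n' where n': "n' < pieces ?j" "sheet_eq ?j n' (c t') = 0" "piece ?j n' x' = c t'"
      by (rule zero_on_sheet[OF xt(1)]) (rule that)
    have "n' = 0 \<or> n' = Suc 0 \<or> n' = 2" using n'(1) by (auto simp: pieces_simps)
    then have "n' = 0 \<and> t' = 11/15 \<or> n' = 2 \<and> t' = 1/9"
      using n'(2) xt(2,3) by (elim disjE; simp add: sheet_eqs c_def crossing_nth; linarith)
    then show False
    proof (elim disjE conjE)
      assume a: "n' = 0" "t' = 11/15"
      have "piece ?j 0 x' = piece ?j 0 ?x1" unfolding x1(1) using n'(3) a by (simp only:)
      then have "x' = ?x1" by (rule inj_piece[OF n(1)])
      then show False using xt(4) a(2) by (simp only:)
    next
      assume a: "n' = 2" "t' = 1/9"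
      have "piece ?j 2 x' = piece ?j 2 ?x2" unfolding x2(1) using n'(3) a by (simp only:)
      then have "x' = ?x2" by (rule inj_piece[OF n(2)])
      then show False using xt(5) a(2) by (simp only:)
    qed
  qed
  have d: "d $ None = 0" "d $ Some i1 = - 1/7" "d $ Some i2 = 1" "\<And>l. l \<noteq> i1 \<Longrightarrow> l \<noteq> i2 \<Longrightarrow> d $ Some l = 0"
    by (simp_all add: d_def c_def crossing_nth)
  \<comment> \<open>Both branches have speed 3 in the coordinate \<open>None\<close>, where the path
    is at rest; so \<open>fst p $ i1\<close> vanishes. The opposite slopes then no longer matter,
    and both maps agree on \<open>p\<close>.\<close>
  have comb: "p = 0" if s: "0 \<le> s" "s \<le> 1" and z: "(1 - s) *\<^sub>R lin_prism ?j 0 d p + s *\<^sub>R lin_prism ?j 2 d p = 0" for s p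
  proof -
    have e: "(1 - s) * (lin ?j 0 (fst p) $ a - snd p * d $ a) + s * (lin ?j 2 (fst p) $ a - snd p * d $ a) = 0" for a
      using arg_cong[OF z, of "\<lambda>y. y $ a"] by (simp add: lin_prism_def)
    have v1: "fst p $ i1 = 0" using e[of None] by (simp add: lin_nth d algebra_simps)
    have v2: "fst p $ i2 = snd p" using e[of "Some i2"] i12 by (simp add: lin_nth d algebra_simps)
    have "snd p = 0" using e[of "Some i1"] by (simp add: lin_nth d v1 v2 field_simps)
    moreover have "fst p $ l = 0" for l
      using e[of "Some l"] v1 v2 \<open>snd p = 0\<close> by (cases "l = i1"; cases "l = i2") (simp_all add: lin_nth d algebra_simps)
    ultimately show ?thesis by (simp add: prod_eq_iff vec_eq_iff)
  qed
  show False
    by (rule two_zeros_essential[OF compact_convex_prism two_le_DIM_Times[OF card] _ F nz linear_lin_prism linear_lin_prism comb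
        r1(2) r2(2) r1(1) r2(1) disj bspec[OF r1(4)] bspec[OF r2(4)] G(1) bspec[OF G(2)]]) auto
qed

section \<open>Separation along paths in the slice\<close>

lemma all_crossing:
  "(\<forall>a. P (crossing v w $ a)) \<longleftrightarrow> P (3/8) \<and> P v \<and> P w \<and> (\<forall>l. l \<noteq> i1 \<longrightarrow> l \<noteq> i2 \<longrightarrow> P (1/2))"
  unfolding split_option_all by (metis crossing_nth(1-4))

lemma crossing_interior: "0 < v \<Longrightarrow> v < 1 \<Longrightarrow> 0 < w \<Longrightarrow> w < 1 \<Longrightarrow> crossing v w \<in> interior std_ball"
  unfolding mem_interior_std_ball using all_crossing[of "\<lambda>x. 0 < x \<and> x < 1" v w] by simp

lemma crossing_frontier:
  assumes "0 \<le> v" "v \<le> 1" "0 \<le> w" "w \<le> 1" "v = 0 \<or> v = 1 \<or> w = 0 \<or> w = 1"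
  shows "crossing v w \<in> std_sphere"
proof -
  have "crossing v w \<in> std_ball" unfolding mem_std_ball using all_crossing[of "\<lambda>x. 0 \<le> x \<and> x \<le> 1" v w] assms by simp
  moreover have "\<exists>a. crossing v w $ a = 0 \<or> crossing v w $ a = 1"
    using assms(5) crossing_nth(2,3) by metis
  ultimately show ?thesis unfolding frontier_std_ball by blast
qed

lemma crossing_affine: "crossing v' w' = crossing v w + k *\<^sub>R (crossing (v + a) (w + b) - crossing v w)"
  if "v' = v + k * a" "w' = w + k * b"
  unfolding vec_eq_iff split_option_all using that by (auto simp: crossing_def)

lemma continuous_crossing:
  assumes "continuous_on S v" "continuous_on S w"
  shows "continuous_on S (\<lambda>t. crossing (v t) (w t))"
proof -
  have "crossing (v t) (w t) = crossing 0 0 + v t *\<^sub>R axis (Some i1) 1 + w t *\<^sub>R axis (Some i2) 1" for t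
    unfolding vec_eq_iff split_option_all using i12 by (auto simp: crossing_def axis_def)
  moreover have "continuous_on S (\<lambda>t. crossing 0 0 + v t *\<^sub>R axis (Some i1) 1 + w t *\<^sub>R axis (Some i2) (1::real))"
    using assms by (intro continuous_intros)
  ultimately show ?thesis by simp
qed

lemma separated_crossings:
  assumes card: "2 \<le> CARD('m option)" and n: "n < pieces j" "\<not> flat j" and t: "0 < t" "t < 1" "e > 0"
    and cont: "continuous_on {0..1} v" "continuous_on {0..1} w"
    and int: "\<And>t. 0 < t \<Longrightarrow> t < 1 \<Longrightarrow> 0 < v t \<and> v t < 1 \<and> 0 < w t \<and> w t < 1"
    and fr: "0 \<le> v 0" "v 0 \<le> 1" "0 \<le> w 0" "w 0 \<le> 1" "v 0 = 0 \<or> v 0 = 1 \<or> w 0 = 0 \<or> w 0 = 1"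
       "0 \<le> v 1" "v 1 \<le> 1" "0 \<le> w 1" "w (1::real) \<le> 1" "v 1 = 0 \<or> v 1 = 1 \<or> w 1 = 0 \<or> w 1 = 1"
    and loc: "\<And>t'. \<bar>t' - t\<bar> < e \<Longrightarrow> v t' = v t + (t' - t) * a \<and> w t' = w t + (t' - t) * b"
    and s: "first_coord j n s = 3/8" "second_coord j n s + (if j = Some i2 then w t/8 else 0) = v t"
      "break j n < s \<and> s < break j (Suc n)"
    and trans: "sheet_eq j n (crossing (v t + a) (w t + b)) \<noteq> 0"
    and uniq: "\<And>t' n'. 0 \<le> t' \<Longrightarrow> t' \<le> 1 \<Longrightarrow> n' < pieces j \<Longrightarrow> sheet_eq j n' (crossing (v t') (w t')) = 0 \<Longrightarrow> n' = n \<and> t' = t"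
  shows "\<not> connected_component (std_ball - image' j) (crossing (v 0) (w 0)) (crossing (v 1) (w 1))"
proof (rule separated_one_crossing[where c = "\<lambda>t. crossing (v t) (w t)" and n = n and t = t and e = e
      and d = "crossing (v t + a) (w t + b) - crossing (v t) (w t)" and x = "lift j s (crossing (v t) (w t))"])
  show "continuous_on {0..1} (\<lambda>t. crossing (v t) (w t))" using cont by (rule continuous_crossing)
  show "\<forall>t. 0 < t \<longrightarrow> t < 1 \<longrightarrow> crossing (v t) (w t) \<in> interior std_ball"
    using int by (intro allI impI crossing_interior) blast+
  show "crossing (v 0) (w 0) \<in> std_sphere" "crossing (v 1) (w 1) \<in> std_sphere"
    by (rule crossing_frontier[OF fr(1-5)], rule crossing_frontier[OF fr(6-10)])
  have vw: "0 < v t" "v t < 1" "0 < w t" "w t < 1" using int[OF t(1,2)] by blast+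
  show "lift j s (crossing (v t) (w t)) \<in> interior (slab j n)" "piece j n (lift j s (crossing (v t) (w t))) = crossing (v t) (w t)"
    by (rule lift_crossing[OF vw n(1) s])+
  show "\<forall>t'. \<bar>t' - t\<bar> < e \<longrightarrow> crossing (v t') (w t') = crossing (v t) (w t) + (t' - t) *\<^sub>R (crossing (v t + a) (w t + b) - crossing (v t) (w t))"
    using loc by (intro allI impI crossing_affine) blast+
  show "sheet_eq j n (crossing (v t) (w t) + (crossing (v t + a) (w t + b) - crossing (v t) (w t))) \<noteq> 0"
    using trans by simp
  show "n' = n \<and> t' = t" if "0 \<le> t'" "t' \<le> 1" "n' < pieces j" "sheet_eq j n' (crossing (v t') (w t')) = 0" for t' n'
    using that by (rule uniq)
qed (use n t card in auto)

lemma separated_loop_vertical: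
  assumes card: "2 \<le> CARD('m option)"
  shows "\<not> connected_component (std_ball - image' (Some i2)) (crossing (4/7) 0) (crossing (4/7) 1)"
proof -
  have u: "n' = 2 \<and> t' = 5/21" if "0 \<le> t'" "t' \<le> 1" "n' < pieces (Some i2)" "sheet_eq (Some i2) n' (crossing (4/7) t') = 0" for t' n'
  proof -
    have "n' = 0 \<or> n' = Suc 0 \<or> n' = 2" using that(3) by (auto simp: pieces_simps)
    then show ?thesis using that by (elim disjE; simp add: sheet_eqs crossing_nth)
  qed
  show ?thesis
    by (rule separated_crossings[where v = "\<lambda>t. 4/7" and w = "\<lambda>t. t" and n = 2 and t = "5/21" and a = 0 and b = 1 and s = "19/24" and e = 1, OF card])
       (use i12 u in \<open>auto simp: pieces_simps flat_def first_coord_def second_coord_def break_simps sheet_eqs crossing_nth intro!: continuous_intros\<close>)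
qed

text \<open>The straight segment would run in the facet w = 0, whereas the path must be interior;
  the tent \<open>min t (1 - t)\<close> pushes it inside. The only crossing is with branch 2, on the
  rising half of the tent.\<close>

lemma separated_loop_horizontal:
  assumes card: "2 \<le> CARD('m option)"
  shows "\<not> connected_component (std_ball - image' (Some i2)) (crossing (4/7) 0) (crossing (3/7) 0)"
proof -
  have u: "n' = 2 \<and> t' = 1/9" if "0 \<le> t'" "t' \<le> 1" "n' < pieces (Some i2)"
    "sheet_eq (Some i2) n' (crossing (4/7 - t'/7) (min t' (1 - t'))) = 0" for t' n'
  proof -
    have "n' = 0 \<or> n' = Suc 0 \<or> n' = 2" using that(3) by (auto simp: pieces_simps)
    then show ?thesis
      using that by (cases "t' \<le> 1 - t'"; elim disjE; simp add: sheet_eqs crossing_nth min_def)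
  qed
  have m: "min t' (1 - t') = t'" if "\<bar>t' - 1/9\<bar> < 1/4" for t' :: real
  proof -
    have "t' \<le> 1 - t'" using that unfolding abs_less_iff by linarith
    then show ?thesis by (simp add: min_def)
  qed
  have "\<not> connected_component (std_ball - image' (Some i2)) (crossing (4/7 - 0/7) (min 0 (1 - 0))) (crossing (4/7 - 1/7) (min 1 (1 - 1)))"
  proof (rule separated_crossings[where v = "\<lambda>t. 4/7 - t/7" and w = "\<lambda>t. min t (1 - t)" and n = 2
      and t = "1/9" and a = "- 1/7" and b = 1 and s = "19/24" and e = "1/4", OF card])
    show "n' = 2 \<and> t' = 1/9" if "0 \<le> t'" "t' \<le> 1" "n' < pieces (Some i2)"
      "sheet_eq (Some i2) n' (crossing (4/7 - t'/7) (min t' (1 - t'))) = 0" for t' n'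
      using that by (rule u)
    show "4/7 - t'/7 = 4/7 - (1/9)/7 + (t' - 1/9) * (- 1/7) \<and> min t' (1 - t') = min (1/9) (1 - 1/9) + (t' - 1/9) * 1"
      if "\<bar>t' - 1/9\<bar> < 1/4" for t' :: real
      using m[OF that] by (simp add: field_simps)
    show "0 < 4/7 - t/7 \<and> 4/7 - t/7 < 1 \<and> 0 < min t (1 - t) \<and> min t (1 - t) < 1" if "0 < t" "t < 1" for t :: real
      using that by simp
    show "continuous_on {0..1} (\<lambda>t. 4/7 - t/7 :: real)" by (auto intro!: continuous_intros)
    show "continuous_on {0..1} (\<lambda>t. min t (1 - t) :: real)"
      by (intro continuous_on_min continuous_intros)
  qed (use i12 in \<open>simp_all add: pieces_simps flat_def first_coord_def second_coord_def break_def sheet_eqs crossing_nth\<close>)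
  then show ?thesis by simp
qed

text \<open>The path follows the line v = w + 1/2, the zero line of the affine function that will
  replace that of the loop. It meets the V only at v = 4/7, w = 1/14.\<close>

lemma separated_vee:
  assumes card: "2 \<le> CARD('m option)"
  shows "\<not> connected_component (std_ball - image' (Some i1)) (crossing (1/2) 0) (crossing 1 (1/2))"
proof -
  have u: "n' = 1 \<and> t' = 1/7" if "0 \<le> t'" "t' \<le> 1" "n' < pieces (Some i1)"
    "sheet_eq (Some i1) n' (crossing (1/2 + t'/2) (t'/2)) = 0" for t' n'
  proof -
    have "n' = 0 \<or> n' = Suc 0" using that(3) by (auto simp: pieces_simps)
    then show ?thesis using that by (elim disjE; simp add: sheet_eqs crossing_nth)
  qed
  have "\<not> connected_component (std_ball - image' (Some i1)) (crossing (1/2 + 0/2) (0/2)) (crossing (1/2 + 1/2) (1/2))"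
    by (rule separated_crossings[where v = "\<lambda>t. 1/2 + t/2" and w = "\<lambda>t. t/2" and n = 1 and t = "1/7" and a = "1/2" and b = "1/2" and s = "9/14" and e = 1, OF card])
       (use i12 u in \<open>auto simp: pieces_simps flat_def first_coord_def second_coord_def break_simps sheet_eqs crossing_nth field_simps intro!: continuous_intros\<close>)
  then show ?thesis by simp
qed

section \<open>The sides of the remaining disks\<close>

definition face_center :: "'m option \<Rightarrow> real \<Rightarrow> real ^ 'm option"
  where "face_center j t = (\<chi> a. if a = j then t else 1/2)"

lemma separated_flat:
  assumes card: "2 \<le> CARD('m option)" and j: "j \<noteq> Some i1" "j \<noteq> Some i2"
  shows "\<not> connected_component (std_ball - image' j) (face_center j 0) (face_center j 1)"
proof -
  let ?k = "if j = None then 3/8 else 1/2 :: real" and ?x = "(\<chi> l. 1/2) :: real ^ 'm"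
  have p: "pieces j = 1" using j by (auto simp: pieces_def)
  have eq: "piece j 0 ?x = face_center j ?k"
  proof (cases "j = None")
    case True
    show ?thesis unfolding True vec_eq_iff split_option_all by (simp add: piece_nth face_center_def)
  next
    case False
    then have "flat j" using j by (simp add: flat_def)
    then show ?thesis using False unfolding vec_eq_iff split_option_all by (auto simp: piece_nth face_center_def)
  qed
  have sh: "sheet_eq j 0 (face_center j t) = 0 \<longleftrightarrow> t = ?k" for t
    using j by (auto simp: sheet_eq_def face_center_def)
  have br: "break j 0 = 0" "break j (Suc 0) = 1" using j by (auto simp: break_def)
  have lin: "face_center j t' = face_center j t + (t' - t) *\<^sub>R (face_center j (t + 1) - face_center j t)" for t t'
    by (auto simp: face_center_def vec_eq_iff)
  show ?thesis
  proof (rule separated_one_crossing[where c = "face_center j" and n = 0 and t = ?k and e = 1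
      and d = "face_center j (?k + 1) - face_center j ?k" and x = ?x])
    have "continuous_on {0..1} (\<lambda>t. face_center j 0 + (t - 0) *\<^sub>R (face_center j (0 + 1) - face_center j 0))"
      by (intro continuous_intros)
    then show "continuous_on {0..1} (face_center j)" by (rule continuous_on_eq) (rule lin[symmetric])
    show "\<forall>t. 0 < t \<longrightarrow> t < 1 \<longrightarrow> face_center j t \<in> interior std_ball"
      unfolding mem_interior_std_ball by (auto simp: face_center_def)
    show "face_center j 0 \<in> std_sphere" "face_center j 1 \<in> std_sphere"
      unfolding frontier_std_ball mem_std_ball by (auto simp: face_center_def intro!: exI[of _ j])
    show "?x \<in> interior (slab j 0)" by (simp add: slab_def interior_cbox mem_box_cart br)
    show "sheet_eq j 0 (face_center j ?k + (face_center j (?k + 1) - face_center j ?k)) \<noteq> 0" using sh[of "?k + 1"] by simp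
    show "n' = 0 \<and> t' = ?k" if "n' < pieces j" "sheet_eq j n' (face_center j t') = 0" for t' n'
      using that p sh[of t'] by auto
    show "\<forall>t'. \<bar>t' - ?k\<bar> < 1 \<longrightarrow> face_center j t' = face_center j ?k + (t' - ?k) *\<^sub>R (face_center j (?k + 1) - face_center j ?k)"
      by (intro allI impI) (rule lin)
  qed (use p eq card in auto)
qed

lemma flat_boundary_value:
  assumes j: "j \<noteq> Some i1" "j \<noteq> Some i2" and y: "y \<in> image' j" "y \<in> std_sphere"
  shows "y $ j = (if j = None then 3/8 else 1/2)"
proof -
  obtain n where "n < pieces j" "sheet_eq j n y = 0" using image'_boundary[OF y] .
  then show ?thesis using j by (auto simp: sheet_eq_def split: if_splits)
qed

text \<open>The face is convex, and boundary points of the image have \<open>j\<close>-th coordinate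
  3/8 or 1/2, so the face misses the image. A defining function thus has one sign on a whole
  face.\<close>

lemma face_connected:
  assumes j: "j \<noteq> Some i1" "j \<noteq> Some i2" and t: "t = 0 \<or> t = 1" and y: "y \<in> std_ball" "y $ j = t"
  shows "connected_component (std_ball - image' j) (face_center j t) y"
proof -
  let ?H = "std_ball \<inter> {y :: real ^ 'm option. axis j 1 \<bullet> y = t}"
  have "convex ?H" by (intro convex_Int convex_box convex_hyperplane)
  then have "connected ?H" by (rule convex_connected)
  moreover have "?H \<subseteq> std_ball - image' j"
  proof
    fix z assume z: "z \<in> ?H"
    then have "z $ j = t" by (simp add: inner_axis')
    then have "z \<in> std_sphere" using z t unfolding frontier_std_ball by blast
    then show "z \<in> std_ball - image' j"
      using flat_boundary_value[OF j, of z] z \<open>z $ j = t\<close> t by (auto split: if_splits)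
  qed
  moreover have "y \<in> ?H" using y by (simp add: inner_axis')
  moreover have "face_center j t \<in> ?H"
    using t unfolding Int_iff mem_std_ball by (auto simp: face_center_def inner_axis')
  ultimately show ?thesis unfolding connected_component_def by blast
qed

text \<open>For the loop this is the point of level 2; for the V it lies between the arms.\<close>

definition base_point :: "'m option \<Rightarrow> real ^ 'm option"
  where "base_point j = (if j = Some i1 then crossing (1/2) 0 else if j = Some i2 then crossing (4/7) 0 else face_center j 1)"

lemma ex_defining_function:
  "\<exists>\<phi> :: real ^ 'm option \<Rightarrow> real. continuous_on std_ball \<phi> \<and> (\<forall>y\<in>std_ball. \<phi> y = 0 \<longleftrightarrow> y \<in> image' j)
     \<and> (\<forall>y\<in>std_ball. \<phi> y > 0 \<longleftrightarrow> connected_component (std_ball - image' j) (base_point j) y)"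
  by (rule signed_distance_function[OF convex_box(1) closed_image' image'_ne, of 0 1 j "base_point j"]) blast

lemma std_sphere_subset: "(std_sphere :: (real ^ 'n) set) \<subseteq> std_ball"
  by (rule frontier_subset_closed) (rule closed_cbox)

lemma separated_point:
  assumes \<phi>: "\<forall>y\<in>std_ball. \<phi> y = 0 \<longleftrightarrow> y \<in> image' j"
     "\<forall>y\<in>std_ball. \<phi> y > (0::real) \<longleftrightarrow> connected_component (std_ball - image' j) (base_point j) y"
    and y: "y \<in> std_sphere" "\<And>n. n < pieces j \<Longrightarrow> sheet_eq j n y \<noteq> 0"
  shows "y = base_point j \<Longrightarrow> \<phi> y > 0"
    "\<not> connected_component (std_ball - image' j) (base_point j) y \<Longrightarrow> \<phi> y < 0"
proof -
  have yb: "y \<in> std_ball" using y(1) std_sphere_subset by blast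
  have ni: "y \<notin> image' j"
  proof
    assume "y \<in> image' j"
    then obtain n where "n < pieces j" "sheet_eq j n y = 0" using image'_boundary y(1) by metis
    then show False using y(2) by blast
  qed
  then have ne: "\<phi> y \<noteq> 0" using \<phi>(1) yb by blast
  show "\<phi> y > 0" if "y = base_point j"
    using \<phi>(2) yb ni connected_component_refl[of y "std_ball - image' j"] that by blast
  show "\<phi> y < 0" if "\<not> connected_component (std_ball - image' j) (base_point j) y"
    using \<phi>(2) yb that ne by force
qed

lemma vee_values:
  assumes "y \<in> image' (Some i1)" "y \<in> std_sphere" "y $ None = 3/8"
  shows "y $ Some i1 = 3/7 \<or> y $ Some i1 = 4/7"
proof -
  obtain n where n: "n < pieces (Some i1)" "sheet_eq (Some i1) n y = 0" using image'_boundary[OF assms(1,2)] .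
  then have "n = 0 \<or> n = Suc 0" by (auto simp: pieces_simps)
  then show ?thesis using n(2) assms(3) by (elim disjE; simp add: sheet_eqs)
qed

lemma loop_avoids_corners:
  assumes "n < pieces (Some i2)" "v = 3/7 \<or> v = 4/7" "w = 0 \<or> w = 1"
  shows "sheet_eq (Some i2) n (crossing v w) \<noteq> 0"
proof -
  have "n = 0 \<or> n = Suc 0 \<or> n = 2" using assms(1) by (auto simp: pieces_simps)
  then show ?thesis using assms(2,3) by (elim disjE; simp add: sheet_eqs crossing_nth)
qed

lemma vee_avoids:
  assumes "n < pieces (Some i1)" "v = 1/2 \<or> v = 1"
  shows "sheet_eq (Some i1) n (crossing v w) \<noteq> 0"
proof -
  have "n = 0 \<or> n = Suc 0" using assms(1) by (auto simp: pieces_simps)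
  then show ?thesis using assms(2) by (elim disjE; simp add: sheet_eqs crossing_nth)
qed

lemma segment_same_sign:
  fixes a b s :: real
  assumes "0 \<le> s" "s \<le> 1" "a > 0 \<and> b > 0 \<or> a < 0 \<and> b < 0"
  shows "(1 - s) * a + s * b \<noteq> 0"
proof (cases "s = 0")
  case False
  then have "s > 0" "1 - s \<ge> 0" using assms by simp_all
  then show ?thesis
    using assms(3) add_nonneg_pos[OF mult_nonneg_nonneg mult_pos_pos, of "1 - s" a s b]
      add_nonpos_neg[OF mult_nonneg_nonpos mult_pos_neg, of "1 - s" a s b] by force
qed (use assms in auto)

lemma segment_same: "(1 - s) * a + s * a = (a::real)"
  by (simp add: algebra_simps)

text \<open>The defining functions are exchanged for affine ones in stages. At a boundary zero of a
  straight homotopy the unchanged components vanish, which leaves four points when the loop is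
  exchanged and two for the V; there it suffices that old and new signs agree. For the other disks
  the sign on a face suffices.\<close>

theorem common_points_nonempty:
  assumes card: "2 \<le> CARD('m option)"
  shows "common_points f' \<noteq> {}"
proof
  assume empty: "common_points f' = {}"
  obtain \<phi> where cont\<phi>: "\<And>j. continuous_on std_ball (\<phi> j)"
    and zero: "\<And>j. \<forall>y\<in>std_ball. \<phi> j y = 0 \<longleftrightarrow> y \<in> image' j"
    and pos: "\<And>j. \<forall>y\<in>std_ball. \<phi> j y > (0::real) \<longleftrightarrow> connected_component (std_ball - image' j) (base_point j) y"
    using choice[of "\<lambda>j \<phi>. continuous_on std_ball \<phi> \<and> (\<forall>y\<in>std_ball. \<phi> y = 0 \<longleftrightarrow> y \<in> image' j)
     \<and> (\<forall>y\<in>std_ball. \<phi> y > 0 \<longleftrightarrow> connected_component (std_ball - image' j) (base_point j) y)"] ex_defining_function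
    by blast
  define \<kappa> :: "'m option \<Rightarrow> real" where "\<kappa> j = (if j = None then 3/8 else 1/2)" for j
  define F0 :: "real ^ 'm option \<Rightarrow> real ^ 'm option" where "F0 y = (\<chi> j. \<phi> j y)" for y
  \<comment> \<open>Among the four points with v = 3/7 or 4/7 and w = 0 or 1, the value v - w - 1/2
    is positive at (4/7, 0) only, exactly like the function of the loop.\<close>
  define F1 where "F1 y = (\<chi> j. if j = Some i2 then y $ Some i1 - y $ Some i2 - 1/2 else \<phi> j y)" for y
  \<comment> \<open>On v = w + 1/2 the boundary points are (1/2, 0) and (1, 1/2), where the function
    of the V is positive and negative; 1/4 - w has the same signs.\<close>
  define F2 where "F2 y = (\<chi> j. if j = Some i2 then y $ Some i1 - y $ Some i2 - 1/2
     else if j = Some i1 then 1/4 - y $ Some i2 else \<phi> j y)" for y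
  define L :: "real ^ 'm option \<Rightarrow> real ^ 'm option" where "L y = (\<chi> j. if j = Some i2 then y $ Some i1 - y $ Some i2
     else if j = Some i1 then - y $ Some i2 else y $ j)" for y
  let ?z = "crossing (3/4) (1/4)"
  define F3 where "F3 y = L (y - ?z)" for y
  have F3: "F3 y $ j = (if j = Some i2 then y $ Some i1 - y $ Some i2 - 1/2
     else if j = Some i1 then 1/4 - y $ Some i2 else y $ j - \<kappa> j)" for y j
    using i12 by (cases j rule: piece_cases) (auto simp: F3_def L_def \<kappa>_def crossing_nth flat_def)
  have L: "linear L" by (rule linearI) (auto simp: L_def vec_eq_iff algebra_simps)
  have L0: "y = 0" if "L y = 0" for y
  proof -
    have e: "L y $ j = 0" for j using that by simp
    have "y $ j = 0" for j
      using e[of j] e[of "Some i1"] e[of "Some i2"] i12 by (cases "j = Some i1"; cases "j = Some i2") (auto simp: L_def)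
    then show ?thesis by (simp add: vec_eq_iff)
  qed
  have cF: "continuous_on std_ball F0" "continuous_on std_ball F1" "continuous_on std_ball F2"
  proof -
    show "continuous_on std_ball F0" unfolding F0_def by (intro continuous_on_vec_lambda cont\<phi>)
    show "continuous_on std_ball F1"
      unfolding F1_def
    proof (rule continuous_on_vec_lambda)
      show "continuous_on std_ball (\<lambda>y. if j = Some i2 then y $ Some i1 - y $ Some i2 - 1/2 else \<phi> j y)" for j
        by (cases "j = Some i2") (auto intro!: continuous_intros cont\<phi>)
    qed
    show "continuous_on std_ball F2"
      unfolding F2_def
    proof (rule continuous_on_vec_lambda)
      show "continuous_on std_ball (\<lambda>y. if j = Some i2 then y $ Some i1 - y $ Some i2 - 1/2
          else if j = Some i1 then 1/4 - y $ Some i2 else \<phi> j y)" for j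
        by (cases "j = Some i2"; cases "j = Some i1") (auto intro!: continuous_intros cont\<phi>)
    qed
  qed
  have cF3: "continuous_on std_ball F3"
    unfolding F3_def by (rule linear_continuous_on_compose[OF _ L]) (intro continuous_intros)
  have zs: "y \<in> image' j" if "\<phi> j y = 0" "y \<in> std_sphere" for y j
    using zero[of j] that std_sphere_subset by blast
  have flat0: "y $ j = \<kappa> j" if "\<phi> j y = 0" "y \<in> std_sphere" "j \<noteq> Some i1" "j \<noteq> Some i2" for y j
    using flat_boundary_value[OF that(3,4) zs[OF that(1,2)] that(2)] by (simp add: \<kappa>_def)
  have sphere: "\<exists>a. y $ a = 0 \<or> y $ a = 1" "0 \<le> y $ a" "y $ a \<le> 1" if "y \<in> std_sphere" for y :: "real ^ 'm option" and a
    using that unfolding frontier_std_ball mem_std_ball by blast+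
  have cross: "y = crossing (y $ Some i1) (y $ Some i2)"
    if "\<And>j. j \<noteq> Some i1 \<Longrightarrow> j \<noteq> Some i2 \<Longrightarrow> y $ j = \<kappa> j" for y
    unfolding eq_crossing_iff using that by (auto simp: \<kappa>_def flat_def)
  have side: "y $ Some i1 = 0 \<or> y $ Some i1 = 1 \<or> y $ Some i2 = 0 \<or> y $ Some i2 = 1"
    if y: "y \<in> std_sphere" and eq: "\<And>j. j \<noteq> Some i1 \<Longrightarrow> j \<noteq> Some i2 \<Longrightarrow> y $ j = \<kappa> j" for y
  proof -
    obtain a where a: "y $ a = 0 \<or> y $ a = 1" using sphere(1)[OF y] by blast
    have "a = Some i1 \<or> a = Some i2"
    proof (rule ccontr)
      assume "\<not> ?thesis"
      then show False using eq[of a] a by (auto simp: \<kappa>_def split: if_splits)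
    qed
    then show ?thesis using a by blast
  qed
  have h1: "bd_homotopic std_ball F1 F0"
  proof (rule bd_homotopic_segment[OF cF(2,1)], rule notI)
    fix y s assume y: "y \<in> std_sphere" and s: "0 \<le> s" "s \<le> (1::real)" and z: "(1 - s) *\<^sub>R F1 y + s *\<^sub>R F0 y = 0"
    have e: "(1 - s) * F1 y $ j + s * F0 y $ j = 0" for j using arg_cong[OF z, of "\<lambda>v. v $ j"] by simp
    have e0: "\<phi> j y = 0" if "j \<noteq> Some i2" for j using e[of j] that by (simp add: F1_def F0_def segment_same)
    have fl: "y $ j = \<kappa> j" if "j \<noteq> Some i1" "j \<noteq> Some i2" for j using flat0[OF e0 y] that by blast
    have v: "y $ Some i1 = 3/7 \<or> y $ Some i1 = 4/7"
      using vee_values[OF zs[OF e0 y] y] i12 fl[of None] by (auto simp: \<kappa>_def)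
    then have w: "y $ Some i2 = 0 \<or> y $ Some i2 = 1" using side[OF y fl] by auto
    have yc: "y = crossing (y $ Some i1) (y $ Some i2)" by (rule cross[OF fl])
    have ns: "sheet_eq (Some i2) n y \<noteq> 0" if "n < pieces (Some i2)" for n
      using loop_avoids_corners[OF that v w] yc by metis
    have bp: "base_point (Some i2) = crossing (4/7) 0" using i12 by (simp add: base_point_def)
    note sp = separated_point[OF zero pos y ns]
    have "(y $ Some i1 - y $ Some i2 - 1/2 > 0 \<and> \<phi> (Some i2) y > 0) \<or> (y $ Some i1 - y $ Some i2 - 1/2 < 0 \<and> \<phi> (Some i2) y < 0)"
    proof (cases "y $ Some i1 = 4/7 \<and> y $ Some i2 = 0")
      case True
      then have "y = base_point (Some i2)" using yc bp by metis
      then show ?thesis using sp(1) True by simp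
    next
      case False
      then consider "y $ Some i1 = 4/7" "y $ Some i2 = 1" | "y $ Some i1 = 3/7" "y $ Some i2 = 0" | "y $ Some i1 = 3/7" "y $ Some i2 = 1"
        using v w by blast
      then show ?thesis
      proof cases
        case 1
        then have "y = crossing (4/7) 1" using yc by metis
        then show ?thesis using sp(2) separated_loop_vertical[OF card] bp 1 by simp
      next
        case 2
        then have "y = crossing (3/7) 0" using yc by metis
        then show ?thesis using sp(2) separated_loop_horizontal[OF card] bp 2 by simp
      next
        case 3
        then have "y = crossing (3/7) 1" using yc by metis
        then show ?thesis using sp(2) separated_loop_two_crossings[OF card] bp 3 by simp
      qed
    qed
    from segment_same_sign[OF s this] show False using e[of "Some i2"] by (simp add: F1_def F0_def)
  qed
  have h2: "bd_homotopic std_ball F2 F1"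
  proof (rule bd_homotopic_segment[OF cF(3,2)], rule notI)
    fix y s assume y: "y \<in> std_sphere" and s: "0 \<le> s" "s \<le> (1::real)" and z: "(1 - s) *\<^sub>R F2 y + s *\<^sub>R F1 y = 0"
    have e: "(1 - s) * F2 y $ j + s * F1 y $ j = 0" for j using arg_cong[OF z, of "\<lambda>v. v $ j"] by simp
    have e0: "\<phi> j y = 0" if "j \<noteq> Some i1" "j \<noteq> Some i2" for j using e[of j] that by (simp add: F2_def F1_def segment_same)
    have fl: "y $ j = \<kappa> j" if "j \<noteq> Some i1" "j \<noteq> Some i2" for j using flat0[OF e0 y] that by blast
    have vw: "y $ Some i1 = y $ Some i2 + 1/2" using e[of "Some i2"] by (simp add: F2_def F1_def segment_same)
    have yc: "y = crossing (y $ Some i1) (y $ Some i2)" by (rule cross[OF fl])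
    have c: "y $ Some i1 = 1/2 \<and> y $ Some i2 = 0 \<or> y $ Some i1 = 1 \<and> y $ Some i2 = 1/2"
      using side[OF y fl] vw sphere(2,3)[OF y, of "Some i1"] sphere(2,3)[OF y, of "Some i2"] by auto
    have ns: "sheet_eq (Some i1) n y \<noteq> 0" if "n < pieces (Some i1)" for n
      using vee_avoids[OF that, of "y $ Some i1" "y $ Some i2"] c yc by auto
    have bp: "base_point (Some i1) = crossing (1/2) 0" by (simp add: base_point_def)
    note sp = separated_point[OF zero pos y ns]
    have "(1/4 - y $ Some i2 > 0 \<and> \<phi> (Some i1) y > 0) \<or> (1/4 - y $ Some i2 < 0 \<and> \<phi> (Some i1) y < 0)"
      using c
    proof
      assume c: "y $ Some i1 = 1/2 \<and> y $ Some i2 = 0"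
      then have "y = base_point (Some i1)" using yc bp by metis
      then show ?thesis using sp(1) c by simp
    next
      assume c: "y $ Some i1 = 1 \<and> y $ Some i2 = 1/2"
      then have "y = crossing 1 (1/2)" using yc by metis
      then show ?thesis using sp(2) separated_vee[OF card] bp c by simp
    qed
    from segment_same_sign[OF s this] show False using e[of "Some i1"] i12 by (simp add: F2_def F1_def)
  qed
  have h3: "bd_homotopic std_ball F3 F2"
  proof (rule bd_homotopic_segment[OF cF3 cF(3)], rule notI)
    fix y s assume y: "y \<in> std_sphere" and s: "0 \<le> s" "s \<le> (1::real)" and z: "(1 - s) *\<^sub>R F3 y + s *\<^sub>R F2 y = 0"
    have e: "(1 - s) * F3 y $ j + s * F2 y $ j = 0" for j using arg_cong[OF z, of "\<lambda>v. v $ j"] by simp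
    have w: "y $ Some i2 = 1/4" using e[of "Some i1"] i12 by (simp add: F2_def F3 segment_same)
    have v: "y $ Some i1 = 3/4" using e[of "Some i2"] w by (simp add: F2_def F3 segment_same)
    \<comment> \<open>Since v = 3/4 and w = 1/4 are inside the unit interval, the face containing
      \<open>y\<close> belongs to a disk other than the V and the loop.\<close>
    obtain a where a: "y $ a = 0 \<or> y $ a = 1" using sphere(1)[OF y] by blast
    have aj: "a \<noteq> Some i1" "a \<noteq> Some i2" using a v w by auto
    have yb: "y \<in> std_ball" using y std_sphere_subset by blast
    have bp: "base_point a = face_center a 1" using aj by (simp add: base_point_def)
    have "(y $ a - \<kappa> a > 0 \<and> \<phi> a y > 0) \<or> (y $ a - \<kappa> a < 0 \<and> \<phi> a y < 0)"
      using a
    proof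
      assume 1: "y $ a = 1"
      then have "\<phi> a y > 0" using pos[of a] yb face_connected[OF aj _ yb, of 1] bp by simp
      then show ?thesis using 1 by (simp add: \<kappa>_def)
    next
      assume 0: "y $ a = 0"
      have con: "connected_component (std_ball - image' a) (face_center a 0) y"
        using face_connected[OF aj _ yb, of 0] 0 by simp
      have "\<not> connected_component (std_ball - image' a) (face_center a 1) y"
        using separated_flat[OF card aj] con by (meson connected_component_sym connected_component_trans)
      then have "\<not> \<phi> a y > 0" using pos[of a] yb bp by simp
      moreover have "\<phi> a y \<noteq> 0"
        using flat0[OF _ y aj] 0 by (auto simp: \<kappa>_def split: if_splits)
      ultimately show ?thesis using 0 by (simp add: \<kappa>_def)
    qed
    from segment_same_sign[OF s this] show False using e[of a] aj by (simp add: F2_def F3)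
  qed
  have nz: "F0 y \<noteq> 0" if "y \<in> std_ball" for y
  proof
    assume "F0 y = 0"
    then have "\<phi> j y = 0" for j by (simp add: F0_def vec_eq_iff)
    then have "y \<in> image' j" for j using zero[of j] that by blast
    then have "y \<in> common_points f'" unfolding common_points_def image'_def by blast
    then show False using empty by blast
  qed
  have zi: "?z \<in> interior std_ball" by (rule crossing_interior) simp_all
  then obtain e where e: "e > 0" "ball ?z e \<subseteq> std_ball"
    by (meson interior_subset mem_interior)
  have "F3 x \<noteq> 0" if "x \<in> std_ball - {?z}" for x
    using L0[of "x - ?z"] that unfolding F3_def by auto
  moreover have "inj L" using L L0 linear_injective_0 by blast
  moreover have "bd_homotopic std_ball F3 F0" using h1 h2 h3 bd_homotopic_trans by blast
  ultimately show False
    using one_zero_essential[of std_ball F3 ?z L e F0] nz L cF3 e card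
    by (simp add: F3_def[abs_def])
qed

end

lemma continuous_on_PL_disks:
  assumes "PL_disks_map K f"
  shows "continuous_on std_ball (f j)"
proof -
  have K: "cell_complex (K j)" "\<Union>(K j) = std_ball" "\<And>C. C \<in> K j \<Longrightarrow> affine_map_on C (f j)"
    using assms unfolding PL_disks_map_def by blast+
  have "continuous_on (\<Union>C\<in>K j. C) (f j)"
  proof (rule continuous_on_closed_Union)
    show "finite (K j)" using K(1) unfolding cell_complex_def by blast
    show "closed C" if "C \<in> K j" for C
      using K(1) that unfolding cell_complex_def by (blast intro: polytope_imp_closed)
    show "continuous_on C (f j)" if C: "C \<in> K j" for C
    proof -
      obtain L c where L: "linear L" "\<And>x. x \<in> C \<Longrightarrow> f j x = L x + c"
        using K(3)[OF C] unfolding affine_map_on_def by (elim exE conjE) (rule that, auto)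
      have "continuous_on C (\<lambda>x. L x + c)"
        by (intro continuous_on_add continuous_on_const linear_continuous_on L(1)[unfolded linear_conv_bounded_linear])
      then show ?thesis by (rule continuous_on_eq) (simp add: L(2))
    qed
  qed
  then show ?thesis using K(2) by simp
qed

theorem theorem1p10:
  fixes r :: nat
  assumes "r \<ge> 3" and "CARD('m::finite option) = r"
  shows "\<exists>f :: 'm disks_map.
    proper_disks_map f \<and> general_position_PL f \<and> algebraic_intersection_number f = 0 \<and>
    \<not> (\<exists>f' :: 'm disks_map.
         proper_disks_map f' \<and> general_position_PL f' \<and>
         (\<forall>j. \<forall>x\<in>std_sphere. f' j x = f j x) \<and>
         common_points f' = {})"
proof -
  have "\<not> CARD('m) \<le> Suc 0" using assms by simp
  then obtain i1 i2 :: 'm where i12: "i1 \<noteq> i2"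
    using card_le_Suc0_iff_eq[of "UNIV :: 'm set"] by auto
  interpret two_axes i1 i2 using i12 by unfold_locales
  show ?thesis
  proof (intro exI[of _ disks] conjI notI)
    show "proper_disks_map disks" by (rule proper_disks)
    show "general_position_PL disks" by (rule general_position_PL_disks)
    show "algebraic_intersection_number disks = 0" by (rule algebraic_intersection_number_disks)
    assume "\<exists>f' :: 'm disks_map. proper_disks_map f' \<and> general_position_PL f' \<and>
         (\<forall>j. \<forall>x\<in>std_sphere. f' j x = disks j x) \<and> common_points f' = {}"
    then obtain f' :: "'m disks_map" where f': "proper_disks_map f'" "general_position_PL f'"
      "\<forall>j. \<forall>x\<in>std_sphere. f' j x = disks j x" "common_points f' = {}" by (elim exE conjE)
    obtain K where "PL_disks_map K f'" using f'(2) unfolding general_position_PL_def by blast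
    then have "avoiding_disks i1 i2 f'"
      using f' i12 continuous_on_PL_disks by unfold_locales auto
    then have "common_points f' \<noteq> {}"
      using assms by (intro avoiding_disks.common_points_nonempty) auto
    then show False using f'(4) by contradiction
  qed
qed

end
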